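(* Let $(X,G)$ be a Borel-overt componentwise quasi-Polish groupoid. Then for each connected component $C$ of $G$, the componentwise topologies $\mathcal{O}_G(C)$ on $C$ and $\mathcal{O}_G(G|_C)$ on $G|_C=\sigma^{-1}(C)$ are the unique second-countable topologies $\mathcal{O}(C)\subseteq\mathcal{B}(C)$ and $\mathcal{O}(G|_C)\subseteq\mathcal{B}(G)$ turning $(C,G|_C)$ into an open topological groupoid such that (i) $\mathcal{O}(G|_C)$ induces on each $\sigma^{-1}(x)$, $x\in C$, the originally given fiberwise topology; (ii) $\mathcal{O}(C)$ generates the Borel $\sigma$-algebra $\mathcal{B}(C)$; and (iii) $C$ is nonmeager in itself with respect to $\mathcal{O}(C)$.
   Context: Quasi-Polish space: homeomorphic to a $\mathbf{\Pi}^0_2$ subspace of $\mathbb{S}^{\mathbb{N}}$ ($\mathbb{S}$ the Sierpiński space). A groupoid $(X,G)$ has source/target $\sigma,\tau$, multiplication $\mu(g,h)=gh$ on $G\times_XG=\{(g,h):\sigma(g)=\tau(h)\}$, identities, inverses; standard Borel if spaces standard Borel and operations Borel. A standard Borel-overt fiberwise quasi-Polish groupoid is a standard Borel groupoid with a quasi-Polish topology on each $\sigma^{-1}(x)$ such that right translations $h\mapsto hg$ are homeomorphisms $\sigma^{-1}(y)\to\sigma^{-1}(x)$ for $g:x\to y$, some countable family of Borel sets restricts to a basis of every $\sigma^{-1}(x)$, and $\sigma(U)$ is Borel for each Borel $U\subseteq G$ with all $U\cap\sigma^{-1}(x)$ open. The $\tau$-fiberwise topology on $\tau^{-1}(y)$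 is transported from $\sigma^{-1}(y)$ by inversion. It is a Borel-overt componentwise quasi-Polish groupoid if moreover for all $x,y\in X$ the multiplication $\tau^{-1}(y)\times_X\sigma^{-1}(x)\to\sigma^{-1}(x)$ is continuous for the product of the $\tau$-fiberwise and $\sigma$-fiberwise topologies. Connected components: $[x]_G=\tau(\sigma^{-1}(x))$. Componentwise topology $\mathcal{O}_G(C)$ on $C=[x]_G$: quotient topology of $\sigma^{-1}(x)$ under $\tau$. Componentwise topology on morphisms: $U\subseteq G$ is open iff $\mu^{-1}(U)$ is a union of sets $(V\times W)\cap(G\times_XG)$ with $V$ $\sigma$-fiberwise open and $W$ $\tau$-fiberwise open; $\mathcal{O}_G(G|_C)$ is its restriction to $G|_C$. An open topological groupoid is one with topologies making all operations continuous and $\sigma$ open. *)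

theory Defs
  imports "HOL-Analysis.Analysis"
begin

section \<open>Quasi-Polish spaces, standard Borel spaces, category\<close>

definition sierpinski_space :: "bool topology" where
  "sierpinski_space = topology (\<lambda>U. U \<in> {{}, {True}, UNIV})"

lemma openin_sierpinski_space: "openin sierpinski_space U \<longleftrightarrow> U \<in> {{}, {True}, UNIV}"
proof -
  have "U \<in> {{}, {True}, UNIV} \<longleftrightarrow> (False \<in> U \<longrightarrow> True \<in> U)" for U :: "bool set"
    by (auto simp: UNIV_bool) (metis (full_types) empty_iff insert_iff)+
  then have "istopology (\<lambda>U :: bool set. U \<in> {{}, {True}, UNIV})"
    unfolding istopology_def by blast
  then show ?thesis
    unfolding sierpinski_space_def by (simp only: topology_inverse')
qed

text \<open>\<open>\<Pi>\<^sup>0\<^sub>2\<close> sets in the sense appropriate for non-metrizable spaces, where open sets need not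
  be countable unions of closed sets: complements of countable unions of differences of open sets.\<close>

definition pi02_in :: "'a topology \<Rightarrow> 'a set \<Rightarrow> bool" where
  "pi02_in T A \<longleftrightarrow> (\<exists>U V :: nat \<Rightarrow> 'a set. (\<forall>n. openin T (U n) \<and> openin T (V n)) \<and>
     A = topspace T - (\<Union>n. U n - V n))"

definition quasi_polish_space :: "'a topology \<Rightarrow> bool" where
  "quasi_polish_space T \<longleftrightarrow>
     (\<exists>A. pi02_in (product_topology (\<lambda>_::nat. sierpinski_space) UNIV) A \<and>
       T homeomorphic_space subtopology (product_topology (\<lambda>_::nat. sierpinski_space) UNIV) A)"

definition standard_borel_space :: "'a measure \<Rightarrow> bool" where
  "standard_borel_space M \<longleftrightarrow>
     (\<exists>T. topspace T = space M \<and> completely_metrizable_space T \<and> second_countable T \<and>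
       sets M = sigma_sets (space M) {U. openin T U})"

definition nowhere_dense_in :: "'a topology \<Rightarrow> 'a set \<Rightarrow> bool" where
  "nowhere_dense_in T A \<longleftrightarrow> A \<subseteq> topspace T \<and> T interior_of (T closure_of A) = {}"

definition meager_in :: "'a topology \<Rightarrow> 'a set \<Rightarrow> bool" where
  "meager_in T A \<longleftrightarrow> (\<exists>N :: nat \<Rightarrow> 'a set. (\<forall>n. nowhere_dense_in T (N n)) \<and> A = (\<Union>n. N n))"

definition quotient_topology :: "'a topology \<Rightarrow> ('a \<Rightarrow> 'b) \<Rightarrow> 'b topology" where
  "quotient_topology T f =
     topology (\<lambda>U. U \<subseteq> f ` topspace T \<and> openin T {x \<in> topspace T. f x \<in> U})"

lemma openin_quotient_topology:
  "openin (quotient_topology T f) U \<longleftrightarrow>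
     U \<subseteq> f ` topspace T \<and> openin T {x \<in> topspace T. f x \<in> U}"
proof -
  have "istopology (\<lambda>U. U \<subseteq> f ` topspace T \<and> openin T {x \<in> topspace T. f x \<in> U})"
    unfolding istopology_def
  proof (intro conjI allI impI; (elim conjE)?)
    fix S U assume "S \<subseteq> f ` topspace T" then show "S \<inter> U \<subseteq> f ` topspace T" by blast
  next
    fix S U assume "openin T {x \<in> topspace T. f x \<in> S}" "openin T {x \<in> topspace T. f x \<in> U}"
    then have "openin T ({x \<in> topspace T. f x \<in> S} \<inter> {x \<in> topspace T. f x \<in> U})" by blast
    also have "{x \<in> topspace T. f x \<in> S} \<inter> {x \<in> topspace T. f x \<in> U}
        = {x \<in> topspace T. f x \<in> S \<inter> U}" by blast
    finally show "openin T {x \<in> topspace T. f x \<in> S \<inter> U}" .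
  next
    fix K assume "\<forall>S\<in>K. S \<subseteq> f ` topspace T \<and> openin T {x \<in> topspace T. f x \<in> S}"
    then show "\<Union>K \<subseteq> f ` topspace T" by blast
  next
    fix K assume K: "\<forall>S\<in>K. S \<subseteq> f ` topspace T \<and> openin T {x \<in> topspace T. f x \<in> S}"
    have "{x \<in> topspace T. f x \<in> \<Union>K} = \<Union>((\<lambda>S. {x \<in> topspace T. f x \<in> S}) ` K)" by blast
    moreover have "openin T (\<Union>((\<lambda>S. {x \<in> topspace T. f x \<in> S}) ` K))"
      using K by (intro openin_Union) blast
    ultimately show "openin T {x \<in> topspace T. f x \<in> \<Union>K}" by simp
  qed
  then show ?thesis
    unfolding quotient_topology_def by (simp only: topology_inverse')
qed

section \<open>Groupoids\<close>

text \<open>The product \<open>mul \<G> g h\<close> is meaningful when \<open>src \<G> g = tgt \<G> h\<close>.\<close>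

record ('x, 'g) groupoid =
  obj :: "'x set"
  arr :: "'g set"
  src :: "'g \<Rightarrow> 'x"
  tgt :: "'g \<Rightarrow> 'x"
  mul :: "'g \<Rightarrow> 'g \<Rightarrow> 'g"
  idt :: "'x \<Rightarrow> 'g"
  ivs :: "'g \<Rightarrow> 'g"

definition composable :: "('x, 'g) groupoid \<Rightarrow> ('g \<times> 'g) set" where
  "composable \<G> = {(g, h). g \<in> arr \<G> \<and> h \<in> arr \<G> \<and> src \<G> g = tgt \<G> h}"

definition src_fiber :: "('x, 'g) groupoid \<Rightarrow> 'x \<Rightarrow> 'g set" where
  "src_fiber \<G> x = {g \<in> arr \<G>. src \<G> g = x}"

definition tgt_fiber :: "('x, 'g) groupoid \<Rightarrow> 'x \<Rightarrow> 'g set" where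
  "tgt_fiber \<G> y = {g \<in> arr \<G>. tgt \<G> g = y}"

definition component :: "('x, 'g) groupoid \<Rightarrow> 'x \<Rightarrow> 'x set" where
  "component \<G> x = tgt \<G> ` src_fiber \<G> x"

definition restrict_groupoid :: "('x, 'g) groupoid \<Rightarrow> 'x set \<Rightarrow> ('x, 'g) groupoid" where
  "restrict_groupoid \<G> C = \<G>\<lparr>obj := C, arr := {g \<in> arr \<G>. src \<G> g \<in> C}\<rparr>"

locale groupoid =
  fixes \<G> :: "('x, 'g) groupoid"
  assumes src_in: "g \<in> arr \<G> \<Longrightarrow> src \<G> g \<in> obj \<G>"
    and tgt_in: "g \<in> arr \<G> \<Longrightarrow> tgt \<G> g \<in> obj \<G>"
    and mul_in: "(g, h) \<in> composable \<G> \<Longrightarrow> mul \<G> g h \<in> arr \<G>"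
    and src_mul: "(g, h) \<in> composable \<G> \<Longrightarrow> src \<G> (mul \<G> g h) = src \<G> h"
    and tgt_mul: "(g, h) \<in> composable \<G> \<Longrightarrow> tgt \<G> (mul \<G> g h) = tgt \<G> g"
    and mul_assoc: "(g, h) \<in> composable \<G> \<Longrightarrow> (h, k) \<in> composable \<G> \<Longrightarrow>
          mul \<G> (mul \<G> g h) k = mul \<G> g (mul \<G> h k)"
    and idt_in: "x \<in> obj \<G> \<Longrightarrow> idt \<G> x \<in> arr \<G>"
    and src_idt: "x \<in> obj \<G> \<Longrightarrow> src \<G> (idt \<G> x) = x"
    and tgt_idt: "x \<in> obj \<G> \<Longrightarrow> tgt \<G> (idt \<G> x) = x"
    and mul_idt_left: "g \<in> arr \<G> \<Longrightarrow> mul \<G> (idt \<G> (tgt \<G> g)) g = g"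
    and mul_idt_right: "g \<in> arr \<G> \<Longrightarrow> mul \<G> g (idt \<G> (src \<G> g)) = g"
    and ivs_in: "g \<in> arr \<G> \<Longrightarrow> ivs \<G> g \<in> arr \<G>"
    and src_ivs: "g \<in> arr \<G> \<Longrightarrow> src \<G> (ivs \<G> g) = tgt \<G> g"
    and tgt_ivs: "g \<in> arr \<G> \<Longrightarrow> tgt \<G> (ivs \<G> g) = src \<G> g"
    and mul_ivs_left: "g \<in> arr \<G> \<Longrightarrow> mul \<G> (ivs \<G> g) g = idt \<G> (src \<G> g)"
    and mul_ivs_right: "g \<in> arr \<G> \<Longrightarrow> mul \<G> g (ivs \<G> g) = idt \<G> (tgt \<G> g)"

locale open_topological_groupoid = groupoid \<G>
  for \<G> :: "('x, 'g) groupoid" and TX :: "'x topology" and TG :: "'g topology" +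
  assumes topspace_obj: "topspace TX = obj \<G>"
    and topspace_arr: "topspace TG = arr \<G>"
    and continuous_src: "continuous_map TG TX (src \<G>)"
    and continuous_tgt: "continuous_map TG TX (tgt \<G>)"
    and continuous_mul: "continuous_map (subtopology (prod_topology TG TG) (composable \<G>)) TG
          (\<lambda>(g, h). mul \<G> g h)"
    and continuous_idt: "continuous_map TX TG (idt \<G>)"
    and continuous_ivs: "continuous_map TG TG (ivs \<G>)"
    and open_src: "open_map TG TX (src \<G>)"

text \<open>Of the measures \<open>BX\<close> and \<open>BG\<close> only the underlying measurable spaces matter.\<close>

locale standard_borel_groupoid = groupoid \<G>
  for \<G> :: "('x, 'g) groupoid" and BX :: "'x measure" and BG :: "'g measure" +
  assumes space_obj: "space BX = obj \<G>"
    and space_arr: "space BG = arr \<G>"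
    and standard_borel_obj: "standard_borel_space BX"
    and standard_borel_arr: "standard_borel_space BG"
    and borel_src: "src \<G> \<in> measurable BG BX"
    and borel_tgt: "tgt \<G> \<in> measurable BG BX"
    and borel_mul: "(\<lambda>(g, h). mul \<G> g h) \<in>
          measurable (restrict_space (BG \<Otimes>\<^sub>M BG) (composable \<G>)) BG"
    and borel_idt: "idt \<G> \<in> measurable BX BG"
    and borel_ivs: "ivs \<G> \<in> measurable BG BG"

section \<open>Fiberwise and componentwise topologies\<close>

text \<open>A family \<open>F\<close> of topologies gives for each object \<open>x\<close> a topology \<open>F x\<close> on \<open>src_fiber \<G> x\<close>.\<close>

definition tgt_fiber_topology ::
  "('x, 'g) groupoid \<Rightarrow> ('x \<Rightarrow> 'g topology) \<Rightarrow> 'x \<Rightarrow> 'g topology" where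
  "tgt_fiber_topology \<G> F y = pullback_topology (tgt_fiber \<G> y) (ivs \<G>) (F y)"

definition src_fiberwise_open ::
  "('x, 'g) groupoid \<Rightarrow> ('x \<Rightarrow> 'g topology) \<Rightarrow> 'g set \<Rightarrow> bool" where
  "src_fiberwise_open \<G> F V \<longleftrightarrow>
     V \<subseteq> arr \<G> \<and> (\<forall>x\<in>obj \<G>. openin (F x) (V \<inter> src_fiber \<G> x))"

definition tgt_fiberwise_open ::
  "('x, 'g) groupoid \<Rightarrow> ('x \<Rightarrow> 'g topology) \<Rightarrow> 'g set \<Rightarrow> bool" where
  "tgt_fiberwise_open \<G> F W \<longleftrightarrow>
     W \<subseteq> arr \<G> \<and> (\<forall>y\<in>obj \<G>. openin (tgt_fiber_topology \<G> F y) (W \<inter> tgt_fiber \<G> y))"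

locale borel_overt_fiberwise_quasi_polish_groupoid = standard_borel_groupoid \<G> BX BG
  for \<G> :: "('x, 'g) groupoid" and BX :: "'x measure" and BG :: "'g measure" +
  fixes F :: "'x \<Rightarrow> 'g topology"
  assumes topspace_fiber: "x \<in> obj \<G> \<Longrightarrow> topspace (F x) = src_fiber \<G> x"
    and quasi_polish_fiber: "x \<in> obj \<G> \<Longrightarrow> quasi_polish_space (F x)"
    and right_translation: "g \<in> arr \<G> \<Longrightarrow>
          homeomorphic_map (F (tgt \<G> g)) (F (src \<G> g)) (\<lambda>h. mul \<G> h g)"
    and countable_borel_fiberwise_basis: "\<exists>\<U>. countable \<U> \<and> \<U> \<subseteq> sets BG \<and>
          (\<forall>x\<in>obj \<G>. (\<forall>U\<in>\<U>. openin (F x) (U \<inter> src_fiber \<G> x)) \<and>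
             (\<forall>V g. openin (F x) V \<and> g \<in> V \<longrightarrow>
                (\<exists>U\<in>\<U>. g \<in> U \<inter> src_fiber \<G> x \<and> U \<inter> src_fiber \<G> x \<subseteq> V)))"
    and borel_overt: "U \<in> sets BG \<Longrightarrow> src_fiberwise_open \<G> F U \<Longrightarrow> src \<G> ` U \<in> sets BX"

locale borel_overt_componentwise_quasi_polish_groupoid =
  borel_overt_fiberwise_quasi_polish_groupoid \<G> BX BG F
  for \<G> :: "('x, 'g) groupoid" and BX :: "'x measure" and BG :: "'g measure"
    and F :: "'x \<Rightarrow> 'g topology" +
  assumes continuous_mul_fiber: "x \<in> obj \<G> \<Longrightarrow> y \<in> obj \<G> \<Longrightarrow>
    continuous_map
      (subtopology (prod_topology (tgt_fiber_topology \<G> F y) (F x)) (composable \<G>))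
      (F x) (\<lambda>(g, h). mul \<G> g h)"

text \<open>The topology on the component of \<open>x\<close>; right translations being homeomorphisms, it does not
  depend on the choice of \<open>x\<close> in the component.\<close>

definition component_topology ::
  "('x, 'g) groupoid \<Rightarrow> ('x \<Rightarrow> 'g topology) \<Rightarrow> 'x \<Rightarrow> 'x topology" where
  "component_topology \<G> F x = quotient_topology (F x) (tgt \<G>)"

definition fiberwise_rectangle ::
  "('x, 'g) groupoid \<Rightarrow> ('x \<Rightarrow> 'g topology) \<Rightarrow> ('g \<times> 'g) set \<Rightarrow> bool" where
  "fiberwise_rectangle \<G> F R \<longleftrightarrow> (\<exists>V W. src_fiberwise_open \<G> F V \<and> tgt_fiberwise_open \<G> F W \<and>
     R = (V \<times> W) \<inter> composable \<G>)"

definition arr_topology ::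
  "('x, 'g) groupoid \<Rightarrow> ('x \<Rightarrow> 'g topology) \<Rightarrow> 'g topology" where
  "arr_topology \<G> F = topology (\<lambda>U. U \<subseteq> arr \<G> \<and>
     (arbitrary union_of fiberwise_rectangle \<G> F) {(g, h) \<in> composable \<G>. mul \<G> g h \<in> U})"

lemma openin_arr_topology:
  "openin (arr_topology \<G> F) U \<longleftrightarrow> U \<subseteq> arr \<G> \<and>
     (arbitrary union_of fiberwise_rectangle \<G> F) {(g, h) \<in> composable \<G>. mul \<G> g h \<in> U}"
proof -
  let ?P = "\<lambda>U. {(g, h) \<in> composable \<G>. mul \<G> g h \<in> U}"
  have src: "src_fiberwise_open \<G> F (V \<inter> V')"
    if "src_fiberwise_open \<G> F V" "src_fiberwise_open \<G> F V'" for V V'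
    unfolding src_fiberwise_open_def
  proof (intro conjI ballI)
    fix x assume "x \<in> obj \<G>"
    then have "openin (F x) ((V \<inter> src_fiber \<G> x) \<inter> (V' \<inter> src_fiber \<G> x))"
      using that by (auto simp: src_fiberwise_open_def)
    then show "openin (F x) (V \<inter> V' \<inter> src_fiber \<G> x)" by (simp add: Int_ac)
  qed (use that in \<open>auto simp: src_fiberwise_open_def\<close>)
  have tgt: "tgt_fiberwise_open \<G> F (W \<inter> W')"
    if "tgt_fiberwise_open \<G> F W" "tgt_fiberwise_open \<G> F W'" for W W'
    unfolding tgt_fiberwise_open_def
  proof (intro conjI ballI)
    fix y assume "y \<in> obj \<G>"
    then have "openin (tgt_fiber_topology \<G> F y) ((W \<inter> tgt_fiber \<G> y) \<inter> (W' \<inter> tgt_fiber \<G> y))"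
      using that by (auto simp: tgt_fiberwise_open_def)
    then show "openin (tgt_fiber_topology \<G> F y) (W \<inter> W' \<inter> tgt_fiber \<G> y)" by (simp add: Int_ac)
  qed (use that in \<open>auto simp: tgt_fiberwise_open_def\<close>)
  have rect: "fiberwise_rectangle \<G> F (R \<inter> R')"
    if RR': "fiberwise_rectangle \<G> F R" "fiberwise_rectangle \<G> F R'" for R R'
  proof -
    obtain V W V' W' where *: "src_fiberwise_open \<G> F V" "tgt_fiberwise_open \<G> F W"
      "src_fiberwise_open \<G> F V'" "tgt_fiberwise_open \<G> F W'"
      and R: "R = (V \<times> W) \<inter> composable \<G>" "R' = (V' \<times> W') \<inter> composable \<G>"
      using RR' unfolding fiberwise_rectangle_def by blast
    have "R \<inter> R' = ((V \<inter> V') \<times> (W \<inter> W')) \<inter> composable \<G>" unfolding R by blast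
    then show ?thesis
      unfolding fiberwise_rectangle_def using src[OF *(1,3)] tgt[OF *(2,4)] by blast
  qed
  have Int: "(arbitrary union_of fiberwise_rectangle \<G> F) (A \<inter> B)"
    if "(arbitrary union_of fiberwise_rectangle \<G> F) A"
       "(arbitrary union_of fiberwise_rectangle \<G> F) B" for A B
  proof -
    have "\<forall>S T. fiberwise_rectangle \<G> F S \<and> fiberwise_rectangle \<G> F T \<longrightarrow>
        (arbitrary union_of fiberwise_rectangle \<G> F) (S \<inter> T)"
      by (intro allI impI arbitrary_union_of_inc rect) (elim conjE, assumption)+
    from arbitrary_union_of_Int_eq[THEN iffD2, OF this] that show ?thesis by iprover
  qed
  have "istopology (\<lambda>U. U \<subseteq> arr \<G> \<and> (arbitrary union_of fiberwise_rectangle \<G> F) (?P U))"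
    unfolding istopology_def
  proof (intro conjI allI impI; (elim conjE)?)
    fix S U assume "S \<subseteq> arr \<G>" then show "S \<inter> U \<subseteq> arr \<G>" by blast
  next
    fix S U assume "(arbitrary union_of fiberwise_rectangle \<G> F) (?P S)"
      "(arbitrary union_of fiberwise_rectangle \<G> F) (?P U)"
    then have "(arbitrary union_of fiberwise_rectangle \<G> F) (?P S \<inter> ?P U)" by (rule Int)
    also have "?P S \<inter> ?P U = ?P (S \<inter> U)" by auto
    finally show "(arbitrary union_of fiberwise_rectangle \<G> F) (?P (S \<inter> U))" .
  next
    fix K assume "\<forall>S\<in>K. S \<subseteq> arr \<G> \<and> (arbitrary union_of fiberwise_rectangle \<G> F) (?P S)"
    then show "\<Union>K \<subseteq> arr \<G>" by blast
  next
    fix K assume K: "\<forall>S\<in>K. S \<subseteq> arr \<G> \<and> (arbitrary union_of fiberwise_rectangle \<G> F) (?P S)"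
    have "(arbitrary union_of fiberwise_rectangle \<G> F) (\<Union>(?P ` K))"
      using K by (intro arbitrary_union_of_Union) (erule imageE, simp)
    moreover have "\<Union>(?P ` K) = ?P (\<Union>K)" by auto
    ultimately show "(arbitrary union_of fiberwise_rectangle \<G> F) (?P (\<Union>K))" by simp
  qed
  then show ?thesis
    unfolding arr_topology_def by (simp only: topology_inverse')
qed

definition component_arr_topology ::
  "('x, 'g) groupoid \<Rightarrow> ('x \<Rightarrow> 'g topology) \<Rightarrow> 'x set \<Rightarrow> 'g topology" where
  "component_arr_topology \<G> F C = subtopology (arr_topology \<G> F) (arr (restrict_groupoid \<G> C))"

text \<open>\<open>\<B>(C)\<close> is the trace of the Borel sets of objects on \<open>C\<close>.\<close>

definition compatible_component_topologies ::
  "('x, 'g) groupoid \<Rightarrow> 'x measure \<Rightarrow> 'g measure \<Rightarrow> ('x \<Rightarrow> 'g topology) \<Rightarrow> 'x set \<Rightarrow>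
     'x topology \<Rightarrow> 'g topology \<Rightarrow> bool" where
  "compatible_component_topologies \<G> BX BG F C TC TG \<longleftrightarrow>
     second_countable TC \<and> second_countable TG \<and>
     {U. openin TC U} \<subseteq> sets (restrict_space BX C) \<and>
     {U. openin TG U} \<subseteq> sets BG \<and>
     open_topological_groupoid (restrict_groupoid \<G> C) TC TG \<and>
     (\<forall>x\<in>C. subtopology TG (src_fiber \<G> x) = F x) \<and>
     sigma_sets C {U. openin TC U} = sets (restrict_space BX C) \<and>
     \<not> meager_in TC C"

end

theory Submission
  imports Defs
begin

text \<open>Fix \<open>x\<close> and let \<open>Y = \<sigma>\<^sup>-\<^sup>1(x)\<close>. The topology on the component \<open>C\<close> is the quotient of \<open>Y\<close> by the open map
  \<open>\<tau>\<close>, and the topology on \<open>G|C\<close> is the quotient of \<open>Y \<times> Y\<close> by the open map \<open>(g, k) \<mapsto> g k\<^sup>-\<^sup>1\<close>. The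
  topology on \<open>C\<close> is \<open>T\<^sub>0\<close> by a \<open>0\<close>-\<open>1\<close> law: if \<open>E\<close> is an indistinguishability class, then
  \<open>\<tau>\<^sup>-\<^sup>1(w)\<close> is dense in \<open>\<tau>\<^sup>-\<^sup>1(E)\<close> for every \<open>w \<in> E\<close>, all these fibers are homeomorphic by left
  multiplications, and Borel separation of points makes one of them comeager. Hence the vertex group
  \<open>G(x, x)\<close> is a \<open>\<Pi>\<^sup>0\<^sub>2\<close> subset of \<open>Y\<close>, thus a Baire space, so its separately continuous right action on \<open>Y\<close>
  is jointly continuous; this gives continuity of multiplication. Lusin separation, applied to images of
  disjoint saturated sets, shows that open sets are Borel and that the topology on \<open>C\<close> generates the Borel sets.

  For uniqueness, let a compatible pair of topologies be given. By the Kuratowski--Ulam argument and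
  nonmeagerness of \<open>C\<close>, dense open sets of objects have dense open preimages in every fiber. So a quotient-open \<open>W\<close>,
  which has the Baire property, can be replaced by an open set in \<open>\<sigma>(N \<inter> \<tau>\<^sup>-\<^sup>1(W))\<close>, and continuity of
  multiplication at the identities provides sets of this form between any point of \<open>W\<close> and \<open>W\<close>.\<close>


section \<open>Quasi-Polish spaces and Baire category\<close>

text \<open>The hypotheses give joint continuity of the map taking \<open>k\<close> and
  \<open>h\<close> to \<open>iv k \<cdot> h\<close>, where the middle object varies. Composing
  \<open>g \<cdot> iv k\<close> with \<open>h \<cdot> iv l\<close> also needs joint continuity of
  \<open>g \<cdot> a\<close> for \<open>a\<close> in the vertex group, and this is given only in
  each variable separately. The gap forces the detour through Baire category, and with it the T0
  property, which identifies the vertex group as a \<Pi>02 set. Fibers need not be metrizable, so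
  completeness is used as a countable presentation: a basis together with axioms saying that basic
  sets are covered by others. Points arise from shrinking sequences that answer every axiom. The
  same bookkeeping serves Baire category, Lusin separation and Borelness of components. Images only
  yield traces of Borel sets on a component. Open sets of arrows must belong to
  \<open>sets BG\<close> itself, so the component has to be shown Borel separately. For uniqueness,
  the unknown topology on objects is not known to be Baire. Nonmeagerness supplies one generic
  object; the later category arguments take place in fibers.\<close>

lemma fair_chain:
  fixes P :: "'b \<Rightarrow> bool" and le :: "'b \<Rightarrow> 'b \<Rightarrow> bool" and Q :: "'t \<Rightarrow> 'b \<Rightarrow> bool"
  assumes "countable \<T>" and "\<T> \<noteq> {}" and "P b0"
    and step: "\<And>t b. t \<in> \<T> \<Longrightarrow> P b \<Longrightarrow> \<exists>b'. P b' \<and> le b' b \<and> Q t b'"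
  obtains c :: "nat \<Rightarrow> 'b" where "c 0 = b0" and "\<And>k. P (c k)" and "\<And>k. le (c (Suc k)) (c k)"
    and "\<And>t m. t \<in> \<T> \<Longrightarrow> \<exists>k\<ge>m. Q t (c k)"
proof -
  \<comment> \<open>Reading only the first component of the decoded pair makes every task come up at
    arbitrarily late stages.\<close>
  let ?t = "\<lambda>k. from_nat_into \<T> (fst (prod_decode k))"
  have t: "?t k \<in> \<T>" for k using assms(2) by (rule from_nat_into)
  have "\<exists>c :: nat \<Rightarrow> 'b. \<forall>k. (P (c k) \<and> (k = 0 \<longrightarrow> c k = b0)) \<and> (le (c (Suc k)) (c k) \<and> Q (?t k) (c (Suc k)))"
  proof (rule dependent_nat_choice)
    fix b and k :: nat assume "P b \<and> (k = 0 \<longrightarrow> b = b0)"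
    then show "\<exists>y. (P y \<and> (Suc k = 0 \<longrightarrow> y = b0)) \<and> le y b \<and> Q (?t k) y"
      using step[OF t, of b k] by auto
  qed (use \<open>P b0\<close> in auto)
  then obtain c :: "nat \<Rightarrow> 'b" where c: "\<And>k. P (c k)" "c 0 = b0" "\<And>k. le (c (Suc k)) (c k)"
    "\<And>k. Q (?t k) (c (Suc k))" by blast
  show thesis
  proof (rule that[OF c(2,1,3)])
    fix t m assume "t \<in> \<T>"
    then obtain i where i: "from_nat_into \<T> i = t"
      using from_nat_into_surj[OF \<open>countable \<T>\<close>] by blast
    have "m \<le> prod_encode (i, m)" by (rule le_prod_encode_2)
    then show "\<exists>k\<ge>m. Q t (c k)"
      using c(4)[of "prod_encode (i, m)"] i by (intro exI[of _ "Suc (prod_encode (i, m))"]) auto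
  qed
qed

section \<open>Countable presentations of quasi-Polish spaces\<close>

text \<open>For finite \<open>s\<close> these are the basic open sets of the power of the Sierpinski
  space: only positive information is open, so coordinates can be required to be \<open>True\<close>
  but never to be \<open>False\<close>.\<close>

definition cylinder :: "nat set \<Rightarrow> (nat \<Rightarrow> bool) set" where
  "cylinder s = {d. \<forall>n\<in>s. d n}"

lemma topspace_sierpinski_space [simp]: "topspace sierpinski_space = UNIV"
  unfolding topspace_def openin_sierpinski_space by auto

lemma openin_cylinder:
  assumes "finite s"
  shows "openin (product_topology (\<lambda>_::nat. sierpinski_space) UNIV) (cylinder s)"
  unfolding openin_product_topology_alt
proof
  fix d assume d: "d \<in> cylinder s"
  let ?U = "\<lambda>n. if n \<in> s then {True} else UNIV"
  have "{n. ?U n \<noteq> UNIV} \<subseteq> s" by auto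
  then have "finite {n. ?U n \<noteq> UNIV}" using assms finite_subset by blast
  moreover have "d \<in> Pi\<^sub>E UNIV ?U" "Pi\<^sub>E UNIV ?U \<subseteq> cylinder s"
    using d unfolding cylinder_def PiE_def Pi_def by (auto split: if_splits)
  ultimately show "\<exists>U. finite {i \<in> UNIV. U i \<noteq> topspace sierpinski_space} \<and>
      (\<forall>i\<in>UNIV. openin sierpinski_space (U i)) \<and> d \<in> Pi\<^sub>E UNIV U \<and> Pi\<^sub>E UNIV U \<subseteq> cylinder s"
    by (intro exI[of _ ?U]) (auto simp: openin_sierpinski_space)
qed

lemma cylinder_nhd:
  assumes "openin (product_topology (\<lambda>_::nat. sierpinski_space) UNIV) W" and "d \<in> W"
  obtains s where "finite s" and "d \<in> cylinder s" and "cylinder s \<subseteq> W"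
proof -
  obtain U where U: "finite {i. U i \<noteq> UNIV}" "\<And>i. openin sierpinski_space (U i)"
    "d \<in> Pi\<^sub>E UNIV U" "Pi\<^sub>E UNIV U \<subseteq> W"
    using assms unfolding openin_product_topology_alt by fastforce
  have U': "U i = {True}" if "U i \<noteq> UNIV" for i
  proof -
    have "U i \<in> {{}, {True}, UNIV}" using U(2) openin_sierpinski_space by simp
    moreover have "U i \<noteq> {}" using U(3) by (auto simp: PiE_def Pi_def)
    ultimately show ?thesis using that by blast
  qed
  show thesis
  proof (rule that[OF U(1)])
    have "d i" if "U i \<noteq> UNIV" for i
      using U'[OF that] U(3) by (metis PiE_E UNIV_I singletonD)
    then show "d \<in> cylinder {i. U i \<noteq> UNIV}" unfolding cylinder_def by simp
    have "cylinder {i. U i \<noteq> UNIV} \<subseteq> Pi\<^sub>E UNIV U"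
      unfolding cylinder_def using U' by (auto simp: PiE_def Pi_def extensional_def) blast
    then show "cylinder {i. U i \<noteq> UNIV} \<subseteq> W" using U(4) by blast
  qed
qed

text \<open>A \<Pi>02 subset of the Sierpinski power consists of the points that lie in
  \<open>V n\<close> whenever they lie in \<open>U n\<close>, and each axiom in \<open>R\<close>
  records this implication for one cylinder inside \<open>U n\<close>. The last clause is
  completeness: a decreasing sequence of basic sets that answers all axioms is a neighbourhood base
  of some point.\<close>

lemma quasi_polish_cover_system:
  assumes "quasi_polish_space T"
  obtains \<B> :: "'a set set" and R :: "('a set \<times> 'a set set) set"
  where "countable \<B>" and "countable R" and "\<And>b. b \<in> \<B> \<Longrightarrow> openin T b"
    and "\<And>W p. openin T W \<Longrightarrow> p \<in> W \<Longrightarrow> \<exists>b\<in>\<B>. p \<in> b \<and> b \<subseteq> W"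
    and "\<And>p q. p \<in> topspace T \<Longrightarrow> q \<in> topspace T \<Longrightarrow> p \<noteq> q \<Longrightarrow> \<exists>b\<in>\<B>. (p \<in> b) \<noteq> (q \<in> b)"
    and "\<And>b \<C>. (b, \<C>) \<in> R \<Longrightarrow> \<C> \<subseteq> \<B> \<and> b \<subseteq> \<Union>\<C>"
    and "\<And>c :: nat \<Rightarrow> 'a set. (\<And>k. c k \<in> \<B>) \<Longrightarrow> (\<And>k. c (Suc k) \<subseteq> c k) \<Longrightarrow>
        (\<And>b \<C> k. (b, \<C>) \<in> R \<Longrightarrow> c k \<subseteq> b \<Longrightarrow> \<exists>l. \<exists>b'\<in>\<C>. c l \<subseteq> b') \<Longrightarrow>
        \<exists>p\<in>topspace T. (\<forall>k. p \<in> c k) \<and> (\<forall>W. openin T W \<and> p \<in> W \<longrightarrow> (\<exists>k. c k \<subseteq> W))"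
proof -
  let ?P = "product_topology (\<lambda>_::nat. sierpinski_space) UNIV"
  have topP [simp]: "topspace ?P = UNIV" by (simp add: PiE_UNIV_domain)
  obtain A e where A: "pi02_in ?P A" and e: "homeomorphic_map T (subtopology ?P A) e"
    using assms unfolding quasi_polish_space_def homeomorphic_space by blast
  obtain U V :: "nat \<Rightarrow> (nat \<Rightarrow> bool) set" where UV: "\<And>n. openin ?P (U n)" "\<And>n. openin ?P (V n)"
    and A_eq: "A = UNIV - (\<Union>n. U n - V n)"
    using A unfolding pi02_in_def topP by metis
  have img: "e ` topspace T = A" and inj: "inj_on e (topspace T)"
    using homeomorphic_imp_surjective_map[OF e] homeomorphic_imp_injective_map[OF e] by auto
  define N where "N s = {p \<in> topspace T. e p \<in> cylinder s}" for s
  have openN: "openin T (N s)" if "finite s" for s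
  proof -
    have "continuous_map T ?P e"
      using homeomorphic_imp_continuous_map[OF e] continuous_map_in_subtopology by blast
    then show ?thesis unfolding N_def using openin_cylinder[OF that]
      by (rule openin_continuous_map_preimage)
  qed
  have nhd: "\<exists>s. finite s \<and> p \<in> N s \<and> N s \<subseteq> W" if W: "openin T W" "p \<in> W" for W p
  proof -
    have sub: "W \<subseteq> topspace T" using W(1) by (rule openin_subset)
    have "openin (subtopology ?P A) (e ` W)"
      using homeomorphic_imp_open_map[OF e] W(1) unfolding open_map_def by blast
    then obtain O' where O': "openin ?P O'" "e ` W = O' \<inter> A" by (auto simp: openin_subtopology)
    then have "e p \<in> O'" using W(2) by blast
    then obtain s where s: "finite s" "e p \<in> cylinder s" "cylinder s \<subseteq> O'"
      using cylinder_nhd[OF O'(1)] by metis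
    have "N s \<subseteq> W"
    proof
      fix g assume g: "g \<in> N s"
      then have "e g \<in> e ` W" using s(3) img O'(2) unfolding N_def by blast
      then show "g \<in> W" using inj g sub unfolding N_def by (auto simp: inj_on_image_mem_iff)
    qed
    then show ?thesis using s W(2) sub unfolding N_def by (intro exI[of _ s]) auto
  qed
  define \<B> where "\<B> = N ` {s. finite s}"
  define R where "R = (\<lambda>(s, n). (N s, N ` {s'. finite s' \<and> cylinder s' \<subseteq> V n})) `
      {(s, n). finite s \<and> cylinder s \<subseteq> U n}"
  have cyl_Un: "cylinder (s \<union> t) = cylinder s \<inter> cylinder t" for s t
    unfolding cylinder_def by auto
  show thesis
  proof (rule that[of \<B> R])
    show "countable \<B>" unfolding \<B>_def by (intro countable_image countable_Collect_finite)
    have "{(s, n). finite s \<and> cylinder s \<subseteq> U n} \<subseteq> {s. finite s} \<times> (UNIV :: nat set)" by auto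
    then have "countable {(s, n). finite s \<and> cylinder s \<subseteq> U n}"
      by (rule countable_subset) (intro countable_SIGMA countable_Collect_finite, simp)
    then show "countable R" unfolding R_def by (rule countable_image)
    show "openin T b" if "b \<in> \<B>" for b using that openN unfolding \<B>_def by auto
    show "\<exists>b\<in>\<B>. p \<in> b \<and> b \<subseteq> W" if "openin T W" "p \<in> W" for W p
      using nhd[OF that] unfolding \<B>_def by blast
    show "\<exists>b\<in>\<B>. (p \<in> b) \<noteq> (q \<in> b)" if "p \<in> topspace T" "q \<in> topspace T" "p \<noteq> q" for p q
    proof -
      have "e p \<noteq> e q" using that inj unfolding inj_on_def by blast
      then obtain n where "e p n \<noteq> e q n" by blast
      then have "(p \<in> N {n}) \<noteq> (q \<in> N {n})" using that unfolding N_def cylinder_def by simp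
      then show ?thesis unfolding \<B>_def by blast
    qed
    show "\<C> \<subseteq> \<B> \<and> b \<subseteq> \<Union>\<C>" if bC: "(b, \<C>) \<in> R" for b \<C>
    proof -
      obtain s n where s: "finite s" "cylinder s \<subseteq> U n" "b = N s"
        "\<C> = N ` {s'. finite s' \<and> cylinder s' \<subseteq> V n}"
        using bC unfolding R_def by (elim imageE) auto
      have "p \<in> \<Union>\<C>" if p: "p \<in> N s" for p
      proof -
        have "e p \<in> A" "e p \<in> U n" using p img s(2) unfolding N_def by auto
        then have "e p \<in> V n" unfolding A_eq by blast
        then obtain s' where "finite s'" "e p \<in> cylinder s'" "cylinder s' \<subseteq> V n"
          using cylinder_nhd[OF UV(2)] by blast
        moreover from this have "p \<in> N s'" using p unfolding N_def by blast
        ultimately show ?thesis unfolding s(4) by blast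
      qed
      moreover have "\<C> \<subseteq> \<B>" unfolding s(4) \<B>_def by blast
      ultimately show ?thesis unfolding s(3) by blast
    qed
    fix c :: "nat \<Rightarrow> 'a set"
    assume c: "\<And>k. c k \<in> \<B>" "\<And>k. c (Suc k) \<subseteq> c k"
      and resp: "\<And>b \<C> k. (b, \<C>) \<in> R \<Longrightarrow> c k \<subseteq> b \<Longrightarrow> \<exists>l. \<exists>b'\<in>\<C>. c l \<subseteq> b'"
    have mono: "c l \<subseteq> c k" if "k \<le> l" for k l
      using that by (induction l rule: dec_induct) (use c(2) in blast)+
    \<comment> \<open>The coordinates of the limit: \<open>True\<close> exactly where the sequence
      commits itself at some stage. Answering the axioms then puts \<open>d\<close> into
      \<open>A\<close>.\<close>
    define d where "d n \<longleftrightarrow> (\<exists>k. c k \<subseteq> N {n})" for n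
    have sub_d: "d \<in> cylinder s \<longleftrightarrow> (\<exists>k. c k \<subseteq> N s)" if "finite s" for s
      using that
    proof (induction s)
      case empty
      have "N {} = topspace T" unfolding N_def cylinder_def by simp
      moreover have "c 0 \<subseteq> topspace T" using c(1)[of 0] unfolding \<B>_def N_def by auto
      ultimately show ?case unfolding cylinder_def by auto
    next
      case (insert n s)
      have *: "N (insert n s) = N {n} \<inter> N s" unfolding N_def cylinder_def by auto
      have "d \<in> cylinder (insert n s) \<longleftrightarrow> d n \<and> d \<in> cylinder s" unfolding cylinder_def by auto
      also have "\<dots> \<longleftrightarrow> (\<exists>k. c k \<subseteq> N (insert n s))"
      proof
        assume "d n \<and> d \<in> cylinder s"
        then obtain k l where "c k \<subseteq> N {n}" "c l \<subseteq> N s" using insert.IH unfolding d_def by blast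
        then have "c (max k l) \<subseteq> N (insert n s)"
          using mono[of k "max k l"] mono[of l "max k l"] unfolding * by auto
        then show "\<exists>k. c k \<subseteq> N (insert n s)" by blast
      next
        assume "\<exists>k. c k \<subseteq> N (insert n s)"
        then show "d n \<and> d \<in> cylinder s" using insert.IH unfolding * d_def by blast
      qed
      finally show ?case .
    qed
    have "d \<in> V n" if d: "d \<in> U n" for n
    proof -
      obtain s where s: "finite s" "d \<in> cylinder s" "cylinder s \<subseteq> U n"
        using cylinder_nhd[OF UV(1) d] .
      obtain k where k: "c k \<subseteq> N s" using sub_d[OF s(1)] s(2) by blast
      have "(N s, N ` {s'. finite s' \<and> cylinder s' \<subseteq> V n}) \<in> R"
        unfolding R_def using s by (intro image_eqI[of _ _ "(s, n)"]) auto
      from resp[OF this k] obtain l s' where "finite s'" "cylinder s' \<subseteq> V n" "c l \<subseteq> N s'"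
        by auto
      then show ?thesis using sub_d[of s'] by blast
    qed
    then have "d \<in> A" unfolding A_eq by blast
    then obtain p where p: "p \<in> topspace T" "e p = d" using img by blast
    have Np: "p \<in> N s \<longleftrightarrow> (\<exists>k. c k \<subseteq> N s)" if "finite s" for s
      using sub_d[OF that] p unfolding N_def by simp
    have "p \<in> b \<longleftrightarrow> (\<exists>k. c k \<subseteq> b)" if "b \<in> \<B>" for b
      using that Np unfolding \<B>_def by blast
    then have "\<forall>k. p \<in> c k" using c(1) by (metis order_refl)
    moreover have "\<exists>k. c k \<subseteq> W" if W: "openin T W" "p \<in> W" for W
    proof -
      obtain s where "finite s" "p \<in> N s" "N s \<subseteq> W" using nhd[OF W] by blast
      then show ?thesis using Np[of s] by blast
    qed
    ultimately show "\<exists>p\<in>topspace T. (\<forall>k. p \<in> c k) \<and> (\<forall>W. openin T W \<and> p \<in> W \<longrightarrow> (\<exists>k. c k \<subseteq> W))"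
      using p(1) by blast
  qed
qed

section \<open>Baire category relative to a subset\<close>

text \<open>\<open>D\<close> is open in the whole space but only has to be dense on
  \<open>K\<close>, so category arguments on the subspace \<open>K\<close> can be run with ambient
  open sets.\<close>

definition open_dense_on :: "'a topology \<Rightarrow> 'a set \<Rightarrow> 'a set \<Rightarrow> bool" where
  "open_dense_on T K D \<longleftrightarrow> openin T D \<and> (\<forall>W. openin T W \<and> W \<inter> K \<noteq> {} \<longrightarrow> W \<inter> D \<inter> K \<noteq> {})"

text \<open>Instead of presenting \<open>K\<close> as a space of its own, its defining implications
  from \<open>U n\<close> to \<open>V n\<close> are treated as further requirements on a shrinking
  sequence of basic sets, each of which meets \<open>K\<close>.\<close>

lemma quasi_polish_baire:
  assumes T: "quasi_polish_space T" and K: "pi02_in T K"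
    and \<D>: "countable \<D>" "\<forall>D\<in>\<D>. open_dense_on T K D"
    and W: "openin T W" "W \<inter> K \<noteq> {}"
  shows "\<exists>p\<in>W \<inter> K. \<forall>D\<in>\<D>. p \<in> D"
proof -
  from T obtain \<B> R where sys: "countable \<B>" "countable R" "\<And>b. b \<in> \<B> \<Longrightarrow> openin T b"
    "\<And>W p. openin T W \<Longrightarrow> p \<in> W \<Longrightarrow> \<exists>b\<in>\<B>. p \<in> b \<and> b \<subseteq> W"
    "\<And>b \<C>. (b, \<C>) \<in> R \<Longrightarrow> \<C> \<subseteq> \<B> \<and> b \<subseteq> \<Union>\<C>"
    "\<And>c :: nat \<Rightarrow> 'a set. (\<And>k. c k \<in> \<B>) \<Longrightarrow> (\<And>k. c (Suc k) \<subseteq> c k) \<Longrightarrow>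
        (\<And>b \<C> k. (b, \<C>) \<in> R \<Longrightarrow> c k \<subseteq> b \<Longrightarrow> \<exists>l. \<exists>b'\<in>\<C>. c l \<subseteq> b') \<Longrightarrow>
        \<exists>p\<in>topspace T. (\<forall>k. p \<in> c k) \<and> (\<forall>W. openin T W \<and> p \<in> W \<longrightarrow> (\<exists>k. c k \<subseteq> W))"
    by (rule quasi_polish_cover_system) blast
  obtain U V :: "nat \<Rightarrow> 'a set" where UV: "\<And>n. openin T (U n)" "\<And>n. openin T (V n)"
    and K_eq: "K = topspace T - (\<Union>n. U n - V n)"
    using K unfolding pi02_in_def by metis
  \<comment> \<open>Three kinds of tasks: enter a dense set, answer a covering axiom so that a limit
    exists, and pass from \<open>U n\<close> to \<open>V n\<close> so that the limit lies in
    \<open>K\<close>. The last two are implications whose premise may become true late, which is why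
    every task has to recur.\<close>
  define \<T> :: "('a set \<Rightarrow> bool) set" where "\<T> = (\<lambda>D b'. b' \<subseteq> D) ` \<D>
      \<union> (\<lambda>(b, \<C>) b'. b' \<subseteq> b \<longrightarrow> (\<exists>b''\<in>\<C>. b' \<subseteq> b'')) ` R
      \<union> range (\<lambda>n b'. b' \<subseteq> U n \<longrightarrow> b' \<subseteq> V n)"
  let ?P = "\<lambda>b. b \<in> \<B> \<and> b \<inter> K \<noteq> {}"
  obtain b0 where b0: "b0 \<in> \<B>" "b0 \<subseteq> W" "b0 \<inter> K \<noteq> {}"
    using W sys(4)[OF W(1)] by blast
  have shrink: "\<exists>b'\<in>\<B>. b' \<inter> K \<noteq> {} \<and> b' \<subseteq> b \<inter> O'"
    if "b \<in> \<B>" "openin T O'" "b \<inter> O' \<inter> K \<noteq> {}" for b O'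
  proof -
    have "openin T (b \<inter> O')" using that sys(3) by blast
    then show ?thesis using sys(4)[of "b \<inter> O'"] that(3) by blast
  qed
  obtain c :: "nat \<Rightarrow> 'a set" where c: "c 0 = b0" "\<And>k. ?P (c k)" "\<And>k. c (Suc k) \<subseteq> c k"
    and fair: "\<And>t m. t \<in> \<T> \<Longrightarrow> \<exists>k\<ge>m. t (c k)"
  proof (rule fair_chain[of \<T> ?P b0 "(\<subseteq>)" "\<lambda>t. t"])
    show "countable \<T>" unfolding \<T>_def using sys(2) \<D>(1) by auto
    show "\<T> \<noteq> {}" unfolding \<T>_def by auto
    show "?P b0" using b0 by blast
  next
    fix t b assume t: "t \<in> \<T>" and b: "b \<in> \<B> \<and> b \<inter> K \<noteq> {}"
    consider D where "D \<in> \<D>" "t = (\<lambda>b'. b' \<subseteq> D)"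
      | b1 \<C> where "(b1, \<C>) \<in> R" "t = (\<lambda>b'. b' \<subseteq> b1 \<longrightarrow> (\<exists>b''\<in>\<C>. b' \<subseteq> b''))"
      | n where "t = (\<lambda>b'. b' \<subseteq> U n \<longrightarrow> b' \<subseteq> V n)"
      using t unfolding \<T>_def by fast
    then show "\<exists>b'. ?P b' \<and> b' \<subseteq> b \<and> t b'"
    proof cases
      case 1
      then have "openin T D" "b \<inter> D \<inter> K \<noteq> {}"
        using \<D>(2)[rule_format, OF 1(1)] b sys(3) unfolding open_dense_on_def by blast+
      then obtain b' where "b' \<in> \<B>" "b' \<inter> K \<noteq> {}" "b' \<subseteq> b \<inter> D" using shrink b by meson
      then show ?thesis using 1(2) by blast
    next
      case 2
      show ?thesis
      proof (cases "b \<subseteq> b1")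
        case True
        then obtain p b2 where "p \<in> b" "p \<in> K" "p \<in> b2" "b2 \<in> \<C>" using b sys(5)[OF 2(1)] by blast
        then obtain b' where "b' \<in> \<B>" "b' \<inter> K \<noteq> {}" "b' \<subseteq> b \<inter> b2"
          using shrink[of b b2] b sys(3,5) 2(1) by blast
        then show ?thesis using 2(2) \<open>b2 \<in> \<C>\<close> by blast
      qed (use 2(2) b in blast)
    next
      case 3
      show ?thesis
      proof (cases "b \<subseteq> U n")
        case True
        then have "b \<inter> V n \<inter> K \<noteq> {}" using b unfolding K_eq by blast
        then obtain b' where "b' \<in> \<B>" "b' \<inter> K \<noteq> {}" "b' \<subseteq> b \<inter> V n" using shrink b UV(2) by meson
        then show ?thesis using 3 by blast
      qed (use 3 b in blast)
    qed
  qed (rule that)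
  have mono: "c l \<subseteq> c k" if "k \<le> l" for k l
    using that by (induction l rule: dec_induct) (use c(3) in blast)+
  have "\<exists>p\<in>topspace T. (\<forall>k. p \<in> c k) \<and> (\<forall>W. openin T W \<and> p \<in> W \<longrightarrow> (\<exists>k. c k \<subseteq> W))"
  proof (rule sys(6))
    fix b \<C> k assume b: "(b, \<C>) \<in> R" "c k \<subseteq> b"
    then have "(\<lambda>b'. b' \<subseteq> b \<longrightarrow> (\<exists>b''\<in>\<C>. b' \<subseteq> b'')) \<in> \<T>" unfolding \<T>_def by force
    from fair[OF this, of k] show "\<exists>l. \<exists>b'\<in>\<C>. c l \<subseteq> b'" using mono b(2) by blast
  qed (use c in auto)
  then obtain p where p: "p \<in> topspace T" "\<And>k. p \<in> c k"
    "\<And>W. openin T W \<Longrightarrow> p \<in> W \<Longrightarrow> \<exists>k. c k \<subseteq> W" by blast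
  have "p \<in> V n" if n: "p \<in> U n" for n
  proof -
    obtain k where k: "c k \<subseteq> U n" using p(3)[OF UV(1) n] by blast
    have "(\<lambda>b'. b' \<subseteq> U n \<longrightarrow> b' \<subseteq> V n) \<in> \<T>" unfolding \<T>_def by blast
    from fair[OF this, of k] show ?thesis using mono k p(2) by blast
  qed
  then have "p \<in> K" using p(1) unfolding K_eq by blast
  moreover have "p \<in> D" if "D \<in> \<D>" for D
  proof -
    have "(\<lambda>b'. b' \<subseteq> D) \<in> \<T>" using that unfolding \<T>_def by blast
    from fair[OF this, of 0] show ?thesis using p(2) by blast
  qed
  moreover have "p \<in> W" using p(2)[of 0] c(1) b0(2) by auto
  ultimately show ?thesis by blast
qed

lemma pi02_in_topspace: "pi02_in T (topspace T)"
  unfolding pi02_in_def by (intro exI[of _ "\<lambda>_. {}"]) simp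

text \<open>Induction over the generation of the Borel sets. The exceptional points are recorded by
  a countable family of open dense sets rather than by a meager set, so that the family can be
  handed directly to a Baire argument.\<close>

lemma baire_property:
  assumes "S \<in> sigma_sets (topspace T) {U. openin T U}" and K: "K \<subseteq> topspace T"
  shows "\<exists>U \<D>. openin T U \<and> countable \<D> \<and> (\<forall>D\<in>\<D>. open_dense_on T K D) \<and>
    (\<forall>p\<in>K. (\<forall>D\<in>\<D>. p \<in> D) \<longrightarrow> (p \<in> S \<longleftrightarrow> p \<in> U))"
  using assms(1)
proof induction
  case (Basic a)
  then show ?case by (intro exI[of _ a] exI[of _ "{}"]) auto
next
  case Empty
  then show ?case by (intro exI[of _ "{}"] exI[of _ "{}"]) auto
next
  case (Compl a)
  then obtain U \<D> where *: "openin T U" "countable \<D>" "\<forall>D\<in>\<D>. open_dense_on T K D"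
    "\<forall>p\<in>K. (\<forall>D\<in>\<D>. p \<in> D) \<longrightarrow> (p \<in> a \<longleftrightarrow> p \<in> U)" by (elim exE conjE)
  \<comment> \<open>The largest open set that avoids \<open>U\<close> on \<open>K\<close>. Its union
    with \<open>U\<close> is dense on \<open>K\<close> and becomes one more member of the
    family.\<close>
  define U' where "U' = \<Union>{W. openin T W \<and> W \<inter> U \<inter> K = {}}"
  have U': "openin T U'" unfolding U'_def by (rule openin_Union) blast
  have disj: "U' \<inter> U \<inter> K = {}" unfolding U'_def by blast
  have "open_dense_on T K (U \<union> U')"
    unfolding open_dense_on_def
  proof (intro conjI allI impI)
    fix W assume W: "openin T W \<and> W \<inter> K \<noteq> {}"
    show "W \<inter> (U \<union> U') \<inter> K \<noteq> {}"
    proof (cases "W \<inter> U \<inter> K = {}")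
      case True
      then have "W \<subseteq> U'" using W unfolding U'_def by blast
      then show ?thesis using W by blast
    qed blast
  qed (use * U' in blast)
  then show ?case
  proof (intro exI[of _ U'] exI[of _ "insert (U \<union> U') \<D>"] conjI ballI impI)
    fix p assume p: "p \<in> K" "\<forall>D\<in>insert (U \<union> U') \<D>. p \<in> D"
    then have "p \<in> a \<longleftrightarrow> p \<in> U" "p \<in> U \<union> U'" using *(4) by auto
    then show "p \<in> topspace T - a \<longleftrightarrow> p \<in> U'" using p(1) disj K by blast
  qed (use * U' in auto)
next
  case (Union a)
  then have "\<forall>i. \<exists>U \<D>. openin T U \<and> countable \<D> \<and> (\<forall>D\<in>\<D>. open_dense_on T K D) \<and>
    (\<forall>p\<in>K. (\<forall>D\<in>\<D>. p \<in> D) \<longrightarrow> (p \<in> a i \<longleftrightarrow> p \<in> U))" by blast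
  then obtain U \<D> where *: "\<forall>i. openin T (U i) \<and> countable (\<D> i) \<and> (\<forall>D\<in>\<D> i. open_dense_on T K D) \<and>
    (\<forall>p\<in>K. (\<forall>D\<in>\<D> i. p \<in> D) \<longrightarrow> (p \<in> a i \<longleftrightarrow> p \<in> U i))" by (elim choice[THEN exE])
  show ?case
  proof (intro exI[of _ "\<Union>i. U i"] exI[of _ "\<Union>i. \<D> i"] conjI ballI impI)
    show "openin T (\<Union>i. U i)" using * by blast
    fix p assume "p \<in> K" "\<forall>D\<in>\<Union>i. \<D> i. p \<in> D"
    then have "p \<in> a i \<longleftrightarrow> p \<in> U i" for i using * by (meson UN_I UNIV_I)
    then show "p \<in> (\<Union>i. a i) \<longleftrightarrow> p \<in> (\<Union>i. U i)" by simp
  qed (use * in auto)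
qed

lemma nonmeager_dense_Inter:
  assumes nm: "\<not> meager_in T (topspace T)" and \<D>: "countable \<D>" "\<forall>D\<in>\<D>. open_dense_on T (topspace T) D"
  shows "\<exists>p\<in>topspace T. \<forall>D\<in>\<D>. p \<in> D"
proof (rule ccontr)
  assume n: "\<not> ?thesis"
  \<comment> \<open>Inserting the whole space makes the family nonempty, as the enumeration
    requires, and adds only an empty complement.\<close>
  let ?D = "from_nat_into (insert (topspace T) \<D>)"
  define N where "N i = topspace T - ?D i" for i
  have D: "open_dense_on T (topspace T) (?D i)" for i
  proof -
    have "?D i \<in> insert (topspace T) \<D>" by (rule from_nat_into) simp
    moreover have "open_dense_on T (topspace T) (topspace T)" unfolding open_dense_on_def by auto
    ultimately show ?thesis using \<D>(2) by auto
  qed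
  have "nowhere_dense_in T (N i)" for i
  proof -
    have "closedin T (N i)" using D[of i] unfolding N_def open_dense_on_def by blast
    then have cl: "T closure_of N i = N i" by (simp add: closure_of_eq)
    have "T interior_of N i = {}"
    proof (rule ccontr)
      let ?W = "T interior_of N i"
      assume "?W \<noteq> {}"
      then have "?W \<inter> topspace T \<noteq> {}" using interior_of_subset_topspace[of T "N i"] by blast
      then have "?W \<inter> ?D i \<inter> topspace T \<noteq> {}" using D[of i] openin_interior_of unfolding open_dense_on_def by blast
      then show False using interior_of_subset[of T "N i"] unfolding N_def by blast
    qed
    then show ?thesis unfolding nowhere_dense_in_def cl by (simp add: N_def)
  qed
  moreover have "topspace T = (\<Union>i. N i)"
  proof
    show "topspace T \<subseteq> (\<Union>i. N i)"
    proof
      fix p assume p: "p \<in> topspace T"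
      then obtain D where "D \<in> \<D>" "p \<notin> D" using n by blast
      moreover obtain i where "?D i = D"
        using from_nat_into_surj[of "insert (topspace T) \<D>" D] \<D>(1) \<open>D \<in> \<D>\<close> by auto
      ultimately show "p \<in> (\<Union>i. N i)" unfolding N_def using p by blast
    qed
  qed (auto simp: N_def)
  ultimately show False using nm unfolding meager_in_def by blast
qed

section \<open>Lusin separation\<close>

text \<open>A family of sets behaves like a set of propositional axioms: \<open>(b, \<C>)\<close> says that membership in \<open>b\<close>
  implies membership in some element of \<open>\<C>\<close>. A Borel set \<open>S\<close> is described by countably many such axioms
  in the sense that a consistent family \<open>d\<close> satisfying them which contains \<open>S\<close> can only
  converge to points of \<open>S\<close>.\<close>

definition obeys :: "'a set set \<Rightarrow> ('a set \<times> 'a set set) set \<Rightarrow> bool" where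
  "obeys d R \<longleftrightarrow> (\<forall>(b, \<C>)\<in>R. b \<in> d \<longrightarrow> (\<exists>c\<in>\<C>. c \<in> d))"

text \<open>The inclusion says that the axioms are true of actual points. Together with countability
  it allows an inseparable pair of sets to be refined along an axiom without becoming
  separable.\<close>

definition countable_covers :: "('a set \<times> 'a set set) set \<Rightarrow> bool" where
  "countable_covers R \<longleftrightarrow> countable R \<and> (\<forall>(b, \<C>)\<in>R. countable \<C> \<and> b \<subseteq> \<Union>\<C>)"

text \<open>The limit need not belong to the members of \<open>d\<close>; that it belongs to a given
  member is exactly what \<open>described_by\<close> provides.\<close>

definition family_converges :: "'a topology \<Rightarrow> 'a set set \<Rightarrow> 'a \<Rightarrow> bool" where
  "family_converges T d p \<longleftrightarrow> topspace T \<in> d \<and> (\<forall>F. finite F \<and> F \<subseteq> d \<longrightarrow> \<Inter>F \<noteq> {}) \<and>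
     p \<in> topspace T \<and> (\<forall>W. openin T W \<and> p \<in> W \<longrightarrow> (\<exists>b\<in>d. b \<subseteq> W))"

definition described_by :: "'a topology \<Rightarrow> ('a set \<times> 'a set set) set \<Rightarrow> 'a set \<Rightarrow> bool" where
  "described_by T R S \<longleftrightarrow> (\<forall>d p. family_converges T d p \<and> obeys d R \<and> S \<in> d \<longrightarrow> p \<in> S)"

lemma obeys_Un [simp]: "obeys d (R \<union> R') \<longleftrightarrow> obeys d R \<and> obeys d R'"
  unfolding obeys_def by blast

lemma obeys_mono: "obeys d R \<Longrightarrow> R' \<subseteq> R \<Longrightarrow> obeys d R'"
  unfolding obeys_def by blast

lemma countable_covers_Un [simp]:
  "countable_covers (R \<union> R') \<longleftrightarrow> countable_covers R \<and> countable_covers R'"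
  unfolding countable_covers_def ball_Un by (simp, blast)

lemma countable_covers_empty [simp]: "countable_covers {}"
  unfolding countable_covers_def by simp

lemma countable_covers_insert [simp]:
  "countable_covers (insert (b, \<C>) R) \<longleftrightarrow> (countable \<C> \<and> b \<subseteq> \<Union>\<C>) \<and> countable_covers R"
  unfolding countable_covers_def by (simp, blast)

lemma countable_covers_UN:
  "countable I \<Longrightarrow> (\<And>i. i \<in> I \<Longrightarrow> countable_covers (R i)) \<Longrightarrow> countable_covers (\<Union>i\<in>I. R i)"
  unfolding countable_covers_def by auto

lemma family_converges_disjoint:
  assumes "family_converges T d p" and "a \<in> d" and "b \<in> d" shows "a \<inter> b \<noteq> {}"
proof -
  have "\<Inter>{a, b} \<noteq> {}" using assms unfolding family_converges_def
    by (metis empty_subsetI finite.emptyI finite.insertI insert_subset)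
  then show ?thesis by simp
qed

lemma family_converges_nhd:
  "family_converges T d p \<Longrightarrow> openin T W \<Longrightarrow> p \<in> W \<Longrightarrow> \<exists>b\<in>d. b \<subseteq> W"
  unfolding family_converges_def by simp

lemma family_converges_topspace:
  "family_converges T d p \<Longrightarrow> topspace T \<in> d \<and> p \<in> topspace T"
  unfolding family_converges_def by simp

lemma described_byD:
  "described_by T R S \<Longrightarrow> family_converges T d p \<Longrightarrow> obeys d R \<Longrightarrow> S \<in> d \<Longrightarrow> p \<in> S"
  unfolding described_by_def by simp

text \<open>Carrying a set and its complement together turns the complement case into a swap. For an
  open set the complement needs no axioms, since a neighbourhood of the limit inside
  \<open>U\<close> would contradict consistency.\<close>

lemma sigma_sets_described:
  assumes "metrizable_space T" and "second_countable T"
    and "S \<in> sigma_sets (topspace T) {U. openin T U}"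
  obtains R where "countable_covers R" and "described_by T R S" and "described_by T R (topspace T - S)"
proof -
  let ?M = "topspace T"
  obtain \<B> where \<B>: "countable \<B>" "\<And>V. V \<in> \<B> \<Longrightarrow> openin T V"
    "\<And>U x. openin T U \<Longrightarrow> x \<in> U \<Longrightarrow> \<exists>V\<in>\<B>. x \<in> V \<and> V \<subseteq> U"
    using assms(2) unfolding second_countable_def by auto
  have "\<exists>R. countable_covers R \<and> described_by T R S \<and> described_by T R (?M - S)"
    using assms(3)
  proof induction
    case (Basic U)
    then have U: "openin T U" by simp
    \<comment> \<open>Consistency only makes the limit adherent to the members of the family, so the
      axiom for \<open>U\<close> offers basic sets whose closures stay inside \<open>U\<close>.
      Regularity provides enough of them.\<close>
    define \<C> where "\<C> = {b \<in> \<B>. T closure_of b \<subseteq> U}"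
    have "U \<subseteq> \<Union>\<C>"
    proof
      fix p assume p: "p \<in> U"
      have "neighbourhood_base_of (closedin T) T"
        using assms(1) metrizable_imp_regular_space neighbourhood_base_of_closedin by blast
      then obtain V K where V: "openin T V" "closedin T K" "p \<in> V" "V \<subseteq> K" "K \<subseteq> U"
        using U p unfolding neighbourhood_base_of by meson
      obtain b where b: "b \<in> \<B>" "p \<in> b" "b \<subseteq> V" using \<B>(3)[OF V(1,3)] by blast
      have "T closure_of b \<subseteq> K" using b V by (intro closure_of_minimal) auto
      then show "p \<in> \<Union>\<C>" using b V unfolding \<C>_def by blast
    qed
    moreover have "countable \<C>" unfolding \<C>_def using \<B>(1) by (rule countable_subset[rotated]) blast
    ultimately have "countable_covers {(U, \<C>)}" unfolding countable_covers_def by simp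
    moreover have "described_by T {(U, \<C>)} U"
      unfolding described_by_def
    proof (intro allI impI, elim conjE)
      fix d p assume d: "family_converges T d p" "obeys d {(U, \<C>)}" "U \<in> d"
      then obtain c where c: "c \<in> d" "T closure_of c \<subseteq> U" unfolding obeys_def \<C>_def by auto
      have "p \<in> T closure_of c"
        unfolding in_closure_of
      proof (intro conjI allI impI)
        show "p \<in> topspace T" using family_converges_topspace[OF d(1)] by blast
        fix W assume "p \<in> W \<and> openin T W"
        then obtain b where "b \<in> d" "b \<subseteq> W" using family_converges_nhd[OF d(1)] by blast
        then show "\<exists>y. y \<in> c \<and> y \<in> W" using family_converges_disjoint[OF d(1) _ c(1)] by blast
      qed
      then show "p \<in> U" using c(2) by blast
    qed
    moreover have "described_by T {(U, \<C>)} (?M - U)"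
      unfolding described_by_def
    proof (intro allI impI, elim conjE)
      fix d p assume d: "family_converges T d p" "?M - U \<in> d"
      have "p \<notin> U"
      proof
        assume "p \<in> U"
        then obtain b where "b \<in> d" "b \<subseteq> U" using family_converges_nhd[OF d(1) U] by blast
        then show False using family_converges_disjoint[OF d(1) _ d(2)] by blast
      qed
      then show "p \<in> ?M - U" using family_converges_topspace[OF d(1)] by blast
    qed
    ultimately show ?case by blast
  next
    case Empty
    have "described_by T {} {}"
      unfolding described_by_def using family_converges_disjoint by fastforce
    moreover have "described_by T {} (?M - {})"
      unfolding described_by_def family_converges_def by auto
    ultimately show ?case by (intro exI[of _ "{}"]) (auto simp: countable_covers_def)
  next
    case (Compl a)
    then obtain R where R: "countable_covers R" "described_by T R a" "described_by T R (?M - a)" by blast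
    have "?M - (?M - a) = a" using sigma_sets_into_sp[OF _ Compl.hyps] openin_subset by blast
    then show ?case using R by metis
  next
    case (Union a)
    then have "\<forall>i. \<exists>R. countable_covers R \<and> described_by T R (a i) \<and> described_by T R (?M - a i)" by blast
    then obtain R where R: "\<And>i. countable_covers (R i)" "\<And>i. described_by T (R i) (a i)"
      "\<And>i. described_by T (R i) (?M - a i)" by metis
    have sub: "a i \<subseteq> ?M" for i using sigma_sets_into_sp[OF _ Union.hyps] openin_subset by blast
    \<comment> \<open>The axioms \<open>(?M, {a i, ?M - a i})\<close> force the family to decide
      every \<open>a i\<close>. If the complement of the union is a member, consistency excludes
      \<open>a i\<close> and leaves its complement.\<close>
    define R' where "R' = (\<Union>i. R i) \<union> {(\<Union>i. a i, range a)} \<union> (\<Union>i. {(?M, {a i, ?M - a i})})"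
    have "countable_covers R'"
      unfolding R'_def countable_covers_Un using R(1) sub
      by (intro conjI countable_covers_UN) auto
    moreover have "described_by T R' (\<Union>i. a i)"
      unfolding described_by_def
    proof (intro allI impI, elim conjE)
      fix d p assume d: "family_converges T d p" "obeys d R'" "(\<Union>i. a i) \<in> d"
      then obtain i where "a i \<in> d" unfolding R'_def by (auto simp: obeys_def)
      moreover have "obeys d (R i)" using d(2) by (rule obeys_mono) (auto simp: R'_def)
      ultimately show "p \<in> (\<Union>i. a i)" using described_byD[OF R(2) d(1)] by blast
    qed
    moreover have "described_by T R' (?M - (\<Union>i. a i))"
      unfolding described_by_def
    proof (intro allI impI, elim conjE)
      fix d p assume d: "family_converges T d p" "obeys d R'" "?M - (\<Union>i. a i) \<in> d"
      have "p \<in> ?M - a i" for i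
      proof -
        have "obeys d {(?M, {a i, ?M - a i})}"
          using d(2) by (rule obeys_mono) (auto simp: R'_def)
        moreover have "?M \<in> d" using family_converges_topspace[OF d(1)] by blast
        moreover have "a i \<notin> d" using family_converges_disjoint[OF d(1) _ d(3), of "a i"] by blast
        ultimately have "?M - a i \<in> d" unfolding obeys_def by auto
        moreover have "obeys d (R i)" using d(2) by (rule obeys_mono) (auto simp: R'_def)
        ultimately show ?thesis using described_byD[OF R(3) d(1)] by blast
      qed
      then show "p \<in> ?M - (\<Union>i. a i)" by blast
    qed
    ultimately show ?case by blast
  qed
  then show thesis using that by blast
qed

text \<open>For each \<open>n\<close> one axiom forces a member inside a closed ball of radius
  \<open>1 / Suc n\<close>. The closures of the members then have the finite intersection property
  and include arbitrarily small sets, so completeness yields a common point.\<close>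

lemma completely_metrizable_convergence:
  assumes "completely_metrizable_space T" and "second_countable T"
  obtains R where "countable_covers R"
    and "\<And>d. topspace T \<in> d \<Longrightarrow> (\<And>F. finite F \<Longrightarrow> F \<subseteq> d \<Longrightarrow> \<Inter>F \<noteq> {}) \<Longrightarrow> obeys d R \<Longrightarrow>
      \<exists>p. family_converges T d p"
proof -
  obtain M \<rho> where M: "Metric_space M \<rho>" "Metric_space.mcomplete M \<rho>"
    and T: "T = Metric_space.mtopology M \<rho>"
    using assms(1) unfolding completely_metrizable_space_def by blast
  interpret Metric_space M \<rho> by (rule M(1))
  have top: "topspace T = M" unfolding T by simp
  obtain \<B> where \<B>: "countable \<B>" "\<And>V. V \<in> \<B> \<Longrightarrow> openin T V"
    "\<And>U x. openin T U \<Longrightarrow> x \<in> U \<Longrightarrow> \<exists>V\<in>\<B>. x \<in> V \<and> V \<subseteq> U"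
    using assms(2) unfolding second_countable_def by auto
  define \<C> where "\<C> n = {b \<in> \<B>. \<exists>a. b \<subseteq> mcball a (1 / Suc n)}" for n :: nat
  define R where "R = (\<Union>n. {(M, \<C> n)})"
  have cov: "M \<subseteq> \<Union>(\<C> n)" for n
  proof
    fix p assume p: "p \<in> M"
    then have "p \<in> mball p (1 / Suc n)" by simp
    then obtain b where "b \<in> \<B>" "p \<in> b" "b \<subseteq> mball p (1 / Suc n)"
      using \<B>(3)[of "mball p (1 / Suc n)" p] unfolding T by blast
    then show "p \<in> \<Union>(\<C> n)" unfolding \<C>_def using mball_subset_mcball by blast
  qed
  have "countable (\<C> n)" for n
    unfolding \<C>_def using \<B>(1) by (rule countable_subset[rotated]) blast
  then have "countable_covers R"
    unfolding R_def using cov by (intro countable_covers_UN) auto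
  moreover have "\<exists>p. family_converges T d p"
    if d: "topspace T \<in> d" "\<And>F. finite F \<Longrightarrow> F \<subseteq> d \<Longrightarrow> \<Inter>F \<noteq> {}" "obeys d R" for d
  proof -
    let ?\<D> = "(\<lambda>b. mtopology closure_of b) ` {b \<in> d. b \<subseteq> M}"
    have small: "\<exists>b\<in>d. b \<subseteq> M \<and> (\<exists>a. b \<subseteq> mcball a e)" if "e > 0" for e
    proof -
      obtain n :: nat where n: "1 / Suc n < e" using \<open>e > 0\<close> nat_approx_posE by metis
      obtain b where b: "b \<in> \<C> n" "b \<in> d" using d(1,3) top unfolding R_def obeys_def by auto
      then obtain a where "b \<subseteq> mcball a (1 / Suc n)" unfolding \<C>_def by blast
      moreover have "mcball a (1 / Suc n) \<subseteq> mcball a e" using n by (intro mcball_subset_concentric) simp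
      moreover have "b \<subseteq> M" using b(1) \<B>(2) openin_subset top unfolding \<C>_def by blast
      ultimately show ?thesis using b(2) by blast
    qed
    have "\<Inter>?\<D> \<noteq> {}"
    proof (rule mcomplete_fip[THEN iffD1, OF M(2), rule_format], intro conjI allI impI ballI)
      fix e :: real assume "e > 0"
      then obtain b a where b: "b \<in> d" "b \<subseteq> M" "b \<subseteq> mcball a e" using small by blast
      then have "mtopology closure_of b \<subseteq> mcball a e" by (intro closure_of_minimal) auto
      then show "\<exists>C a. C \<in> ?\<D> \<and> C \<subseteq> mcball a e" using b by blast
    next
      fix F assume F: "finite F \<and> F \<subseteq> ?\<D>"
      then obtain F' where F': "F' \<subseteq> {b \<in> d. b \<subseteq> M}" "finite F'" "F = (\<lambda>b. mtopology closure_of b) ` F'"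
        using finite_subset_image[OF conjunct1[OF F] conjunct2[OF F]] by (elim exE conjE)
      have "\<Inter>(insert M F') \<noteq> {}" by (rule d(2)) (use F'(1,2) d(1) top in auto)
      moreover have "b \<subseteq> mtopology closure_of b" if "b \<in> F'" for b
        using that F'(1) by (intro closure_of_subset) auto
      then have "\<Inter>(insert M F') \<subseteq> \<Inter>F" unfolding F'(3) by blast
      ultimately show "\<Inter>F \<noteq> {}" by blast
    qed auto
    then obtain p where p: "\<And>b. b \<in> d \<Longrightarrow> b \<subseteq> M \<Longrightarrow> p \<in> mtopology closure_of b" by auto
    have pM: "p \<in> M" using p[of M] d(1) top by (simp add: in_closure_of)
    have "\<exists>b\<in>d. b \<subseteq> W" if W: "openin T W" "p \<in> W" for W
    proof -
      obtain r where r: "r > 0" "mball p r \<subseteq> W" using W unfolding T openin_mtopology by blast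
      \<comment> \<open>Two points of a closed ball of radius \<open>r / 3\<close> are less than
        \<open>r\<close> apart, which places \<open>b\<close> in the ball of radius \<open>r\<close>
        about \<open>p\<close>.\<close>
      obtain b a where b: "b \<in> d" "b \<subseteq> M" "b \<subseteq> mcball a (r / 3)" using small[of "r / 3"] r(1) by auto
      have "mtopology closure_of b \<subseteq> mcball a (r / 3)" using b by (intro closure_of_minimal) auto
      then have pa: "p \<in> mcball a (r / 3)" using p b by blast
      have "b \<subseteq> mball p r"
      proof
        fix z assume "z \<in> b"
        then have "z \<in> mcball a (r / 3)" using b by blast
        then show "z \<in> mball p r" using pa r(1) triangle[of p a z] commute[of p a] by auto
      qed
      then show ?thesis using b(1) r(2) by blast
    qed
    then have "family_converges T d p"
      unfolding family_converges_def using d pM top by auto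
    then show ?thesis ..
  qed
  ultimately show thesis using that by blast
qed

section \<open>Separation of images by members of a sigma-algebra\<close>

definition separable_by :: "'b set set \<Rightarrow> 'b set \<Rightarrow> 'b set \<Rightarrow> bool" where
  "separable_by \<S> X Y \<longleftrightarrow> (\<exists>B\<in>\<S>. X \<subseteq> B \<and> Y \<inter> B = {})"

lemma separable_by_sym:
  assumes "sigma_algebra \<Omega> \<S>" and "X \<subseteq> \<Omega>" and "Y \<subseteq> \<Omega>" and "separable_by \<S> X Y"
  shows "separable_by \<S> Y X"
proof -
  obtain B where B: "B \<in> \<S>" "X \<subseteq> B" "Y \<inter> B = {}"
    using assms(4) unfolding separable_by_def by (elim bexE conjE)
  interpret sigma_algebra \<Omega> \<S> by (rule assms(1))
  have "\<Omega> - B \<in> \<S>" using B(1) by (rule compl_sets)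
  moreover have "Y \<subseteq> \<Omega> - B" "X \<inter> (\<Omega> - B) = {}" using B(2,3) assms(3) by blast+
  ultimately show ?thesis unfolding separable_by_def by (intro bexI[of _ "\<Omega> - B"] conjI)
qed

text \<open>Used contrapositively: if \<open>X\<close> is inseparable from \<open>Y\<close>, then so
  is one of countably many pieces covering \<open>X\<close>. This is how an inseparable pair is
  shrunk.\<close>

lemma separable_by_Union:
  assumes "sigma_algebra \<Omega> \<S>" and "countable I" and "X \<subseteq> (\<Union>i\<in>I. X' i)"
    and "\<And>i. i \<in> I \<Longrightarrow> separable_by \<S> (X' i) Y"
  shows "separable_by \<S> X Y"
proof -
  obtain B where B: "\<And>i. i \<in> I \<Longrightarrow> B i \<in> \<S> \<and> X' i \<subseteq> B i \<and> Y \<inter> B i = {}"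
    using assms(4) unfolding separable_by_def by metis
  have "(\<Union>i\<in>I. B i) \<in> \<S>"
    using sigma_algebra.countable_UN'[OF assms(1) assms(2)] B by blast
  moreover have "X \<subseteq> (\<Union>i\<in>I. B i)" "Y \<inter> (\<Union>i\<in>I. B i) = {}" using assms(3) B by blast+
  ultimately show ?thesis unfolding separable_by_def by (intro bexI[of _ "\<Union>i\<in>I. B i"] conjI)
qed

lemma image_Inter_cover:
  assumes "b \<in> s" and "b \<subseteq> \<Union>\<C>"
  shows "f ` \<Inter>s \<subseteq> (\<Union>c\<in>\<C>. f ` \<Inter>(insert c s))"
proof (rule image_subsetI)
  fix x assume x: "x \<in> \<Inter>s"
  then obtain c where "c \<in> \<C>" "x \<in> c" using assms by blast
  then show "f x \<in> (\<Union>c\<in>\<C>. f ` \<Inter>(insert c s))"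
    using x by (intro UN_I[of c] imageI) simp_all
qed

text \<open>Without a separator both sets can be shrunk, staying inseparable, until all axioms are
  answered; the two families then converge to some \<open>p\<close> in \<open>P\<close> and
  \<open>q\<close> in \<open>Q\<close>. A member of \<open>\<A>\<close> that tells
  \<open>f p\<close> from \<open>f q\<close> separates the images already at a finite stage.\<close>

theorem lusin_separation:
  fixes f :: "'a \<Rightarrow> 'b"
  assumes T: "completely_metrizable_space T" "second_countable T"
    and \<S>: "sigma_algebra \<Omega> \<S>"
    and P: "P \<in> sigma_sets (topspace T) {U. openin T U}" "f ` P \<subseteq> \<Omega>"
    and Q: "Q \<in> sigma_sets (topspace T) {U. openin T U}" "f ` Q \<subseteq> \<Omega>"
    and \<A>: "countable \<A>" "\<A> \<subseteq> \<S>"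
    and fP: "\<And>A. A \<in> \<A> \<Longrightarrow> {p \<in> P. f p \<in> A} \<in> sigma_sets (topspace T) {U. openin T U}"
    and fQ: "\<And>A. A \<in> \<A> \<Longrightarrow> {q \<in> Q. f q \<in> A} \<in> sigma_sets (topspace T) {U. openin T U}"
    and sep: "\<And>p q. p \<in> P \<Longrightarrow> q \<in> Q \<Longrightarrow> \<exists>A\<in>\<A>. (f p \<in> A) \<noteq> (f q \<in> A)"
  obtains B where "B \<in> \<S>" and "f ` P \<subseteq> B" and "f ` Q \<inter> B = {}"
proof -
  let ?M = "topspace T" and ?\<sigma> = "sigma_sets (topspace T) {U. openin T U}"
  interpret M: sigma_algebra ?M ?\<sigma> by (rule sigma_algebra_sigma_sets) (use openin_subset in blast)
  interpret S: sigma_algebra \<Omega> \<S> by (rule \<S>)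
  obtain R0 where R0: "countable_covers R0" and conv: "\<And>d. ?M \<in> d \<Longrightarrow>
      (\<And>F. finite F \<Longrightarrow> F \<subseteq> d \<Longrightarrow> \<Inter>F \<noteq> {}) \<Longrightarrow> obeys d R0 \<Longrightarrow> \<exists>p. family_converges T d p"
    by (rule completely_metrizable_convergence[OF T]) (rule that, assumption, blast)
  have "\<exists>R. countable_covers R \<and> described_by T R S \<and> described_by T R (?M - S)" if "S \<in> ?\<sigma>" for S
    using sigma_sets_described[OF completely_metrizable_imp_metrizable_space[OF T(1)] T(2) that] by blast
  then obtain D where D: "\<And>S. S \<in> ?\<sigma> \<Longrightarrow> countable_covers (D S) \<and> described_by T (D S) S" by metis
  define part where "part X A = {p \<in> X. f p \<in> A}" for X A
  \<comment> \<open>These axioms put the limit into \<open>X\<close>, force the family to decide for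
    each \<open>A\<close> which side of \<open>X\<close> to choose, and make this choice binding for
    the limit.\<close>
  define RX where "RX X = D X \<union> (\<Union>A\<in>\<A>. D (part X A) \<union> D (X - part X A) \<union>
      {(X, {part X A, X - part X A})})" for X
  define R where "R = R0 \<union> RX P \<union> RX Q"
  have covX: "countable_covers (RX X)" if "X \<in> ?\<sigma>" "\<And>A. A \<in> \<A> \<Longrightarrow> part X A \<in> ?\<sigma>" for X
    unfolding RX_def countable_covers_Un using that D \<A>(1)
    by (intro conjI countable_covers_UN) (simp_all add: M.Diff subset_eq)
  have part: "part P A \<in> ?\<sigma>" "part Q A \<in> ?\<sigma>" if "A \<in> \<A>" for A
    using fP fQ that unfolding part_def by auto
  have R: "countable_covers R" unfolding R_def using R0 covX P(1) Q(1) part by simp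
  have limX: "p \<in> X \<and> (\<forall>A\<in>\<A>. (f p \<in> A \<longrightarrow> part X A \<in> d) \<and> (f p \<notin> A \<longrightarrow> X - part X A \<in> d))"
    if X: "X \<in> ?\<sigma>" "\<And>A. A \<in> \<A> \<Longrightarrow> part X A \<in> ?\<sigma>" and d: "X \<in> d" "obeys d (RX X)" "family_converges T d p"
    for X d p
  proof (intro conjI ballI)
    have "obeys d (D X)" using d(2) by (rule obeys_mono) (auto simp: RX_def)
    then show "p \<in> X" using described_byD[OF conjunct2[OF D[OF X(1)]] d(3) _ d(1)] by blast
    fix A assume A: "A \<in> \<A>"
    have r: "obeys d (D (part X A))" "obeys d (D (X - part X A))"
      "obeys d {(X, {part X A, X - part X A})}"
      using A by (auto intro!: obeys_mono[OF d(2)] simp: RX_def)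
    have "part X A \<in> d \<Longrightarrow> p \<in> part X A"
      using described_byD[OF conjunct2[OF D[OF X(2)[OF A]]] d(3) r(1)] by blast
    moreover have "X - part X A \<in> d \<Longrightarrow> p \<in> X - part X A"
      using described_byD[OF conjunct2[OF D[OF M.Diff[OF X(1) X(2)[OF A]]]] d(3) r(2)] by blast
    moreover have "part X A \<in> d \<or> X - part X A \<in> d" using r(3) d(1) unfolding obeys_def by auto
    ultimately show "f p \<in> A \<longrightarrow> part X A \<in> d" "f p \<notin> A \<longrightarrow> X - part X A \<in> d"
      unfolding part_def by blast+
  qed
  \<comment> \<open>A stage is a pair of families, and the invariant is that the images of their
    intersections are inseparable. In particular both intersections are nonempty, which gives the
    finite intersection property in the limit.\<close>
  define N0 where "N0 = (\<lambda>(s, t). finite s \<and> finite t \<and> ?M \<in> s \<and> ?M \<in> t \<and> P \<in> s \<and> Q \<in> t \<and>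
      \<not> separable_by \<S> (f ` \<Inter>s) (f ` \<Inter>t))"
  define le0 :: "'a set set \<times> 'a set set \<Rightarrow> 'a set set \<times> 'a set set \<Rightarrow> bool"
    where "le0 = (\<lambda>(s', t') (s, t). s \<subseteq> s' \<and> t \<subseteq> t')"
  define task :: "bool \<times> 'a set \<times> 'a set set \<Rightarrow> 'a set set \<times> 'a set set \<Rightarrow> bool" where
    "task = (\<lambda>(left, b, \<C>) (s, t). if left then b \<in> s \<longrightarrow> (\<exists>c\<in>\<C>. c \<in> s) else b \<in> t \<longrightarrow> (\<exists>c\<in>\<C>. c \<in> t))"
  have "separable_by \<S> (f ` P) (f ` Q)"
  proof (rule ccontr)
    assume nsep: "\<not> separable_by \<S> (f ` P) (f ` Q)"
    have sub: "P \<subseteq> ?M" "Q \<subseteq> ?M" using P(1) Q(1) M.sets_into_space by blast+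
    \<comment> \<open>The extra task \<open>(True, {}, {{}})\<close> keeps the set of tasks nonempty
      when \<open>R\<close> is empty.\<close>
    obtain c where c0: "c 0 = ({?M, P}, {?M, Q})" and cN: "\<And>k. N0 (c k)"
      and dec: "\<And>k. le0 (c (Suc k)) (c k)"
      and fair: "\<And>u m. u \<in> insert (True, {}, {{}}) (UNIV \<times> R) \<Longrightarrow> \<exists>k\<ge>m. task u (c k)"
    proof (rule fair_chain[of "insert (True, {}, {{}}) (UNIV \<times> R)" N0 "({?M, P}, {?M, Q})" le0 task])
      show "countable (insert (True, {}, {{}}) (UNIV \<times> R))"
        using R unfolding countable_covers_def by simp
      show "N0 ({?M, P}, {?M, Q})" unfolding N0_def using nsep sub by (simp add: Int_absorb1)
    next
      fix u st assume u: "u \<in> insert (True, {}, {{}}) (UNIV \<times> R)" and N: "N0 st"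
      obtain s t where st: "st = (s, t)" by (cases st)
      obtain left b \<C> where u_eq: "u = (left, b, \<C>)" by (cases u)
      have \<C>: "countable \<C>" "b \<subseteq> \<Union>\<C>" using u R unfolding u_eq countable_covers_def by auto
      have Ns: "finite s" "finite t" "?M \<in> s" "?M \<in> t" "P \<in> s" "Q \<in> t"
        "\<not> separable_by \<S> (f ` \<Inter>s) (f ` \<Inter>t)" using N unfolding st N0_def by auto
      have in\<Omega>: "P \<in> s' \<Longrightarrow> f ` \<Inter>s' \<subseteq> \<Omega>" "Q \<in> t' \<Longrightarrow> f ` \<Inter>t' \<subseteq> \<Omega>" for s' t'
        using P(2) Q(2) by blast+
      consider "task u st" | "left" "b \<in> s" | "\<not> left" "b \<in> t"
        unfolding u_eq st task_def by (cases left) auto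
      then show "\<exists>st'. N0 st' \<and> le0 st' st \<and> task u st'"
      proof cases
        case 1
        then show ?thesis using N st by (intro exI[of _ st]) (auto simp: le0_def)
      next
        case 2
        have "\<exists>c\<in>\<C>. \<not> separable_by \<S> (f ` \<Inter>(insert c s)) (f ` \<Inter>t)"
        proof (rule ccontr)
          assume "\<not> ?thesis"
          then have "separable_by \<S> (f ` \<Inter>(insert c s)) (f ` \<Inter>t)" if "c \<in> \<C>" for c
            using that by blast
          then have "separable_by \<S> (f ` \<Inter>s) (f ` \<Inter>t)"
            by (rule separable_by_Union[OF \<S> \<C>(1) image_Inter_cover[OF 2(2) \<C>(2)]])
          then show False using Ns(7) by contradiction
        qed
        then obtain c where "c \<in> \<C>" "\<not> separable_by \<S> (f ` \<Inter>(insert c s)) (f ` \<Inter>t)" by blast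
        then show ?thesis
          using Ns 2 unfolding u_eq st task_def N0_def le0_def by (intro exI[of _ "(insert c s, t)"]) auto
      next
        case 3
        have "\<exists>c\<in>\<C>. \<not> separable_by \<S> (f ` \<Inter>s) (f ` \<Inter>(insert c t))"
        proof (rule ccontr)
          assume n: "\<not> ?thesis"
          have "separable_by \<S> (f ` \<Inter>(insert c t)) (f ` \<Inter>s)" if "c \<in> \<C>" for c
            by (rule separable_by_sym[OF \<S> in\<Omega>]) (use n that Ns in auto)
          then have "separable_by \<S> (f ` \<Inter>t) (f ` \<Inter>s)"
            by (rule separable_by_Union[OF \<S> \<C>(1) image_Inter_cover[OF 3(2) \<C>(2)]])
          then show False using Ns(7) separable_by_sym[OF \<S> in\<Omega>(2)[OF Ns(6)] in\<Omega>(1)[OF Ns(5)]] by blast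
        qed
        then obtain c where "c \<in> \<C>" "\<not> separable_by \<S> (f ` \<Inter>s) (f ` \<Inter>(insert c t))" by blast
        then show ?thesis
          using Ns 3 unfolding u_eq st task_def N0_def le0_def by (intro exI[of _ "(s, insert c t)"]) auto
      qed
    qed (simp, rule that)
    define s t where "s k = fst (c k)" and "t k = snd (c k)" for k
    have c_eq: "c k = (s k, t k)" for k unfolding s_def t_def by simp
    have N: "finite (s k)" "finite (t k)" "?M \<in> s k" "?M \<in> t k" "P \<in> s k" "Q \<in> t k"
      "\<not> separable_by \<S> (f ` \<Inter>(s k)) (f ` \<Inter>(t k))" for k using cN[of k] unfolding c_eq N0_def by auto
    have step: "s k \<subseteq> s (Suc k)" "t k \<subseteq> t (Suc k)" for k
      using dec[of k] unfolding c_eq le0_def by simp_all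
    have mono: "s k \<subseteq> s l" "t k \<subseteq> t l" if "k \<le> l" for k l
      using lift_Suc_mono_le[of s, OF step(1) that] lift_Suc_mono_le[of t, OF step(2) that] by auto
    define ds dt where "ds = (\<Union>k. s k)" and "dt = (\<Union>k. t k)"
    have fin: "\<exists>k. F \<subseteq> (\<Union>k. r k) \<longrightarrow> F \<subseteq> r k"
      if "finite F" "\<And>k l. k \<le> l \<Longrightarrow> r k \<subseteq> r l" for F :: "'a set set" and r :: "nat \<Rightarrow> 'a set set"
      using that(1)
    proof induction
      case (insert a F)
      then obtain k where k: "F \<subseteq> (\<Union>k. r k) \<longrightarrow> F \<subseteq> r k" by blast
      show ?case
      proof (cases "insert a F \<subseteq> (\<Union>k. r k)")
        case True
        then obtain l where "a \<in> r l" by blast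
        then have "insert a F \<subseteq> r (max k l)"
          using k True that(2)[of k "max k l"] that(2)[of l "max k l"] by auto
        then show ?thesis by blast
      qed blast
    qed blast
    have limit: "obeys (\<Union>k. r k) R \<and> (\<exists>p. family_converges T (\<Union>k. r k) p)"
      if r: "\<And>k. ?M \<in> r k" "\<And>k l. k \<le> l \<Longrightarrow> r k \<subseteq> r l" "\<And>k. \<Inter>(r k) \<noteq> {}"
        and fair': "\<And>b \<C> k. (b, \<C>) \<in> R \<Longrightarrow> \<exists>l\<ge>k. b \<in> r l \<longrightarrow> (\<exists>c\<in>\<C>. c \<in> r l)" for r :: "nat \<Rightarrow> 'a set set"
    proof
      show R: "obeys (\<Union>k. r k) R" unfolding obeys_def
      proof (intro ballI, clarify)
        fix b \<C> k assume b: "(b, \<C>) \<in> R" "b \<in> r k"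
        from fair'[OF b(1), of k] obtain l where "l \<ge> k" "b \<in> r l \<longrightarrow> (\<exists>c\<in>\<C>. c \<in> r l)" by blast
        then show "\<exists>c\<in>\<C>. c \<in> \<Union>(range r)" using r(2)[of k l] b(2) by auto
      qed
      show "\<exists>p. family_converges T (\<Union>k. r k) p"
      proof (rule conv)
        show "?M \<in> (\<Union>k. r k)" using r(1) by blast
        show "\<Inter>F \<noteq> {}" if F: "finite F" "F \<subseteq> (\<Union>k. r k)" for F
        proof -
          obtain k where "F \<subseteq> r k" using fin[of F r, OF F(1) r(2)] F(2) by blast
          then show ?thesis using r(3)[of k] by blast
        qed
        show "obeys (\<Union>k. r k) R0" using R by (rule obeys_mono) (simp add: R_def Un_assoc)
      qed
    qed
    have sne: "\<Inter>(s k) \<noteq> {}" for k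
    proof
      assume "\<Inter>(s k) = {}"
      then have "separable_by \<S> (f ` \<Inter>(s k)) (f ` \<Inter>(t k))"
        unfolding separable_by_def by (intro bexI[of _ "{}"]) auto
      then show False using N(7) by blast
    qed
    have tne: "\<Inter>(t k) \<noteq> {}" for k
    proof
      assume e: "\<Inter>(t k) = {}"
      have "f ` \<Inter>(s k) \<subseteq> \<Omega>" using P(2) N(5)[of k] by blast
      then have "separable_by \<S> (f ` \<Inter>(s k)) (f ` \<Inter>(t k))"
        unfolding separable_by_def e by (intro bexI[of _ "\<Omega>"]) auto
      then show False using N(7) by blast
    qed
    have fs: "\<exists>l\<ge>k. b \<in> s l \<longrightarrow> (\<exists>c\<in>\<C>. c \<in> s l)" if "(b, \<C>) \<in> R" for b \<C> k
      using fair[of "(True, b, \<C>)" k] that unfolding task_def c_eq by simp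
    have ft: "\<exists>l\<ge>k. b \<in> t l \<longrightarrow> (\<exists>c\<in>\<C>. c \<in> t l)" if "(b, \<C>) \<in> R" for b \<C> k
      using fair[of "(False, b, \<C>)" k] that unfolding task_def c_eq by simp
    have "obeys ds R \<and> (\<exists>p. family_converges T ds p)"
      unfolding ds_def by (rule limit[OF N(3) mono(1) sne fs])
    then obtain p where rs: "obeys ds R" and p: "family_converges T ds p" by (elim conjE exE)
    have "obeys dt R \<and> (\<exists>q. family_converges T dt q)"
      unfolding dt_def by (rule limit[OF N(4) mono(2) tne ft])
    then obtain q where rt: "obeys dt R" and q: "family_converges T dt q" by (elim conjE exE)
    have "P \<in> ds" "Q \<in> dt" using N(5,6) unfolding ds_def dt_def by blast+
    have pP: "p \<in> P \<and> (\<forall>A\<in>\<A>. (f p \<in> A \<longrightarrow> part P A \<in> ds) \<and> (f p \<notin> A \<longrightarrow> P - part P A \<in> ds))"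
      by (rule limX[OF P(1) part(1) \<open>P \<in> ds\<close> _ p]) (use rs in \<open>auto simp: R_def\<close>)
    have qQ: "q \<in> Q \<and> (\<forall>A\<in>\<A>. (f q \<in> A \<longrightarrow> part Q A \<in> dt) \<and> (f q \<notin> A \<longrightarrow> Q - part Q A \<in> dt))"
      by (rule limX[OF Q(1) part(2) \<open>Q \<in> dt\<close> _ q]) (use rt in \<open>auto simp: R_def\<close>)
    obtain A where A: "A \<in> \<A>" "(f p \<in> A) \<noteq> (f q \<in> A)"
      using sep[OF conjunct1[OF pP] conjunct1[OF qQ]] by (elim bexE)
    note parts = bspec[OF conjunct2[OF pP] A(1)] bspec[OF conjunct2[OF qQ] A(1)]
    \<comment> \<open>The two families have decided \<open>A\<close> in opposite ways, so
      \<open>A\<close> or its complement separates the images at any stage that contains both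
      decisions.\<close>
    obtain S1 S2 B where S12: "S1 \<in> ds" "S2 \<in> dt" "B \<in> \<S>" "f ` (S1 \<inter> P) \<subseteq> B" "f ` (S2 \<inter> Q) \<inter> B = {}"
    proof (cases "f p \<in> A")
      case True
      show ?thesis
      proof (rule that)
        show "part P A \<in> ds" "Q - part Q A \<in> dt" using True A(2) parts by simp_all
        show "A \<in> \<S>" using A(1) \<A>(2) by blast
      qed (auto simp: part_def)
    next
      case False
      show ?thesis
      proof (rule that)
        show "P - part P A \<in> ds" "part Q A \<in> dt" using False A(2) parts by simp_all
        show "\<Omega> - A \<in> \<S>" using A(1) \<A>(2) by blast
      qed (use P(2) in \<open>auto simp: part_def\<close>)
    qed
    obtain k l where "S1 \<in> s k" "S2 \<in> t l" using S12(1,2) unfolding ds_def dt_def by blast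
    then have "S1 \<in> s (max k l)" "S2 \<in> t (max k l)"
      using mono(1)[of k "max k l"] mono(2)[of l "max k l"] by auto
    then have "\<Inter>(s (max k l)) \<subseteq> S1 \<inter> P" "\<Inter>(t (max k l)) \<subseteq> S2 \<inter> Q" using N(5,6) by blast+
    then have "f ` \<Inter>(s (max k l)) \<subseteq> f ` (S1 \<inter> P)" "f ` \<Inter>(t (max k l)) \<subseteq> f ` (S2 \<inter> Q)"
      by (simp_all only: image_mono)
    then have "separable_by \<S> (f ` \<Inter>(s (max k l))) (f ` \<Inter>(t (max k l)))"
      unfolding separable_by_def using S12(4,5) by (intro bexI[OF _ S12(3)]) blast
    then show False using N(7) by blast
  qed
  then obtain B where "B \<in> \<S>" "f ` P \<subseteq> B" "f ` Q \<inter> B = {}"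
    unfolding separable_by_def by (elim bexE conjE)
  then show thesis by (rule that)
qed

section \<open>Standard Borel spaces\<close>

text \<open>It suffices to agree with \<open>y\<close> on a countable base. A base set containing
  \<open>y\<close> contributes the implication from the whole space to its preimage, any other base
  set the implication from its preimage to the empty set.\<close>

lemma pi02_in_indistinguishable:
  assumes f: "continuous_map T Q f" and Q: "second_countable Q"
  shows "pi02_in T {g \<in> topspace T. \<forall>W. openin Q W \<longrightarrow> (f g \<in> W \<longleftrightarrow> y \<in> W)}"
proof -
  obtain \<B> where \<B>: "countable \<B>" "\<And>V. V \<in> \<B> \<Longrightarrow> openin Q V"
    "\<And>U x. openin Q U \<Longrightarrow> x \<in> U \<Longrightarrow> \<exists>V\<in>\<B>. x \<in> V \<and> V \<subseteq> U"
    using Q unfolding second_countable_def by auto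
  let ?b = "from_nat_into (insert {} \<B>)"
  let ?pre = "\<lambda>n. {g \<in> topspace T. f g \<in> ?b n}"
  have b: "openin Q (?b n)" for n
    using from_nat_into[of "insert {} \<B>" n] \<B>(2) by auto
  have pre: "openin T (?pre n)" for n using f b by (rule openin_continuous_map_preimage)
  have b_surj: "\<exists>n. ?b n = V" if "V \<in> \<B>" for V
    using from_nat_into_surj[of "insert {} \<B>" V] \<B>(1) that by auto
  define U where "U n = (if y \<in> ?b n then topspace T else ?pre n)" for n
  define V where "V n = (if y \<in> ?b n then ?pre n else {})" for n
  have fwd: "(f g \<in> W \<longleftrightarrow> y \<in> W)" if g: "g \<in> topspace T" "\<And>n. g \<notin> U n - V n" and W: "openin Q W" for g W
  proof -
    have n: "f g \<in> ?b n \<longleftrightarrow> y \<in> ?b n" for n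
      using g(1) g(2)[of n] unfolding U_def V_def by (auto split: if_splits)
    have *: "f g \<in> O' \<longleftrightarrow> y \<in> O'" if "O' \<in> \<B>" for O' using n b_surj[OF that] by metis
    show ?thesis using \<B>(3)[OF W, of "f g"] \<B>(3)[OF W, of y] * by blast
  qed
  have bwd: "g \<notin> U n - V n" if "g \<in> topspace T" "\<forall>W. openin Q W \<longrightarrow> (f g \<in> W \<longleftrightarrow> y \<in> W)" for g n
  proof -
    have "f g \<in> ?b n \<longleftrightarrow> y \<in> ?b n" using that(2) b[of n] by blast
    then show ?thesis using that(1) unfolding U_def V_def by auto
  qed
  have "(\<forall>W. openin Q W \<longrightarrow> (f g \<in> W \<longleftrightarrow> y \<in> W)) \<longleftrightarrow> g \<notin> (\<Union>n. U n - V n)" if "g \<in> topspace T" for g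
  proof
    assume "\<forall>W. openin Q W \<longrightarrow> (f g \<in> W \<longleftrightarrow> y \<in> W)"
    then show "g \<notin> (\<Union>n. U n - V n)" using bwd[OF that] by (simp only: UN_iff) blast
  next
    assume "g \<notin> (\<Union>n. U n - V n)"
    then have "g \<notin> U n - V n" for n by (simp only: UN_iff) blast
    then show "\<forall>W. openin Q W \<longrightarrow> (f g \<in> W \<longleftrightarrow> y \<in> W)"
      using fwd[OF that] by blast
  qed
  then have "{g \<in> topspace T. \<forall>W. openin Q W \<longrightarrow> (f g \<in> W \<longleftrightarrow> y \<in> W)} = topspace T - (\<Union>n. U n - V n)"
    by (intro set_eqI) (simp only: mem_Collect_eq Diff_iff cong: conj_cong)
  then show ?thesis
    unfolding pi02_in_def using pre by (intro exI[of _ U] exI[of _ V]) (auto simp: U_def V_def)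
qed

lemma standard_borel_separating:
  assumes "standard_borel_space M"
  obtains \<A> where "countable \<A>" and "\<A> \<subseteq> sets M"
    and "\<And>p q. p \<in> space M \<Longrightarrow> q \<in> space M \<Longrightarrow> p \<noteq> q \<Longrightarrow> \<exists>A\<in>\<A>. (p \<in> A) \<noteq> (q \<in> A)"
proof -
  obtain T where T: "topspace T = space M" "completely_metrizable_space T" "second_countable T"
    "sets M = sigma_sets (space M) {U. openin T U}"
    using assms unfolding standard_borel_space_def by blast
  obtain \<B> where \<B>: "countable \<B>" "\<And>V. V \<in> \<B> \<Longrightarrow> openin T V"
    "\<And>U x. openin T U \<Longrightarrow> x \<in> U \<Longrightarrow> \<exists>V\<in>\<B>. x \<in> V \<and> V \<subseteq> U"
    using T(3) unfolding second_countable_def by auto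
  show thesis
  proof (rule that[OF \<B>(1)])
    show "\<B> \<subseteq> sets M" unfolding T(4) using \<B>(2) by (auto intro: sigma_sets.Basic)
    fix p q assume pq: "p \<in> space M" "q \<in> space M" "p \<noteq> q"
    have "t1_space T"
      using T(2) completely_metrizable_imp_metrizable_space metrizable_imp_t1_space by blast
    then obtain U where U: "openin T U" "p \<in> U" "q \<notin> U" using pq T(1) unfolding t1_space_def by metis
    show "\<exists>A\<in>\<B>. (p \<in> A) \<noteq> (q \<in> A)" using \<B>(3)[OF U(1,2)] U(3) by blast
  qed
qed

lemma standard_borel_singleton:
  assumes "standard_borel_space M" and "x \<in> space M" shows "{x} \<in> sets M"
proof -
  obtain T where T: "topspace T = space M" "completely_metrizable_space T"
    "sets M = sigma_sets (space M) {U. openin T U}"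
    using assms(1) unfolding standard_borel_space_def by blast
  have "t1_space T"
    using T(2) completely_metrizable_imp_metrizable_space metrizable_imp_t1_space by blast
  then have "closedin T {x}" using assms(2) T(1) by (metis closedin_t1_singleton)
  then have "openin T (space M - {x})" using T(1) unfolding closedin_def by simp
  then have "space M - {x} \<in> sets M" unfolding T(3) by (simp add: sigma_sets.Basic)
  then have "space M - (space M - {x}) \<in> sets M" by (rule sets.compl_sets)
  moreover have "space M - (space M - {x}) = {x}" using assms(2) by blast
  ultimately show ?thesis by simp
qed

lemma standard_borel_pair:
  assumes "standard_borel_space M" and "standard_borel_space N"
  shows "standard_borel_space (M \<Otimes>\<^sub>M N)"
proof -
  obtain T where T: "topspace T = space M" "completely_metrizable_space T" "second_countable T"
    "sets M = sigma_sets (space M) {U. openin T U}"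
    using assms(1) unfolding standard_borel_space_def by blast
  obtain T' where T': "topspace T' = space N" "completely_metrizable_space T'" "second_countable T'"
    "sets N = sigma_sets (space N) {U. openin T' U}"
    using assms(2) unfolding standard_borel_space_def by blast
  obtain \<B> where \<B>: "countable \<B>" "\<And>V. V \<in> \<B> \<Longrightarrow> openin T V"
    "\<And>U x. openin T U \<Longrightarrow> x \<in> U \<Longrightarrow> \<exists>V\<in>\<B>. x \<in> V \<and> V \<subseteq> U"
    using T(3) unfolding second_countable_def by auto
  obtain \<B>' where \<B>': "countable \<B>'" "\<And>V. V \<in> \<B>' \<Longrightarrow> openin T' V"
    "\<And>U x. openin T' U \<Longrightarrow> x \<in> U \<Longrightarrow> \<exists>V\<in>\<B>'. x \<in> V \<and> V \<subseteq> U"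
    using T'(3) unfolding second_countable_def by auto
  let ?P = "prod_topology T T'" and ?R = "(\<lambda>(b, b'). b \<times> b') ` (\<B> \<times> \<B>')"
  have R: "countable ?R" using \<B>(1) \<B>'(1) by simp
  have base: "\<exists>r\<in>?R. p \<in> r \<and> r \<subseteq> W" if W: "openin ?P W" "p \<in> W" for W p
  proof -
    obtain U V where "openin T U" "openin T' V" "fst p \<in> U" "snd p \<in> V" "U \<times> V \<subseteq> W"
      using W unfolding openin_prod_topology_alt by (metis prod.collapse)
    moreover from this obtain b b' where "b \<in> \<B>" "fst p \<in> b" "b \<subseteq> U" "b' \<in> \<B>'" "snd p \<in> b'" "b' \<subseteq> V"
      using \<B>(3) \<B>'(3) by meson
    ultimately show ?thesis by (intro bexI[of _ "b \<times> b'"]) (auto simp: mem_Times_iff)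
  qed
  have Ropen: "openin ?P r" if "r \<in> ?R" for r
    using that \<B>(2) \<B>'(2) by (auto simp: openin_prod_Times_iff)
  have "second_countable ?P"
    unfolding second_countable_def
    by (intro exI[of _ ?R] conjI ballI allI impI, rule R, erule Ropen, elim conjE, erule base)
  moreover have "completely_metrizable_space ?P"
    using T(2) T'(2) completely_metrizable_space_prod_topology by blast
  moreover have top: "topspace ?P = space (M \<Otimes>\<^sub>M N)" using T(1) T'(1) by (simp add: space_pair_measure)
  moreover have "sets (M \<Otimes>\<^sub>M N) = sigma_sets (space (M \<Otimes>\<^sub>M N)) {U. openin ?P U}"
  proof
    define L where "L = sigma (space (M \<Otimes>\<^sub>M N)) {U. openin ?P U}"
    have sub: "{U. openin ?P U} \<subseteq> Pow (space (M \<Otimes>\<^sub>M N))" using openin_subset top by blast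
    have L: "sets L = sigma_sets (space (M \<Otimes>\<^sub>M N)) {U. openin ?P U}" "space L = space M \<times> space N"
      unfolding L_def using sub by (simp_all add: space_pair_measure)
    have "fst \<in> measurable L M"
    proof (rule measurable_sigma_sets[OF T(4)])
      show "{U. openin T U} \<subseteq> Pow (space M)" using openin_subset T(1) by blast
      fix U assume "U \<in> {U. openin T U}"
      then have "openin ?P (U \<times> topspace T')" by (simp add: openin_prod_Times_iff)
      moreover have "fst -` U \<inter> space L = U \<times> topspace T'"
        using \<open>U \<in> {U. openin T U}\<close> openin_subset T(1) T'(1) L(2) by fastforce
      ultimately show "fst -` U \<inter> space L \<in> sets L" unfolding L(1) by (simp add: sigma_sets.Basic)
    qed (auto simp: L)
    moreover have "snd \<in> measurable L N"
    proof (rule measurable_sigma_sets[OF T'(4)])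
      show "{U. openin T' U} \<subseteq> Pow (space N)" using openin_subset T'(1) by blast
      fix U assume "U \<in> {U. openin T' U}"
      then have "openin ?P (topspace T \<times> U)" by (simp add: openin_prod_Times_iff)
      moreover have "snd -` U \<inter> space L = topspace T \<times> U"
        using \<open>U \<in> {U. openin T' U}\<close> openin_subset T(1) T'(1) L(2) by fastforce
      ultimately show "snd -` U \<inter> space L \<in> sets L" unfolding L(1) by (simp add: sigma_sets.Basic)
    qed (auto simp: L)
    ultimately have "(\<lambda>p. (fst p, snd p)) \<in> measurable L (M \<Otimes>\<^sub>M N)" by (rule measurable_Pair)
    then have id: "(\<lambda>p. p) \<in> measurable L (M \<Otimes>\<^sub>M N)" by simp
    show "sets (M \<Otimes>\<^sub>M N) \<subseteq> sigma_sets (space (M \<Otimes>\<^sub>M N)) {U. openin ?P U}"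
    proof
      fix A assume A: "A \<in> sets (M \<Otimes>\<^sub>M N)"
      from measurable_sets[OF id A] have "A \<inter> space L \<in> sets L" by (simp add: vimage_def Int_def)
      moreover have "A \<inter> space L = A"
        using sets.sets_into_space[OF A] L(2) by (simp add: space_pair_measure Int_absorb2)
      ultimately show "A \<in> sigma_sets (space (M \<Otimes>\<^sub>M N)) {U. openin ?P U}" unfolding L(1) by simp
    qed
    have "W \<in> sets (M \<Otimes>\<^sub>M N)" if W: "openin ?P W" for W
    proof -
      have "W = \<Union>{r \<in> ?R. r \<subseteq> W}"
      proof
        show "W \<subseteq> \<Union>{r \<in> ?R. r \<subseteq> W}" using base[OF W] by blast
      qed blast
      moreover have "\<Union>{r \<in> ?R. r \<subseteq> W} \<in> sets (M \<Otimes>\<^sub>M N)"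
      proof (rule sets.countable_Union)
        show "countable {r \<in> ?R. r \<subseteq> W}" using R by (rule countable_subset[rotated]) blast
        have "b \<times> b' \<in> sets (M \<Otimes>\<^sub>M N)" if "b \<in> \<B>" "b' \<in> \<B>'" for b b'
          using that \<B>(2) \<B>'(2) T(4) T'(4) by (intro pair_measureI) (simp_all add: sigma_sets.Basic)
        then show "{r \<in> ?R. r \<subseteq> W} \<subseteq> sets (M \<Otimes>\<^sub>M N)" by auto
      qed
      ultimately show ?thesis by simp
    qed
    then show "sigma_sets (space (M \<Otimes>\<^sub>M N)) {U. openin ?P U} \<subseteq> sets (M \<Otimes>\<^sub>M N)"
      by (intro sets.sigma_sets_subset) blast
  qed
  ultimately show ?thesis unfolding standard_borel_space_def by blast
qed

text \<open>The set \<open>P\<close> and its complement in \<open>Y\<close> are unions of fibers of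
  \<open>f\<close>, so a separator of their images cuts out \<open>V\<close> on the image of
  \<open>Y\<close>. The free choice of \<open>\<S>\<close> gives two uses: Borel sets as
  \<open>\<S>\<close> show that an open set is Borel, and the sigma-algebra generated by a topology
  as \<open>\<S>\<close> shows that the topology generates the Borel sets.\<close>

lemma standard_borel_saturated_image:
  assumes M: "standard_borel_space M" and \<S>: "sigma_algebra \<Omega> \<S>"
    and Y: "Y \<in> sets M" "f ` Y \<subseteq> \<Omega>" and \<A>: "countable \<A>" "\<A> \<subseteq> \<S>"
    and f: "\<And>A. A \<in> \<A> \<Longrightarrow> {p \<in> Y. f p \<in> A} \<in> sets M"
    and sep: "\<And>p q. p \<in> Y \<Longrightarrow> q \<in> Y \<Longrightarrow> f p \<noteq> f q \<Longrightarrow> \<exists>A\<in>\<A>. (f p \<in> A) \<noteq> (f q \<in> A)"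
    and V: "{p \<in> Y. f p \<in> V} \<in> sets M"
  obtains B where "B \<in> \<S>" and "B \<inter> f ` Y = V \<inter> f ` Y"
proof -
  obtain T where T: "topspace T = space M" "completely_metrizable_space T" "second_countable T"
    and sets: "sets M = sigma_sets (topspace T) {U. openin T U}"
    using M unfolding standard_borel_space_def by auto
  define P where "P = {p \<in> Y. f p \<in> V}"
  have P: "P \<in> sets M" "f ` P \<subseteq> \<Omega>" unfolding P_def using V Y(2) by auto
  have Q: "Y - P \<in> sets M" "f ` (Y - P) \<subseteq> \<Omega>" using sets.Diff[OF Y(1) P(1)] Y(2) by auto
  show thesis
  proof (rule lusin_separation[OF T(2,3) \<S> P(1)[unfolded sets] P(2) Q(1)[unfolded sets] Q(2) \<A>])
    show "{p \<in> P. f p \<in> A} \<in> sigma_sets (topspace T) {U. openin T U}"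
      "{p \<in> Y - P. f p \<in> A} \<in> sigma_sets (topspace T) {U. openin T U}" if "A \<in> \<A>" for A
    proof -
      have "{p \<in> P. f p \<in> A} = P \<inter> {p \<in> Y. f p \<in> A}" "{p \<in> Y - P. f p \<in> A} = (Y - P) \<inter> {p \<in> Y. f p \<in> A}"
        unfolding P_def by auto
      then show "{p \<in> P. f p \<in> A} \<in> sigma_sets (topspace T) {U. openin T U}"
        "{p \<in> Y - P. f p \<in> A} \<in> sigma_sets (topspace T) {U. openin T U}"
        unfolding sets[symmetric] using sets.Int[OF P(1) f[OF that]] sets.Int[OF Q(1) f[OF that]] by simp_all
    qed
    show "\<exists>A\<in>\<A>. (f p \<in> A) \<noteq> (f q \<in> A)" if "p \<in> P" "q \<in> Y - P" for p q
      by (rule sep) (use that in \<open>auto simp: P_def\<close>)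
    fix B assume B: "B \<in> \<S>" "f ` P \<subseteq> B" "f ` (Y - P) \<inter> B = {}"
    have "B \<inter> f ` Y = V \<inter> f ` Y" using B(2,3) unfolding P_def by blast
    with B(1) show thesis by (rule that)
  qed
qed

section \<open>Groupoids\<close>

context groupoid
begin

abbreviation "\<sigma> \<equiv> src \<G>"
abbreviation "\<tau> \<equiv> tgt \<G>"
abbreviation mul_op (infixl "\<cdot>" 70) where "g \<cdot> h \<equiv> mul \<G> g h"
abbreviation "iv \<equiv> ivs \<G>"
abbreviation "S \<equiv> src_fiber \<G>"

lemma mem_src_fiber [simp]: "g \<in> S x \<longleftrightarrow> g \<in> arr \<G> \<and> \<sigma> g = x"
  unfolding src_fiber_def by simp

lemma mem_composable [simp]: "(g, h) \<in> composable \<G> \<longleftrightarrow> g \<in> arr \<G> \<and> h \<in> arr \<G> \<and> \<sigma> g = \<tau> h"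
  unfolding composable_def by simp

lemma mul_closed [simp]:
  assumes "g \<in> arr \<G>" "h \<in> arr \<G>" "\<sigma> g = \<tau> h"
  shows "g \<cdot> h \<in> arr \<G>" "\<sigma> (g \<cdot> h) = \<sigma> h" "\<tau> (g \<cdot> h) = \<tau> g"
  using assms mul_in src_mul tgt_mul by simp_all

lemma assoc:
  assumes "g \<in> arr \<G>" "h \<in> arr \<G>" "k \<in> arr \<G>" "\<sigma> g = \<tau> h" "\<sigma> h = \<tau> k"
  shows "g \<cdot> h \<cdot> k = g \<cdot> (h \<cdot> k)"
  using assms mul_assoc by simp

declare ivs_in [simp] src_ivs [simp] tgt_ivs [simp] src_in [simp] tgt_in [simp]
  idt_in [simp] src_idt [simp] tgt_idt [simp]

lemma mul_idt [simp]:
  "g \<in> arr \<G> \<Longrightarrow> x = \<tau> g \<Longrightarrow> idt \<G> x \<cdot> g = g" "g \<in> arr \<G> \<Longrightarrow> x = \<sigma> g \<Longrightarrow> g \<cdot> idt \<G> x = g"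
  using mul_idt_left mul_idt_right by simp_all

lemma mul_iv [simp]:
  assumes "g \<in> arr \<G>" "h \<in> arr \<G>"
  shows "\<sigma> g = \<tau> h \<Longrightarrow> iv g \<cdot> (g \<cdot> h) = h" "\<tau> g = \<tau> h \<Longrightarrow> g \<cdot> (iv g \<cdot> h) = h"
    "\<sigma> g = \<tau> h \<Longrightarrow> g \<cdot> h \<cdot> iv h = g" "\<sigma> g = \<sigma> h \<Longrightarrow> g \<cdot> iv h \<cdot> h = g"
  using assms by (simp_all add: assoc[symmetric] mul_ivs_left mul_ivs_right)
    (simp_all add: assoc mul_ivs_left mul_ivs_right)

lemma iv_unique:
  assumes "g \<in> arr \<G>" "h \<in> arr \<G>" "\<sigma> h = \<tau> g" "h \<cdot> g = idt \<G> (\<sigma> g)" shows "iv g = h"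
proof -
  have "h = h \<cdot> g \<cdot> iv g" using assms(1-3) by simp
  also have "\<dots> = idt \<G> (\<sigma> g) \<cdot> iv g" unfolding assms(4) ..
  also have "\<dots> = iv g" using assms(1) by simp
  finally show ?thesis by simp
qed

lemma iv_iv [simp]: "g \<in> arr \<G> \<Longrightarrow> iv (iv g) = g"
  by (rule iv_unique) (simp_all add: mul_ivs_right)

lemma iv_mul [simp]:
  assumes "g \<in> arr \<G>" "h \<in> arr \<G>" "\<sigma> g = \<tau> h" shows "iv (g \<cdot> h) = iv h \<cdot> iv g"
  by (rule iv_unique) (use assms in \<open>simp_all add: assoc mul_ivs_left\<close>)

lemma iv_idt [simp]: "x \<in> obj \<G> \<Longrightarrow> iv (idt \<G> x) = idt \<G> x"
  by (rule iv_unique) simp_all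

lemma mem_component: "y \<in> component \<G> x \<longleftrightarrow> (\<exists>a\<in>arr \<G>. \<sigma> a = x \<and> \<tau> a = y)"
  unfolding component_def by auto

lemma component_refl: "x \<in> obj \<G> \<Longrightarrow> x \<in> component \<G> x"
  unfolding mem_component by (intro bexI[of _ "idt \<G> x"]) simp_all

lemma component_subset: "component \<G> x \<subseteq> obj \<G>"
  unfolding component_def by auto

lemma component_arrow:
  assumes "y \<in> component \<G> x" "z \<in> component \<G> x"
  obtains a where "a \<in> arr \<G>" "\<sigma> a = y" "\<tau> a = z"
proof -
  obtain b c where "b \<in> arr \<G>" "\<sigma> b = x" "\<tau> b = y" "c \<in> arr \<G>" "\<sigma> c = x" "\<tau> c = z"
    using assms unfolding mem_component by blast
  then show thesis by (intro that[of "c \<cdot> iv b"]) simp_all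
qed

lemma component_closed:
  assumes "y \<in> component \<G> x" "a \<in> arr \<G>"
  shows "\<sigma> a = y \<Longrightarrow> \<tau> a \<in> component \<G> x" "\<tau> a = y \<Longrightarrow> \<sigma> a \<in> component \<G> x"
proof -
  obtain b where b: "b \<in> arr \<G>" "\<sigma> b = x" "\<tau> b = y" using assms(1) unfolding mem_component by blast
  show "\<tau> a \<in> component \<G> x" if "\<sigma> a = y"
    unfolding mem_component using that b assms(2) by (intro bexI[of _ "a \<cdot> b"]) simp_all
  show "\<sigma> a \<in> component \<G> x" if "\<tau> a = y"
    unfolding mem_component using that b assms(2) by (intro bexI[of _ "iv a \<cdot> b"]) simp_all
qed

lemma component_eq:
  assumes "y \<in> component \<G> x" shows "component \<G> y = component \<G> x"
proof
  show "component \<G> y \<subseteq> component \<G> x"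
    using component_closed(1)[OF assms] by (auto simp: mem_component[of _ y])
  have "y \<in> obj \<G>" using assms component_subset by blast
  obtain a where a: "a \<in> arr \<G>" "\<sigma> a = x" "\<tau> a = y" using assms unfolding mem_component by blast
  have x: "x \<in> component \<G> y"
    unfolding mem_component using a by (intro bexI[of _ "iv a"]) simp_all
  show "component \<G> x \<subseteq> component \<G> y"
    using component_closed(1)[OF x] by (auto simp: mem_component[of _ x])
qed

end

section \<open>The componentwise topologies\<close>

context borel_overt_componentwise_quasi_polish_groupoid
begin

section \<open>Neighbourhood forms of the continuity hypotheses\<close>

lemma fiber_open_subset: "x \<in> obj \<G> \<Longrightarrow> openin (F x) U \<Longrightarrow> U \<subseteq> S x"
  using openin_subset topspace_fiber by metis

lemma fiber_openI:
  assumes "\<And>g. g \<in> U \<Longrightarrow> \<exists>V. openin (F x) V \<and> g \<in> V \<and> V \<subseteq> U" shows "openin (F x) U"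
  by (subst openin_subopen) (use assms in metis)

lemma openin_fiber: "x \<in> obj \<G> \<Longrightarrow> openin (F x) (S x)"
  using topspace_fiber openin_topspace by metis

lemma right_translate_open:
  assumes "a \<in> arr \<G>" and "openin (F (\<tau> a)) U" shows "openin (F (\<sigma> a)) ((\<lambda>h. h \<cdot> a) ` U)"
  using homeomorphic_imp_open_map[OF right_translation[OF assms(1)]] assms(2) unfolding open_map_def by metis

lemma right_translate_preimage:
  assumes "a \<in> arr \<G>" and "openin (F (\<sigma> a)) U" shows "openin (F (\<tau> a)) {h \<in> S (\<tau> a). h \<cdot> a \<in> U}"
proof -
  have "topspace (F (\<tau> a)) = S (\<tau> a)" using assms(1) by (simp add: topspace_fiber)
  then show ?thesis
    using openin_continuous_map_preimage[OF homeomorphic_imp_continuous_map[OF right_translation[OF assms(1)]] assms(2)]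
    by simp
qed

text \<open>Continuity of multiplication read through inversion, which carries the
  \<open>\<tau>\<close>-fiberwise topology to a source fiber. Both sources are fixed while the
  common target of \<open>k'\<close> and \<open>h'\<close> varies.\<close>

lemma div_nhd:
  assumes k: "k \<in> S y" and h: "h \<in> S x" and kh: "\<tau> k = \<tau> h" and U: "openin (F x) U" "iv k \<cdot> h \<in> U"
  obtains V W where "openin (F y) V" and "k \<in> V" and "openin (F x) W" and "h \<in> W"
    and "\<And>k' h'. k' \<in> V \<Longrightarrow> h' \<in> W \<Longrightarrow> \<tau> k' = \<tau> h' \<Longrightarrow> iv k' \<cdot> h' \<in> U"
proof -
  have xy: "x \<in> obj \<G>" "y \<in> obj \<G>" using k h by auto
  let ?P = "prod_topology (tgt_fiber_topology \<G> F y) (F x)"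
  have "openin (subtopology ?P (composable \<G>))
      {p \<in> topspace (subtopology ?P (composable \<G>)). (\<lambda>(g, h). g \<cdot> h) p \<in> U}"
    using continuous_mul_fiber[OF xy] U(1) by (rule openin_continuous_map_preimage)
  then obtain O' where O': "openin ?P O'"
    "{p \<in> topspace (subtopology ?P (composable \<G>)). (\<lambda>(g, h). g \<cdot> h) p \<in> U} = O' \<inter> composable \<G>"
    unfolding openin_subtopology by metis
  have top: "topspace (tgt_fiber_topology \<G> F y) = tgt_fiber \<G> y"
    unfolding tgt_fiber_topology_def topspace_pullback_topology topspace_fiber[OF xy(2)]
    by (auto simp: tgt_fiber_def)
  have tp: "topspace (subtopology ?P (composable \<G>)) = (tgt_fiber \<G> y \<times> S x) \<inter> composable \<G>"
    by (simp add: top topspace_fiber[OF xy(1)])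
  have "(iv k, h) \<in> O' \<inter> composable \<G>"
    unfolding O'(2)[symmetric] tp using k h kh U(2) by (simp add: tgt_fiber_def)
  then obtain V' W where VW: "openin (tgt_fiber_topology \<G> F y) V'" "openin (F x) W" "iv k \<in> V'" "h \<in> W" "V' \<times> W \<subseteq> O'"
    using O'(1) unfolding openin_prod_topology_alt by (metis IntD1)
  obtain V where V: "openin (F y) V" "V' = iv -` V \<inter> tgt_fiber \<G> y"
    using VW(1) unfolding tgt_fiber_topology_def openin_pullback_topology by metis
  show thesis
  proof (rule that[OF V(1) _ VW(2,4)])
    show "k \<in> V" using VW(3) k unfolding V(2) by simp
    fix k' h' assume a: "k' \<in> V" "h' \<in> W" "\<tau> k' = \<tau> h'"
    have k': "k' \<in> S y" and h': "h' \<in> S x"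
      using a fiber_open_subset[OF xy(2) V(1)] fiber_open_subset[OF xy(1) VW(2)] by auto
    then have "iv k' \<in> V'" using a(1) unfolding V(2) by (simp add: tgt_fiber_def)
    then have "(iv k', h') \<in> O' \<inter> composable \<G>" using VW(5) a(2,3) k' h' by auto
    then show "iv k' \<cdot> h' \<in> U" unfolding O'(2)[symmetric] by simp
  qed
qed

text \<open>\<open>div_nhd\<close> with its first argument fixed at \<open>iv g\<close>. Left
  multiplication by \<open>g\<close> is defined only on arrows with target
  \<open>\<sigma> g\<close>, which need not form an open set; hence the side condition on
  \<open>h'\<close>.\<close>

lemma mul_nhd:
  assumes "g \<in> arr \<G>" and "h \<in> S x" and "\<sigma> g = \<tau> h" and "openin (F x) U" and "g \<cdot> h \<in> U"
  obtains W where "openin (F x) W" and "h \<in> W" and "\<And>h'. h' \<in> W \<Longrightarrow> \<tau> h' = \<sigma> g \<Longrightarrow> g \<cdot> h' \<in> U"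
proof -
  have g: "iv g \<in> S (\<tau> g)" "\<tau> (iv g) = \<tau> h" "iv (iv g) \<cdot> h \<in> U" using assms by simp_all
  show thesis
  proof (rule div_nhd[OF g(1) assms(2) g(2) assms(4) g(3)])
    fix V W
    assume VW: "openin (F x) W" "h \<in> W" "iv g \<in> V"
      "\<And>k' h'. k' \<in> V \<Longrightarrow> h' \<in> W \<Longrightarrow> \<tau> k' = \<tau> h' \<Longrightarrow> iv k' \<cdot> h' \<in> U"
    show thesis
    proof (rule that[OF VW(1,2)])
      fix h' assume "h' \<in> W" "\<tau> h' = \<sigma> g"
      then show "g \<cdot> h' \<in> U" using VW(4)[OF VW(3), of h'] assms(1) by simp
    qed
  qed
qed

text \<open>\<open>div_nhd\<close> with the identity at \<open>x\<close> as its second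
  argument.\<close>

lemma iv_nhd:
  assumes "k \<in> S y" and "\<tau> k = x" and "openin (F x) U" and "iv k \<in> U"
  obtains V where "openin (F y) V" and "k \<in> V" and "\<And>k'. k' \<in> V \<Longrightarrow> \<tau> k' = x \<Longrightarrow> iv k' \<in> U"
proof -
  have x: "x \<in> obj \<G>" "y \<in> obj \<G>" using assms(1,2) by auto
  have h: "idt \<G> x \<in> S x" "\<tau> k = \<tau> (idt \<G> x)" "iv k \<cdot> idt \<G> x \<in> U" using assms x by simp_all
  show thesis
  proof (rule div_nhd[OF assms(1) h(1,2) assms(3) h(3)])
    fix V W
    assume VW: "openin (F y) V" "k \<in> V" "openin (F x) W" "idt \<G> x \<in> W"
      "\<And>k' h'. k' \<in> V \<Longrightarrow> h' \<in> W \<Longrightarrow> \<tau> k' = \<tau> h' \<Longrightarrow> iv k' \<cdot> h' \<in> U"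
    show thesis
    proof (rule that[OF VW(1,2)])
      fix k' assume k': "k' \<in> V" "\<tau> k' = x"
      then have "k' \<in> arr \<G>" using fiber_open_subset[OF x(2) VW(1)] by auto
      then show "iv k' \<in> U" using VW(5)[OF k'(1) VW(4)] k' x by simp
    qed
  qed
qed

lemma fiber_base:
  assumes "x \<in> obj \<G>"
  obtains \<B> where "countable \<B>" and "\<And>b. b \<in> \<B> \<Longrightarrow> openin (F x) b"
    and "\<And>W p. openin (F x) W \<Longrightarrow> p \<in> W \<Longrightarrow> \<exists>b\<in>\<B>. p \<in> b \<and> b \<subseteq> W"
    and "\<And>p q. p \<in> S x \<Longrightarrow> q \<in> S x \<Longrightarrow> p \<noteq> q \<Longrightarrow> \<exists>b\<in>\<B>. (p \<in> b) \<noteq> (q \<in> b)"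
  by (rule quasi_polish_cover_system[OF quasi_polish_fiber[OF assms]], rule that)
    (simp_all add: topspace_fiber[OF assms])

lemma second_countable_fiber: "x \<in> obj \<G> \<Longrightarrow> second_countable (F x)"
  by (rule fiber_base[of x], assumption, unfold second_countable_def)
    (intro exI conjI ballI allI impI, assumption, blast, blast)

section \<open>The quotient topology on a component\<close>

lemma topspace_component_topology [simp]:
  assumes "x \<in> obj \<G>" shows "topspace (component_topology \<G> F x) = component \<G> x"
proof -
  have "openin (component_topology \<G> F x) (component \<G> x)"
    unfolding component_topology_def openin_quotient_topology topspace_fiber[OF assms]
    using openin_fiber[OF assms] by (auto simp: component_def intro: back_subst[of "openin (F x)"])
  moreover have "U \<subseteq> component \<G> x" if "openin (component_topology \<G> F x) U" for U
    using that unfolding component_topology_def openin_quotient_topology topspace_fiber[OF assms] component_def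
    by simp
  ultimately show ?thesis by (meson openin_subset openin_topspace subset_antisym)
qed

lemma openin_component_topology:
  assumes "x \<in> obj \<G>"
  shows "openin (component_topology \<G> F x) U \<longleftrightarrow>
    U \<subseteq> component \<G> x \<and> openin (F x) {g \<in> S x. \<tau> g \<in> U}"
  unfolding component_topology_def openin_quotient_topology topspace_fiber[OF assms] component_def ..

text \<open>If \<open>g\<close> and \<open>h\<close> in \<open>S x\<close> have the same target,
  then \<open>g\<close> is the right translate of \<open>h\<close> by the vertex arrow
  \<open>iv h \<cdot> g\<close>. The saturation of \<open>U\<close> is therefore a union of open
  translates.\<close>

lemma openin_tgt_image:
  assumes x: "x \<in> obj \<G>" and U: "openin (F x) U"
  shows "openin (component_topology \<G> F x) (\<tau> ` U)"
  unfolding openin_component_topology[OF x]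
proof
  have sub: "U \<subseteq> S x" using U by (rule fiber_open_subset[OF x])
  then show "\<tau> ` U \<subseteq> component \<G> x" unfolding component_def by blast
  show "openin (F x) {g \<in> S x. \<tau> g \<in> \<tau> ` U}"
  proof (rule fiber_openI)
    fix g assume "g \<in> {g \<in> S x. \<tau> g \<in> \<tau> ` U}"
    then obtain h where g: "g \<in> arr \<G>" "\<sigma> g = x" and h: "h \<in> U" "\<tau> g = \<tau> h" "h \<in> arr \<G>" "\<sigma> h = x"
      using sub by auto
    define a where "a = iv h \<cdot> g"
    have a: "a \<in> arr \<G>" "\<sigma> a = x" "\<tau> a = x" unfolding a_def using g h by simp_all
    have "openin (F x) ((\<lambda>h. h \<cdot> a) ` U)" using right_translate_open[OF a(1)] U a by simp
    moreover have "h \<cdot> a = g" unfolding a_def using g h by simp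
    moreover have "(\<lambda>h. h \<cdot> a) ` U \<subseteq> {g \<in> S x. \<tau> g \<in> \<tau> ` U}" using sub a by auto
    ultimately show "\<exists>V. openin (F x) V \<and> g \<in> V \<and> V \<subseteq> {g \<in> S x. \<tau> g \<in> \<tau> ` U}"
      using h(1) by (intro exI[of _ "(\<lambda>h. h \<cdot> a) ` U"]) blast
  qed
qed

text \<open>Right translation leaves targets unchanged, so it carries the preimage of
  \<open>U\<close> in one fiber to its preimage in another.\<close>

lemma component_topology_mono:
  assumes "x \<in> obj \<G>" and "y \<in> component \<G> x" and "openin (component_topology \<G> F x) U"
  shows "openin (component_topology \<G> F y) U"
proof -
  have y: "y \<in> obj \<G>" using assms(2) component_subset by blast
  obtain a where a: "a \<in> arr \<G>" "\<sigma> a = x" "\<tau> a = y" using assms(2) unfolding mem_component by blast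
  have U: "U \<subseteq> component \<G> x" "openin (F x) {g \<in> S x. \<tau> g \<in> U}"
    using assms(3) openin_component_topology[OF assms(1)] by auto
  have "openin (F y) {h \<in> S y. h \<cdot> a \<in> {g \<in> S x. \<tau> g \<in> U}}"
    using right_translate_preimage[OF a(1), of "{g \<in> S x. \<tau> g \<in> U}"] U(2) unfolding a by blast
  also have "{h \<in> S y. h \<cdot> a \<in> {g \<in> S x. \<tau> g \<in> U}} = {h \<in> S y. \<tau> h \<in> U}" using a by auto
  finally show ?thesis using U(1) component_eq[OF assms(2)] openin_component_topology[OF y] by simp
qed

lemma component_topology_eq:
  assumes "x \<in> obj \<G>" and "y \<in> component \<G> x"
  shows "component_topology \<G> F y = component_topology \<G> F x"
proof -
  have y: "y \<in> obj \<G>" using assms(2) component_subset by blast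
  have "x \<in> component \<G> y" using component_eq[OF assms(2)] component_refl[OF assms(1)] by simp
  then show ?thesis
    unfolding topology_eq using component_topology_mono[OF assms] component_topology_mono[OF y] by blast
qed

lemma continuous_tgt_fiber: "x \<in> obj \<G> \<Longrightarrow> continuous_map (F x) (component_topology \<G> F x) \<tau>"
  unfolding continuous_map_def
  by (auto simp: topspace_fiber openin_component_topology component_def)

lemma second_countable_component:
  assumes "x \<in> obj \<G>" shows "second_countable (component_topology \<G> F x)"
proof (rule second_countable_open_map_image)
  show "continuous_map (F x) (component_topology \<G> F x) \<tau>" by (rule continuous_tgt_fiber[OF assms])
  show "open_map (F x) (component_topology \<G> F x) \<tau>"
    unfolding open_map_def using openin_tgt_image[OF assms] by blast
  show "\<tau> ` topspace (F x) = topspace (component_topology \<G> F x)"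
    using assms by (simp add: topspace_fiber component_def)
qed (rule second_countable_fiber[OF assms])

section \<open>Fiberwise open sets and Borel sets\<close>

lemma src_fiber_borel: assumes "x \<in> obj \<G>" shows "S x \<in> sets BG"
proof -
  have "{x} \<in> sets BX" using standard_borel_singleton[OF standard_borel_obj] assms space_obj by simp
  then have "\<sigma> -` {x} \<inter> space BG \<in> sets BG" using borel_src by (rule measurable_sets[rotated])
  moreover have "\<sigma> -` {x} \<inter> space BG = S x" unfolding space_arr by auto
  ultimately show ?thesis by simp
qed

lemma fiber_open_borel:
  assumes x: "x \<in> obj \<G>" and V: "openin (F x) V" shows "V \<in> sets BG"
proof -
  obtain \<U> where \<U>: "countable \<U>" "\<U> \<subseteq> sets BG"
    and base: "\<forall>V g. openin (F x) V \<and> g \<in> V \<longrightarrow> (\<exists>U\<in>\<U>. g \<in> U \<inter> S x \<and> U \<inter> S x \<subseteq> V)"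
    using countable_borel_fiberwise_basis x by meson
  have "V = \<Union>((\<lambda>U. U \<inter> S x) ` {U \<in> \<U>. U \<inter> S x \<subseteq> V})"
  proof
    show "V \<subseteq> \<Union>((\<lambda>U. U \<inter> S x) ` {U \<in> \<U>. U \<inter> S x \<subseteq> V})"
    proof
      fix g assume "g \<in> V"
      then obtain U where "U \<in> \<U>" "g \<in> U \<inter> S x" "U \<inter> S x \<subseteq> V" using base V by meson
      then show "g \<in> \<Union>((\<lambda>U. U \<inter> S x) ` {U \<in> \<U>. U \<inter> S x \<subseteq> V})" by blast
    qed
  qed blast
  moreover have "\<Union>((\<lambda>U. U \<inter> S x) ` {U \<in> \<U>. U \<inter> S x \<subseteq> V}) \<in> sets BG"
  proof (rule sets.countable_Union)
    show "countable ((\<lambda>U. U \<inter> S x) ` {U \<in> \<U>. U \<inter> S x \<subseteq> V})"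
      using \<U>(1) by (intro countable_image) (rule countable_subset[rotated], assumption, blast)
    show "(\<lambda>U. U \<inter> S x) ` {U \<in> \<U>. U \<inter> S x \<subseteq> V} \<subseteq> sets BG"
      using \<U>(2) src_fiber_borel[OF x] by (auto intro!: sets.Int)
  qed
  ultimately show ?thesis by simp
qed

lemma sigma_algebra_sigma_opens: "sigma_algebra (topspace T) (sigma_sets (topspace T) {U. openin T U})"
  by (rule sigma_algebra_sigma_sets) (use openin_subset in auto)

text \<open>Lusin separation for the identity map: the countable base consists of Borel sets and
  separates the points of the fiber, so it generates all Borel sets there.\<close>

lemma borel_trace_fiber:
  assumes x: "x \<in> obj \<G>" and A: "A \<in> sets BG"
  shows "A \<inter> S x \<in> sigma_sets (topspace (F x)) {U. openin (F x) U}"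
proof -
  obtain \<B> where \<B>: "countable \<B>" "\<And>b. b \<in> \<B> \<Longrightarrow> openin (F x) b"
    "\<And>p q. p \<in> S x \<Longrightarrow> q \<in> S x \<Longrightarrow> p \<noteq> q \<Longrightarrow> \<exists>b\<in>\<B>. (p \<in> b) \<noteq> (q \<in> b)"
    using fiber_base[OF x] by metis
  have pre: "{p \<in> S x. p \<in> b} \<in> sets BG" if "b \<in> sets BG" for b
    using sets.Int[OF src_fiber_borel[OF x] that] by (simp only: Int_def)
  obtain B where B: "B \<in> sigma_sets (topspace (F x)) {U. openin (F x) U}"
    "B \<inter> (\<lambda>p. p) ` S x = A \<inter> (\<lambda>p. p) ` S x"
  proof (rule standard_borel_saturated_image[OF standard_borel_arr sigma_algebra_sigma_opens src_fiber_borel[OF x]])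
    show "\<B> \<subseteq> sigma_sets (topspace (F x)) {U. openin (F x) U}" using \<B>(2) by (auto intro: sigma_sets.Basic)
    show "{p \<in> S x. p \<in> b} \<in> sets BG" if "b \<in> \<B>" for b
      by (intro pre fiber_open_borel[OF x] \<B>(2) that)
    show "\<exists>b\<in>\<B>. (p \<in> b) \<noteq> (q \<in> b)" if "p \<in> S x" "q \<in> S x" "p \<noteq> q" for p q
      by (rule \<B>(3)[OF that])
  qed (use pre[OF A] \<B>(1) in \<open>auto simp: topspace_fiber[OF x]\<close>)
  moreover have "B \<subseteq> S x"
    using sigma_sets_into_sp[OF _ B(1)] openin_subset topspace_fiber[OF x] by blast
  ultimately show ?thesis by (simp add: Int_absorb2)
qed

lemma tgt_preimage_borel:
  assumes "x \<in> obj \<G>" and "A \<in> sets BX" shows "{g \<in> S x. \<tau> g \<in> A} \<in> sets BG"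
proof -
  have "\<tau> -` A \<inter> space BG \<in> sets BG" using borel_tgt assms(2) by (rule measurable_sets)
  then have "\<tau> -` A \<inter> space BG \<inter> S x \<in> sets BG" using src_fiber_borel[OF assms(1)] by auto
  moreover have "\<tau> -` A \<inter> space BG \<inter> S x = {g \<in> S x. \<tau> g \<in> A}" unfolding space_arr by auto
  ultimately show ?thesis by simp
qed

subsection \<open>The component is \<open>T\<^sub>0\<close>\<close>

lemma open_dense_on_translate:
  assumes a: "a \<in> arr \<G>" "\<sigma> a = y" "\<tau> a = y"
    and K: "K \<subseteq> S y" "\<And>g b. g \<in> K \<Longrightarrow> b \<in> arr \<G> \<Longrightarrow> \<sigma> b = y \<Longrightarrow> \<tau> b = y \<Longrightarrow> g \<cdot> b \<in> K"
    and D: "open_dense_on (F y) K D"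
  shows "open_dense_on (F y) K ((\<lambda>h. h \<cdot> a) ` D)"
  unfolding open_dense_on_def
proof (intro conjI allI impI; (elim conjE)?)
  have y: "y \<in> obj \<G>" using a by auto
  have Dop: "openin (F y) D" using D unfolding open_dense_on_def by blast
  then show "openin (F y) ((\<lambda>h. h \<cdot> a) ` D)" using right_translate_open[OF a(1)] a(2,3) by simp
  fix W assume W: "openin (F y) W" "W \<inter> K \<noteq> {}"
  let ?W = "(\<lambda>h. h \<cdot> iv a) ` W"
  have "openin (F y) ?W" using right_translate_open[of "iv a"] W(1) a by simp
  moreover obtain g where g: "g \<in> W" "g \<in> K" using W(2) by blast
  have "g \<cdot> iv a \<in> ?W \<inter> K" using g K(2)[OF g(2), of "iv a"] a by simp
  ultimately have "?W \<inter> D \<inter> K \<noteq> {}" using D unfolding open_dense_on_def by blast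
  then obtain w where w: "w \<in> W" "w \<cdot> iv a \<in> D" "w \<cdot> iv a \<in> K" by blast
  have wS: "w \<in> arr \<G>" "\<sigma> w = y" using fiber_open_subset[OF y W(1)] w(1) by auto
  have "w = w \<cdot> iv a \<cdot> a" using wS a by simp
  then have "w \<in> (\<lambda>h. h \<cdot> a) ` D" "w \<in> K" using w(2) K(2)[OF w(3) a] by auto
  then show "W \<inter> (\<lambda>h. h \<cdot> a) ` D \<inter> K \<noteq> {}" using w(1) by blast
qed

text \<open>The \<open>\<tau>\<close>-fibers inside \<open>S y\<close> are the orbits of the vertex
  group acting on the right, and \<open>dense\<close> says that every orbit in \<open>K\<close> is
  dense in \<open>K\<close>. If the preimage of \<open>A\<close> were generic on one part of
  \<open>K\<close> and its complement on another, a translate would make these parts overlap. The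
  boolean \<open>c\<close> is the generic truth value of \<open>\<tau> p \<in> A\<close>.\<close>

lemma generic_ergodicity:
  assumes y: "y \<in> obj \<G>" and A: "A \<in> sets BX"
    and K: "K \<subseteq> S y" "\<And>g b. g \<in> K \<Longrightarrow> b \<in> arr \<G> \<Longrightarrow> \<sigma> b = y \<Longrightarrow> \<tau> b = y \<Longrightarrow> g \<cdot> b \<in> K"
    and K2: "pi02_in (F y) K"
    and dense: "\<And>w W. w \<in> \<tau> ` K \<Longrightarrow> openin (F y) W \<Longrightarrow> W \<inter> K \<noteq> {} \<Longrightarrow> \<exists>g\<in>W. \<tau> g = w"
  shows "\<exists>\<D> c. countable \<D> \<and> (\<forall>D\<in>\<D>. open_dense_on (F y) K D) \<and>
    (\<forall>p\<in>K. (\<forall>D\<in>\<D>. p \<in> D) \<longrightarrow> (\<tau> p \<in> A \<longleftrightarrow> c))"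
proof -
  have KT: "K \<subseteq> topspace (F y)" using K(1) topspace_fiber[OF y] by simp
  define P where "P = {g \<in> S y. \<tau> g \<in> A}"
  have P: "P \<in> sets BG" unfolding P_def by (rule tgt_preimage_borel[OF y A])
  have PS: "P \<inter> S y = P" "(S y - P) \<inter> S y = S y - P" unfolding P_def by auto
  have "P \<in> sigma_sets (topspace (F y)) {U. openin (F y) U}"
    using borel_trace_fiber[OF y P] PS by simp
  from baire_property[OF this KT] obtain U \<D> where U: "openin (F y) U" "countable \<D>"
    "\<forall>D\<in>\<D>. open_dense_on (F y) K D" "\<forall>p\<in>K. (\<forall>D\<in>\<D>. p \<in> D) \<longrightarrow> (p \<in> P \<longleftrightarrow> p \<in> U)"
    by (elim exE conjE)
  have "S y - P \<in> sigma_sets (topspace (F y)) {U. openin (F y) U}"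
    using borel_trace_fiber[OF y, of "S y - P"] P src_fiber_borel[OF y] PS by (simp add: sets.Diff)
  from baire_property[OF this KT] obtain U' \<D>' where U': "openin (F y) U'" "countable \<D>'"
    "\<forall>D\<in>\<D>'. open_dense_on (F y) K D" "\<forall>p\<in>K. (\<forall>D\<in>\<D>'. p \<in> D) \<longrightarrow> (p \<in> S y - P \<longleftrightarrow> p \<in> U')"
    by (elim exE conjE)
  have "U \<inter> K = {} \<or> U' \<inter> K = {}"
  proof (rule ccontr)
    assume "\<not> ?thesis"
    then obtain g where g: "g \<in> U" "g \<in> K" and U'K: "U' \<inter> K \<noteq> {}" by blast
    have "\<tau> g \<in> \<tau> ` K" using g(2) by blast
    from dense[OF this U'(1) U'K] obtain g' where g': "g' \<in> U'" "\<tau> g' = \<tau> g" by blast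
    have gg': "g \<in> arr \<G>" "\<sigma> g = y" "g' \<in> arr \<G>" "\<sigma> g' = y"
      using g(2) g'(1) K(1) fiber_open_subset[OF y U'(1)] by auto
    define a where "a = iv g \<cdot> g'"
    have a: "a \<in> arr \<G>" "\<sigma> a = y" "\<tau> a = y" "g \<cdot> a = g'" unfolding a_def using gg' g'(2) by simp_all
    let ?W = "(\<lambda>h. h \<cdot> a) ` U \<inter> U'"
    have W: "openin (F y) ?W" using right_translate_open[OF a(1)] U(1) U'(1) a by auto
    have "g' \<in> ?W \<inter> K" using g(1) g'(1) a(4) K(2)[OF g(2) a(1-3)] by force
    then have WK: "?W \<inter> K \<noteq> {}" by blast
    \<comment> \<open>Translates of the members of \<open>\<D>\<close> are included so that a
      generic \<open>p\<close> in the overlap is still generic for \<open>\<D>\<close> after being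
      carried back by \<open>iv a\<close>.\<close>
    define \<E> where "\<E> = \<D> \<union> \<D>' \<union> (\<lambda>D. (\<lambda>h. h \<cdot> a) ` D) ` \<D>"
    have \<E>: "countable \<E>" unfolding \<E>_def using U(2) U'(2) by simp
    have \<E>d: "\<forall>D\<in>\<E>. open_dense_on (F y) K D"
    proof
      fix D assume D\<E>: "D \<in> \<E>"
      consider "D \<in> \<D>" | "D \<in> \<D>'" | D' where "D' \<in> \<D>" "D = (\<lambda>h. h \<cdot> a) ` D'"
        using D\<E> unfolding \<E>_def by blast
      then show "open_dense_on (F y) K D"
      proof cases
        case 3
        show ?thesis unfolding 3(2) by (rule open_dense_on_translate[OF a(1-3) K U(3)[rule_format, OF 3(1)]])
      qed (use U(3) U'(3) in blast)+
    qed
    obtain p where p: "p \<in> ?W \<inter> K" "\<forall>D\<in>\<E>. p \<in> D"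
      using quasi_polish_baire[OF quasi_polish_fiber[OF y] K2 \<E> \<E>d W WK] by (elim bexE)
    have pK: "p \<in> K" "p \<in> ?W" and pD: "\<forall>D\<in>\<D>. p \<in> (\<lambda>h. h \<cdot> a) ` D" and pD': "\<forall>D\<in>\<D>'. p \<in> D"
      using p unfolding \<E>_def by blast+
    have "p \<notin> P" using U'(4) pK pD' by blast
    obtain h where h: "h \<in> U" "p = h \<cdot> a" using pK(2) by blast
    have hS: "h \<in> arr \<G>" "\<sigma> h = y" using h(1) fiber_open_subset[OF y U(1)] by auto
    have "p \<cdot> iv a = h" using hS a h(2) by simp
    then have hK: "h \<in> K" using K(2)[OF pK(1), of "iv a"] a by simp
    have "h \<in> D" if D: "D \<in> \<D>" for D
    proof -
      have "p \<in> (\<lambda>h. h \<cdot> a) ` D" using pD D by blast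
      then obtain h' where h': "h' \<in> D" "p = h' \<cdot> a" by blast
      have "D \<subseteq> S y" using U(3) D fiber_open_subset[OF y] unfolding open_dense_on_def by blast
      then have "h' \<in> arr \<G>" "\<sigma> h' = y" using h'(1) by auto
      then have "h' = p \<cdot> iv a" using h'(2) a by simp
      then show ?thesis using \<open>p \<cdot> iv a = h\<close> h'(1) by simp
    qed
    then have "h \<in> P" using U(4) hK h(1) by blast
    then have "p \<in> P" unfolding P_def using h(2) hS a by simp
    then show False using \<open>p \<notin> P\<close> by blast
  qed
  then show ?thesis
  proof
    assume "U \<inter> K = {}"
    then have "\<forall>p\<in>K. (\<forall>D\<in>\<D>. p \<in> D) \<longrightarrow> (\<tau> p \<in> A \<longleftrightarrow> False)"
      using U(4) K(1) unfolding P_def by blast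
    then show ?thesis using U(2,3) by (intro exI conjI)
  next
    assume "U' \<inter> K = {}"
    then have "\<forall>p\<in>K. (\<forall>D\<in>\<D>'. p \<in> D) \<longrightarrow> (\<tau> p \<in> A \<longleftrightarrow> True)"
      using U'(4) K(1) unfolding P_def by blast
    then show ?thesis using U'(2,3) by (intro exI conjI)
  qed
qed

lemma component_t0:
  assumes y: "y \<in> obj \<G>" and z: "z \<in> component \<G> y"
    and ind: "\<And>W. openin (component_topology \<G> F y) W \<Longrightarrow> z \<in> W \<longleftrightarrow> y \<in> W"
  shows "z = y"
proof -
  let ?Q = "component_topology \<G> F y"
  define E where "E w \<longleftrightarrow> (\<forall>W. openin ?Q W \<longrightarrow> (w \<in> W \<longleftrightarrow> y \<in> W))" for w
  define K where "K = {g \<in> S y. E (\<tau> g)}"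
  have K: "K \<subseteq> S y" unfolding K_def by blast
  have Kinv: "g \<cdot> b \<in> K" if "g \<in> K" "b \<in> arr \<G>" "\<sigma> b = y" "\<tau> b = y" for g b
    using that unfolding K_def by simp
  have K2: "pi02_in (F y) K"
    using pi02_in_indistinguishable[OF continuous_tgt_fiber[OF y] second_countable_component[OF y], of y]
    unfolding K_def E_def topspace_fiber[OF y] .
  have dense: "\<exists>g\<in>W. \<tau> g = w" if w: "E w" and W: "openin (F y) W" "W \<inter> K \<noteq> {}" for w W
  proof -
    obtain g where g: "g \<in> W" "g \<in> K" using W(2) by blast
    have "openin ?Q (\<tau> ` W)" by (rule openin_tgt_image[OF y W(1)])
    moreover have "\<tau> g \<in> \<tau> ` W" "E (\<tau> g)" using g unfolding K_def by auto
    ultimately have "w \<in> \<tau> ` W" using w unfolding E_def by metis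
    then show ?thesis by auto
  qed
  have denseK: "\<exists>g\<in>W. \<tau> g = w" if "w \<in> \<tau> ` K" "openin (F y) W" "W \<inter> K \<noteq> {}" for w W
    using that dense[of w W] unfolding K_def by auto
  obtain \<A> where \<A>: "countable \<A>" "\<A> \<subseteq> sets BX"
    "\<And>p q. p \<in> space BX \<Longrightarrow> q \<in> space BX \<Longrightarrow> p \<noteq> q \<Longrightarrow> \<exists>A\<in>\<A>. (p \<in> A) \<noteq> (q \<in> A)"
    using standard_borel_separating[OF standard_borel_obj] by metis
  have "\<forall>A\<in>\<A>. \<exists>\<D> c. countable \<D> \<and> (\<forall>D\<in>\<D>. open_dense_on (F y) K D) \<and>
    (\<forall>p\<in>K. (\<forall>D\<in>\<D>. p \<in> D) \<longrightarrow> (\<tau> p \<in> A \<longleftrightarrow> c))"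
    using generic_ergodicity[OF y _ K Kinv K2 denseK] \<A>(2) by blast
  then obtain \<D> where "\<forall>A\<in>\<A>. \<exists>c. countable (\<D> A) \<and> (\<forall>D\<in>\<D> A. open_dense_on (F y) K D) \<and>
    (\<forall>p\<in>K. (\<forall>D\<in>\<D> A. p \<in> D) \<longrightarrow> (\<tau> p \<in> A \<longleftrightarrow> c))" by metis
  then obtain c where \<D>: "\<forall>A\<in>\<A>. countable (\<D> A) \<and> (\<forall>D\<in>\<D> A. open_dense_on (F y) K D) \<and>
    (\<forall>p\<in>K. (\<forall>D\<in>\<D> A. p \<in> D) \<longrightarrow> (\<tau> p \<in> A \<longleftrightarrow> c A))" by metis
  define \<E> where "\<E> = (\<Union>A\<in>\<A>. \<D> A)"
  have \<E>: "countable \<E>" "\<forall>D\<in>\<E>. open_dense_on (F y) K D"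
    unfolding \<E>_def using \<D> \<A>(1) by auto
  \<comment> \<open>The generic truth values for a countable family that separates objects leave
    only one possible target for generic arrows in \<open>K\<close>.\<close>
  have const: "\<tau> p = \<tau> q" if pq: "p \<in> K" "q \<in> K" "\<forall>D\<in>\<E>. p \<in> D" "\<forall>D\<in>\<E>. q \<in> D" for p q
  proof (rule ccontr)
    assume "\<tau> p \<noteq> \<tau> q"
    moreover have "\<tau> p \<in> space BX" "\<tau> q \<in> space BX" using pq(1,2) K space_obj by auto
    ultimately obtain A where A: "A \<in> \<A>" "(\<tau> p \<in> A) \<noteq> (\<tau> q \<in> A)" using \<A>(3) by metis
    have "\<tau> p \<in> A \<longleftrightarrow> c A" "\<tau> q \<in> A \<longleftrightarrow> c A" using \<D> A(1) pq unfolding \<E>_def by auto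
    then show False using A(2) by blast
  qed
  have Ey: "E y" unfolding E_def by blast
  have yK: "idt \<G> y \<in> K" unfolding K_def using y Ey by simp
  have topK: "S y \<inter> K \<noteq> {}" using yK K by blast
  obtain p0 where "p0 \<in> S y \<inter> K" and p0_in: "\<forall>D\<in>\<E>. p0 \<in> D"
    using quasi_polish_baire[OF quasi_polish_fiber[OF y] K2 \<E> openin_fiber[OF y] topK] by (elim bexE)
  then have p0: "p0 \<in> K" "\<forall>D\<in>\<E>. p0 \<in> D" by blast+
  define w0 where "w0 = \<tau> p0"
  have Ew0: "E w0" using p0(1) unfolding w0_def K_def by blast
  have w0C: "w0 \<in> component \<G> y" unfolding w0_def component_def using p0(1) K by blast
  text \<open>Left multiplication by an arrow from \<open>w0\<close> to \<open>v\<close> is a homeomorphism between two dense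
    subsets of \<open>K\<close>, the first of which contains a dense \<open>G\<^sub>\<delta>\<close> subset of \<open>K\<close>; if \<open>v \<noteq> w0\<close> then the second is disjoint from it.\<close>
  have "v = w0" if v: "E v" "v \<in> component \<G> y" for v
  proof -
    obtain k where k: "k \<in> arr \<G>" "\<sigma> k = w0" "\<tau> k = v" using component_arrow[OF w0C v(2)] .
    \<comment> \<open>Left multiplication by \<open>k\<close> is defined only over
      \<open>w0\<close>. \<open>\<phi> D\<close> is the largest open set of the fiber whose arrows
      over \<open>w0\<close> are all taken into \<open>D\<close>.\<close>
    define \<phi> where "\<phi> D = \<Union>{V. openin (F y) V \<and> (\<forall>g\<in>V. \<tau> g = w0 \<longrightarrow> k \<cdot> g \<in> D)}" for D
    have \<phi>: "open_dense_on (F y) K (\<phi> D)" if D: "D \<in> \<E>" for D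
      unfolding open_dense_on_def
    proof (intro conjI allI impI; (elim conjE)?)
      show "openin (F y) (\<phi> D)" unfolding \<phi>_def by (rule openin_Union) blast
      fix W assume W: "openin (F y) W" "W \<inter> K \<noteq> {}"
      have Dop: "openin (F y) D" using \<E>(2)[rule_format, OF D] unfolding open_dense_on_def by blast
      obtain g1 where g1: "g1 \<in> W" "\<tau> g1 = w0" using dense[OF Ew0 W] by blast
      have g1S: "g1 \<in> arr \<G>" "\<sigma> g1 = y" using g1(1) fiber_open_subset[OF y W(1)] by auto
      have h: "k \<cdot> g1 \<in> S y" "k \<cdot> g1 \<in> K" unfolding K_def using g1 g1S k v by simp_all
      have "iv k \<in> arr \<G>" "\<sigma> (iv k) = \<tau> (k \<cdot> g1)" "iv k \<cdot> (k \<cdot> g1) \<in> W" using g1 g1S k by simp_all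
      then obtain W' where W': "openin (F y) W'" "k \<cdot> g1 \<in> W'"
        "\<And>h'. h' \<in> W' \<Longrightarrow> \<tau> h' = \<sigma> (iv k) \<Longrightarrow> iv k \<cdot> h' \<in> W"
        using mul_nhd[OF _ h(1) _ W(1)] by metis
      have "W' \<inter> D \<inter> K \<noteq> {}" using \<E>(2)[rule_format, OF D] W'(1,2) h(2) unfolding open_dense_on_def by blast
      \<comment> \<open>Density is used a second time, to find a point of
        \<open>W' \<inter> D\<close> over \<open>v\<close>: only such a point can be carried back by
        \<open>iv k\<close>.\<close>
      then obtain h2 where h2: "h2 \<in> W' \<inter> D" "\<tau> h2 = v" using dense[OF v(1), of "W' \<inter> D"] W'(1) Dop by blast
      have h2S: "h2 \<in> arr \<G>" "\<sigma> h2 = y" using h2(1) fiber_open_subset[OF y Dop] by auto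
      let ?g = "iv k \<cdot> h2"
      have g: "?g \<in> S y" "\<tau> ?g = w0" "k \<cdot> ?g = h2" using h2 h2S k by simp_all
      have gW: "?g \<in> W" using W'(3)[of h2] h2 k by simp
      have gD: "\<sigma> k = \<tau> ?g" "k \<cdot> ?g \<in> D" using g h2 k by simp_all
      obtain V where V: "openin (F y) V" "?g \<in> V" "\<And>h'. h' \<in> V \<Longrightarrow> \<tau> h' = \<sigma> k \<Longrightarrow> k \<cdot> h' \<in> D"
        using mul_nhd[OF k(1) g(1) gD(1) Dop gD(2)] by metis
      have "\<forall>g\<in>V. \<tau> g = w0 \<longrightarrow> k \<cdot> g \<in> D" by (intro ballI impI V(3)) (simp_all add: k(2))
      then have "?g \<in> \<phi> D" unfolding \<phi>_def using V(1) by (intro UnionI[OF _ V(2)]) simp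
      moreover have "?g \<in> K" unfolding K_def using g(1,2) Ew0 by simp
      ultimately show "W \<inter> \<phi> D \<inter> K \<noteq> {}" using gW by blast
    qed
    have cnt: "countable (\<E> \<union> \<phi> ` \<E>)" using \<E>(1) by simp
    have dns: "\<forall>D\<in>\<E> \<union> \<phi> ` \<E>. open_dense_on (F y) K D" using \<E>(2) \<phi> by auto
    obtain p where "p \<in> S y \<inter> K" and p': "\<forall>D\<in>\<E> \<union> \<phi> ` \<E>. p \<in> D"
      using quasi_polish_baire[OF quasi_polish_fiber[OF y] K2 cnt dns openin_fiber[OF y] topK] by (elim bexE)
    then have p: "p \<in> K" "\<forall>D\<in>\<E>. p \<in> D" "\<forall>D\<in>\<E>. p \<in> \<phi> D" by blast+
    \<comment> \<open>Genericity places \<open>p\<close> over \<open>w0\<close>, so the sets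
      \<open>\<phi> D\<close> apply to it. Then \<open>k \<cdot> p\<close> is generic as well, but
      it lies over \<open>v\<close>.\<close>
    have pw: "\<tau> p = w0" using const[OF p(1) p0(1)] p(2) p0(2) unfolding w0_def by blast
    have pS: "p \<in> arr \<G>" "\<sigma> p = y" using p(1) K by auto
    have "k \<cdot> p \<in> D" if "D \<in> \<E>" for D
    proof -
      have "p \<in> \<phi> D" using p(3) that by blast
      then obtain V where "p \<in> V" "\<forall>g\<in>V. \<tau> g = w0 \<longrightarrow> k \<cdot> g \<in> D" unfolding \<phi>_def by auto
      then show ?thesis using pw by blast
    qed
    moreover have "k \<cdot> p \<in> K" unfolding K_def using pS pw k v(1) by simp
    ultimately have "\<tau> (k \<cdot> p) = w0" using const[OF _ p0(1) _ p0(2)] unfolding w0_def by blast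
    then show "v = w0" using pS pw k by simp
  qed
  note uniq = this
  have "E z" unfolding E_def using ind by blast
  then show ?thesis using uniq[OF _ z] uniq[OF Ey component_refl[OF y]] by simp
qed

lemma component_t0_space:
  assumes x: "x \<in> obj \<G>" and pq: "p \<in> component \<G> x" "q \<in> component \<G> x" "p \<noteq> q"
  shows "\<exists>W. openin (component_topology \<G> F x) W \<and> (p \<in> W) \<noteq> (q \<in> W)"
proof (rule ccontr)
  assume n: "\<not> ?thesis"
  have q: "q \<in> obj \<G>" using pq(2) component_subset by blast
  have "p = q"
  proof (rule component_t0[OF q])
    show "p \<in> component \<G> q" using pq(1) component_eq[OF pq(2)] by simp
    show "p \<in> W \<longleftrightarrow> q \<in> W" if "openin (component_topology \<G> F q) W" for W
      using that n component_topology_eq[OF x pq(2)] by auto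
  qed
  then show False using pq(3) by contradiction
qed

text \<open>The T0 property turns topological indistinguishability from \<open>x\<close> into
  equality with \<open>x\<close>.\<close>

lemma pi02_in_tgt_singleton:
  assumes x: "x \<in> obj \<G>" shows "pi02_in (F x) {g \<in> S x. \<tau> g = x}"
proof -
  have "(\<forall>W. openin (component_topology \<G> F x) W \<longrightarrow> (\<tau> g \<in> W \<longleftrightarrow> x \<in> W)) \<longleftrightarrow> \<tau> g = x" if "g \<in> S x" for g
  proof
    assume a: "\<forall>W. openin (component_topology \<G> F x) W \<longrightarrow> (\<tau> g \<in> W \<longleftrightarrow> x \<in> W)"
    have "\<tau> g \<in> component \<G> x" using that unfolding component_def by blast
    then show "\<tau> g = x" using component_t0[OF x] a by blast
  qed simp
  then have "{g \<in> S x. \<tau> g = x} = {g \<in> topspace (F x).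
      \<forall>W. openin (component_topology \<G> F x) W \<longrightarrow> (\<tau> g \<in> W \<longleftrightarrow> x \<in> W)}"
    unfolding topspace_fiber[OF x] by blast
  then show ?thesis
    using pi02_in_indistinguishable[OF continuous_tgt_fiber[OF x] second_countable_component[OF x], of x] by simp
qed

subsection \<open>Joint continuity\<close>

text \<open>For fixed \<open>g0\<close> the sets \<open>R b\<close>, with \<open>b\<close> a basic
  neighbourhood of \<open>g0\<close>, cover \<open>W \<inter> K\<close> because right translations
  are continuous; by Baire category one of them is dense in a piece of \<open>K\<close>. Fibers need
  not be regular, so the gaps are filled by the group action and not by passing to closures.\<close>

lemma generic_joint_continuity:
  assumes x: "x \<in> obj \<G>" and g0: "g0 \<in> S x" and m: "openin (F x) m"
    and K: "K = {a \<in> S x. \<tau> a = x}"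
    and W: "openin (F x) W" "W \<inter> K \<noteq> {}" "\<forall>a\<in>W \<inter> K. g0 \<cdot> a \<in> m"
  obtains N V where "openin (F x) N" and "N \<subseteq> W" and "N \<inter> K \<noteq> {}" and "openin (F x) V" and "g0 \<in> V"
    and "\<forall>g\<in>V. \<forall>a\<in>N \<inter> K. g \<cdot> a \<in> m"
proof -
  obtain \<B> where \<B>: "countable \<B>" "\<And>b. b \<in> \<B> \<Longrightarrow> openin (F x) b"
    "\<And>W p. openin (F x) W \<Longrightarrow> p \<in> W \<Longrightarrow> \<exists>b\<in>\<B>. p \<in> b \<and> b \<subseteq> W"
    using fiber_base[OF x] by metis
  define \<B>0 where "\<B>0 = {b \<in> \<B>. g0 \<in> b}"
  define R where "R b = {a \<in> K. \<forall>g\<in>b. g \<cdot> a \<in> m}" for b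
  have K2: "pi02_in (F x) K" unfolding K by (rule pi02_in_tgt_singleton[OF x])
  have cover: "\<exists>b\<in>\<B>0. a \<in> R b" if a: "a \<in> W \<inter> K" for a
  proof -
    have a': "a \<in> arr \<G>" "\<sigma> a = x" "\<tau> a = x" using a K by auto
    have "openin (F x) {h \<in> S x. h \<cdot> a \<in> m}" using right_translate_preimage[OF a'(1)] m a' by simp
    moreover have "g0 \<in> {h \<in> S x. h \<cdot> a \<in> m}" using g0 W(3) a by simp
    ultimately obtain b where "b \<in> \<B>" "g0 \<in> b" "b \<subseteq> {h \<in> S x. h \<cdot> a \<in> m}" using \<B>(3) by meson
    then show ?thesis using a unfolding \<B>0_def R_def by (intro bexI[of _ b]) auto
  qed
  have "\<exists>b\<in>\<B>0. \<exists>W3. openin (F x) W3 \<and> W3 \<subseteq> W \<and> W3 \<inter> K \<noteq> {} \<and>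
      (\<forall>W4. openin (F x) W4 \<and> W4 \<subseteq> W3 \<and> W4 \<inter> K \<noteq> {} \<longrightarrow> W4 \<inter> R b \<noteq> {})"
  proof (rule ccontr)
    assume n: "\<not> ?thesis"
    \<comment> \<open>The region that \<open>R b\<close> does not approach inside \<open>W\<close>.
      If no \<open>R b\<close> were dense in a piece of \<open>W\<close>, all these regions would be
      dense on \<open>K\<close>, and a generic point of \<open>W \<inter> K\<close> would escape the
      cover.\<close>
    define D where "D b = \<Union>{W4. openin (F x) W4 \<and> W4 \<inter> W \<inter> R b = {}}" for b
    have D: "\<forall>U\<in>D ` \<B>0. open_dense_on (F x) K U"
    proof
      fix U assume "U \<in> D ` \<B>0"
      then obtain b where b: "b \<in> \<B>0" "U = D b" by blast
      show "open_dense_on (F x) K U"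
        unfolding open_dense_on_def b(2)
      proof (intro conjI allI impI; (elim conjE)?)
        show "openin (F x) (D b)" unfolding D_def by (rule openin_Union) blast
        fix W' assume W': "openin (F x) W'" "W' \<inter> K \<noteq> {}"
        show "W' \<inter> D b \<inter> K \<noteq> {}"
        proof (cases "W' \<inter> W \<inter> K = {}")
          case True
          then have "W' \<inter> W \<inter> R b = {}" unfolding R_def by blast
          then have "W' \<subseteq> D b" unfolding D_def using W'(1) by blast
          then show ?thesis using W'(2) by blast
        next
          case False
          have "openin (F x) (W' \<inter> W)" using W'(1) W(1) by (rule openin_Int)
          then have "\<exists>W4. openin (F x) W4 \<and> W4 \<subseteq> W' \<inter> W \<and> W4 \<inter> K \<noteq> {} \<and> W4 \<inter> R b = {}"
            using n b(1) False by (meson Int_lower2)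
          then obtain W4 where W4: "openin (F x) W4" "W4 \<subseteq> W' \<inter> W" "W4 \<inter> K \<noteq> {}" "W4 \<inter> R b = {}" by blast
          then have "W4 \<inter> W \<inter> R b = {}" by blast
          then have "W4 \<subseteq> D b" unfolding D_def using W4(1) by blast
          then show ?thesis using W4(2,3) by blast
        qed
      qed
    qed
    have cnt: "countable (D ` \<B>0)" unfolding \<B>0_def using \<B>(1) by simp
    obtain p where p: "p \<in> W \<inter> K" "\<forall>U\<in>D ` \<B>0. p \<in> U"
      using quasi_polish_baire[OF quasi_polish_fiber[OF x] K2 cnt D W(1,2)] by (elim bexE)
    obtain b where b: "b \<in> \<B>0" "p \<in> R b" using cover[OF p(1)] by (elim bexE)
    then have "p \<in> D b" using p(2) by blast
    then show False unfolding D_def using b(2) p(1) by blast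
  qed
  then obtain b W3 where b: "b \<in> \<B>0" and W3: "openin (F x) W3" "W3 \<subseteq> W" "W3 \<inter> K \<noteq> {}"
    and dense: "\<forall>W4. openin (F x) W4 \<and> W4 \<subseteq> W3 \<and> W4 \<inter> K \<noteq> {} \<longrightarrow> W4 \<inter> R b \<noteq> {}" by (elim bexE exE conjE)
  have bop: "openin (F x) b" "g0 \<in> b" using b \<B>(2) unfolding \<B>0_def by auto
  have "v \<cdot> a \<in> m" if va: "v \<in> b" "a \<in> W3 \<inter> K" for v a
  proof -
    have v: "v \<in> arr \<G>" "\<sigma> v = x" using va(1) fiber_open_subset[OF x bop(1)] by auto
    have a: "a \<in> arr \<G>" "\<sigma> a = x" "\<tau> a = x" using va(2) K by auto
    text \<open>By density \<open>v a\<close> can be rewritten as \<open>v' s\<close> with \<open>v' \<in> b\<close> and \<open>s \<in> R b\<close>.\<close>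
    have va': "v \<cdot> a \<in> arr \<G>" "iv a \<in> S x" "\<sigma> (v \<cdot> a) = \<tau> (iv a)" "v \<cdot> a \<cdot> iv a \<in> b" using v a va(1) by simp_all
    obtain W5 where W5: "openin (F x) W5" "iv a \<in> W5" "\<And>h'. h' \<in> W5 \<Longrightarrow> \<tau> h' = \<sigma> (v \<cdot> a) \<Longrightarrow> v \<cdot> a \<cdot> h' \<in> b"
      using mul_nhd[OF va'(1-3) bop(1) va'(4)] by metis
    have aS: "a \<in> S x" using a by simp
    obtain V where V: "openin (F x) V" "a \<in> V" "\<And>k'. k' \<in> V \<Longrightarrow> \<tau> k' = x \<Longrightarrow> iv k' \<in> W5"
      using iv_nhd[OF aS a(3) W5(1,2)] by metis
    have "openin (F x) (V \<inter> W3)" using V(1) W3(1) by (rule openin_Int)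
    moreover have "V \<inter> W3 \<inter> K \<noteq> {}" using V(2) va(2) by blast
    ultimately have "V \<inter> W3 \<inter> R b \<noteq> {}" using dense by blast
    then obtain s where s: "s \<in> V" "s \<in> R b" by blast
    have sK: "s \<in> arr \<G>" "\<sigma> s = x" "\<tau> s = x" using s(2) K unfolding R_def by auto
    have "v \<cdot> a \<cdot> iv s \<in> b" using W5(3)[OF V(3)[OF s(1) sK(3)]] sK v a by simp
    then have "v \<cdot> a \<cdot> iv s \<cdot> s \<in> m" using s(2) unfolding R_def by blast
    then show ?thesis using v a sK by simp
  qed
  then show thesis using that[OF W3 bop] by blast
qed

text \<open>Joint continuity holds at \<open>g0\<close> and a generic \<open>a1\<close>. By
  associativity, right translation by \<open>iv a1 \<cdot> a0\<close> moves it from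
  \<open>a1\<close> to the given \<open>a0\<close>.\<close>

lemma right_action_joint_continuity:
  assumes x: "x \<in> obj \<G>" and g0: "g0 \<in> S x" and a0: "a0 \<in> S x" "\<tau> a0 = x"
    and U: "openin (F x) U" "g0 \<cdot> a0 \<in> U"
  obtains V N where "openin (F x) V" and "g0 \<in> V" and "openin (F x) N" and "a0 \<in> N"
    and "\<And>g a. g \<in> V \<Longrightarrow> a \<in> N \<Longrightarrow> \<tau> a = x \<Longrightarrow> g \<cdot> a \<in> U"
proof -
  define K where "K = {a \<in> S x. \<tau> a = x}"
  obtain \<B> where \<B>: "countable \<B>" "\<And>b. b \<in> \<B> \<Longrightarrow> openin (F x) b"
    "\<And>W p. openin (F x) W \<Longrightarrow> p \<in> W \<Longrightarrow> \<exists>b\<in>\<B>. p \<in> b \<and> b \<subseteq> W"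
    using fiber_base[OF x] by metis
  define joint where "joint m N \<longleftrightarrow> (\<exists>V. openin (F x) V \<and> g0 \<in> V \<and> (\<forall>g\<in>V. \<forall>a\<in>N \<inter> K. g \<cdot> a \<in> m))" for m N
  \<comment> \<open>A point of \<open>D m\<close> has a neighbourhood that is either jointly taken
    into \<open>m\<close> or entirely kept out of \<open>m\<close> by \<open>g0\<close>. The second
    alternative fails at any \<open>a1 \<in> K\<close> with
    \<open>g0 \<cdot> a1 \<in> m\<close>.\<close>
  define D where "D m = \<Union>{N. openin (F x) N \<and> (joint m N \<or> (\<forall>a\<in>N \<inter> K. g0 \<cdot> a \<notin> m))}" for m
  have K2: "pi02_in (F x) K" unfolding K_def by (rule pi02_in_tgt_singleton[OF x])
  have D: "\<forall>U\<in>D ` \<B>. open_dense_on (F x) K U"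
  proof
    fix U assume "U \<in> D ` \<B>"
    then obtain m where m: "m \<in> \<B>" "U = D m" by blast
    show "open_dense_on (F x) K U"
      unfolding open_dense_on_def m(2)
    proof (intro conjI allI impI; (elim conjE)?)
      show "openin (F x) (D m)" unfolding D_def by (rule openin_Union) blast
      fix W assume W: "openin (F x) W" "W \<inter> K \<noteq> {}"
      show "W \<inter> D m \<inter> K \<noteq> {}"
      proof (cases "\<forall>a\<in>W \<inter> K. g0 \<cdot> a \<notin> m")
        case True
        then have "W \<subseteq> D m" unfolding D_def using W(1) by blast
        then show ?thesis using W(2) by blast
      next
        case False
        then obtain a where a: "a \<in> W" "a \<in> K" "g0 \<cdot> a \<in> m" by blast
        have aS: "a \<in> S x" "\<sigma> g0 = \<tau> a" "g0 \<in> arr \<G>" using a(2) g0 unfolding K_def by auto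
        obtain W2 where W2: "openin (F x) W2" "a \<in> W2" "\<And>h'. h' \<in> W2 \<Longrightarrow> \<tau> h' = \<sigma> g0 \<Longrightarrow> g0 \<cdot> h' \<in> m"
          using mul_nhd[OF aS(3,1,2) \<B>(2)[OF m(1)] a(3)] by metis
        have "openin (F x) (W \<inter> W2)" using W(1) W2(1) by (rule openin_Int)
        moreover have "W \<inter> W2 \<inter> K \<noteq> {}" using a W2(2) by blast
        moreover have "\<forall>a\<in>W \<inter> W2 \<inter> K. g0 \<cdot> a \<in> m" using W2(3) g0 unfolding K_def by simp
        ultimately obtain N V where N: "openin (F x) N" "N \<subseteq> W \<inter> W2" "N \<inter> K \<noteq> {}"
          and V: "openin (F x) V" "g0 \<in> V" "\<forall>g\<in>V. \<forall>a\<in>N \<inter> K. g \<cdot> a \<in> m"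
          using generic_joint_continuity[OF x g0 \<B>(2)[OF m(1)] K_def] by metis
        have "joint m N" unfolding joint_def using V by blast
        then have "N \<subseteq> D m" unfolding D_def using N(1) by blast
        then show ?thesis using N(2,3) by blast
      qed
    qed
  qed
  have cnt: "countable (D ` \<B>)" using \<B>(1) by simp
  have "idt \<G> x \<in> S x \<inter> K" unfolding K_def using x by simp
  then have ne: "S x \<inter> K \<noteq> {}" by blast
  obtain a1 where a1: "a1 \<in> S x \<inter> K" "\<forall>U\<in>D ` \<B>. a1 \<in> U"
    using quasi_polish_baire[OF quasi_polish_fiber[OF x] K2 cnt D openin_fiber[OF x] ne] by (elim bexE)
  have a1': "a1 \<in> arr \<G>" "\<sigma> a1 = x" "\<tau> a1 = x" using a1(1) unfolding K_def by auto
  have a0': "a0 \<in> arr \<G>" "\<sigma> a0 = x" "\<tau> a0 = x" using a0 by auto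
  have g0': "g0 \<in> arr \<G>" "\<sigma> g0 = x" using g0 by auto
  define c where "c = iv a1 \<cdot> a0"
  have c: "c \<in> arr \<G>" "\<sigma> c = x" "\<tau> c = x" unfolding c_def using a0' a1' by simp_all
  have a1c: "a1 \<cdot> c = a0" unfolding c_def using a0' a1' by simp
  have "openin (F x) {h \<in> S x. h \<cdot> c \<in> U}" using right_translate_preimage[OF c(1)] U(1) c by simp
  moreover have "g0 \<cdot> a1 \<cdot> c = g0 \<cdot> a0" using g0' a1' c a1c by (simp add: assoc)
  then have "g0 \<cdot> a1 \<in> {h \<in> S x. h \<cdot> c \<in> U}" using U(2) g0' a1' by simp
  ultimately obtain m where m: "m \<in> \<B>" "g0 \<cdot> a1 \<in> m" "m \<subseteq> {h \<in> S x. h \<cdot> c \<in> U}" using \<B>(3) by meson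
  have "a1 \<in> D m" using a1(2) m(1) by blast
  then obtain N where N: "openin (F x) N" "a1 \<in> N" "joint m N \<or> (\<forall>a\<in>N \<inter> K. g0 \<cdot> a \<notin> m)"
    unfolding D_def by blast
  have "joint m N" using N(2,3) a1(1) m(2) by blast
  then obtain V where V: "openin (F x) V" "g0 \<in> V" "\<forall>g\<in>V. \<forall>a\<in>N \<inter> K. g \<cdot> a \<in> m"
    unfolding joint_def by blast
  let ?N = "(\<lambda>h. h \<cdot> c) ` N"
  show thesis
  proof (rule that[OF V(1,2)])
    show "openin (F x) ?N" using right_translate_open[OF c(1)] N(1) c by simp
    show "a0 \<in> ?N" using N(2) a1c by force
    fix g a assume ga: "g \<in> V" "a \<in> ?N" "\<tau> a = x"
    then obtain h where h: "h \<in> N" "a = h \<cdot> c" by blast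
    have hS: "h \<in> arr \<G>" "\<sigma> h = x" using h(1) fiber_open_subset[OF x N(1)] by auto
    have gS: "g \<in> arr \<G>" "\<sigma> g = x" using ga(1) fiber_open_subset[OF x V(1)] by auto
    have ht: "\<tau> h = x" using ga(3) h(2) hS c by simp
    have "g \<cdot> h \<in> m" using V(3) ga(1) h(1) hS ht unfolding K_def by simp
    then have "g \<cdot> h \<cdot> c \<in> U" using m(3) by blast
    then show "g \<cdot> a \<in> U" using h(2) hS gS ht c by (simp add: assoc)
  qed
qed

text \<open>The product of \<open>g \<cdot> iv k\<close> and \<open>h \<cdot> iv l\<close> is
  \<open>g \<cdot> (iv k \<cdot> h) \<cdot> iv l\<close>; this is the continuity of its
  numerator.\<close>

lemma triple_product_nhd:
  assumes x: "x \<in> obj \<G>" and g: "g \<in> S x" "k \<in> S x" "h \<in> S x" "\<tau> k = \<tau> h"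
    and U: "openin (F x) U" "g \<cdot> (iv k \<cdot> h) \<in> U"
  obtains V1 V2 V3 where "openin (F x) V1" and "g \<in> V1" and "openin (F x) V2" and "k \<in> V2"
    and "openin (F x) V3" and "h \<in> V3"
    and "\<And>g' k' h'. g' \<in> V1 \<Longrightarrow> k' \<in> V2 \<Longrightarrow> h' \<in> V3 \<Longrightarrow> \<tau> k' = \<tau> h' \<Longrightarrow> g' \<cdot> (iv k' \<cdot> h') \<in> U"
proof -
  have a: "iv k \<cdot> h \<in> S x" "\<tau> (iv k \<cdot> h) = x" using g by simp_all
  obtain V N where VN: "openin (F x) V" "g \<in> V" "openin (F x) N" "iv k \<cdot> h \<in> N"
    and *: "\<And>g a. g \<in> V \<Longrightarrow> a \<in> N \<Longrightarrow> \<tau> a = x \<Longrightarrow> g \<cdot> a \<in> U"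
    using right_action_joint_continuity[OF x g(1) a U] by metis
  obtain V2 V3 where V: "openin (F x) V2" "k \<in> V2" "openin (F x) V3" "h \<in> V3"
    and **: "\<And>k' h'. k' \<in> V2 \<Longrightarrow> h' \<in> V3 \<Longrightarrow> \<tau> k' = \<tau> h' \<Longrightarrow> iv k' \<cdot> h' \<in> N"
    using div_nhd[OF g(2,3,4) VN(3,4)] by metis
  show thesis
  proof (rule that[OF VN(1,2) V])
    fix g' k' h' assume a: "g' \<in> V" "k' \<in> V2" "h' \<in> V3" "\<tau> k' = \<tau> h'"
    have "k' \<in> S x" "h' \<in> S x"
      using a fiber_open_subset[OF x V(1)] fiber_open_subset[OF x V(3)] by auto
    then show "g' \<cdot> (iv k' \<cdot> h') \<in> U" using *[OF a(1) **[OF a(2-4)]] a(4) by simp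
  qed
qed

section \<open>The topology on arrows described by pairs from one fiber\<close>

text \<open>Fiberwise open sets can be prescribed independently on each fiber, so the rectangle
  condition concerns one middle object at a time. Right translation by an arrow out of
  \<open>x\<close> moves that object to \<open>x\<close>.\<close>

lemma openin_component_arr_topology:
  assumes x: "x \<in> obj \<G>"
  shows "openin (component_arr_topology \<G> F (component \<G> x)) U \<longleftrightarrow>
    U \<subseteq> {g \<in> arr \<G>. \<sigma> g \<in> component \<G> x} \<and>
    (\<forall>g\<in>S x. \<forall>k\<in>S x. g \<cdot> iv k \<in> U \<longrightarrow> (\<exists>V W. openin (F x) V \<and> g \<in> V \<and> openin (F x) W \<and> k \<in> W \<and>
       (\<forall>g'\<in>V. \<forall>k'\<in>W. g' \<cdot> iv k' \<in> U)))"
    (is "?L \<longleftrightarrow> U \<subseteq> ?A \<and> ?R")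
proof
  assume ?L
  then obtain U' where U': "openin (arr_topology \<G> F) U'" "U = U' \<inter> ?A"
    unfolding component_arr_topology_def restrict_groupoid_def openin_subtopology by auto
  have ?R
  proof (intro ballI impI)
    fix g k assume gk: "g \<in> S x" "k \<in> S x" "g \<cdot> iv k \<in> U"
    have rect: "(arbitrary union_of fiberwise_rectangle \<G> F) {(g, h) \<in> composable \<G>. g \<cdot> h \<in> U'}"
      using U'(1) unfolding openin_arr_topology by blast
    have "(g, iv k) \<in> {(g, h) \<in> composable \<G>. g \<cdot> h \<in> U'}" using gk U'(2) by simp
    then obtain Z where Z: "fiberwise_rectangle \<G> F Z" "(g, iv k) \<in> Z" "Z \<subseteq> {(g, h) \<in> composable \<G>. g \<cdot> h \<in> U'}"
      using rect[unfolded arbitrary_union_of_alt] by (meson bspec)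
    obtain V W where VW: "src_fiberwise_open \<G> F V" "tgt_fiberwise_open \<G> F W" "Z = (V \<times> W) \<inter> composable \<G>"
      using Z(1) unfolding fiberwise_rectangle_def by blast
    have V: "openin (F x) (V \<inter> S x)" using VW(1) x unfolding src_fiberwise_open_def by blast
    have "openin (tgt_fiber_topology \<G> F x) (W \<inter> tgt_fiber \<G> x)"
      using VW(2) x unfolding tgt_fiberwise_open_def by blast
    then obtain W0 where W0: "openin (F x) W0" "W \<inter> tgt_fiber \<G> x = iv -` W0 \<inter> tgt_fiber \<G> x"
      unfolding tgt_fiber_topology_def openin_pullback_topology by blast
    have "iv k \<in> W \<inter> tgt_fiber \<G> x" using Z(2) gk(2) unfolding VW(3) by (simp add: tgt_fiber_def)
    then have k: "k \<in> W0" unfolding W0(2) using gk(2) by simp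
    have "g' \<cdot> iv k' \<in> U" if "g' \<in> V \<inter> S x" "k' \<in> W0" for g' k'
    proof -
      have k': "k' \<in> arr \<G>" "\<sigma> k' = x" using that(2) fiber_open_subset[OF x W0(1)] by auto
      then have "iv k' \<in> iv -` W0 \<inter> tgt_fiber \<G> x" using that(2) by (simp add: tgt_fiber_def)
      then have "iv k' \<in> W" unfolding W0(2)[symmetric] by blast
      then have "(g', iv k') \<in> Z" unfolding VW(3) using that(1) k' by simp
      then have "g' \<cdot> iv k' \<in> U'" using Z(3) by blast
      moreover have "\<tau> k' \<in> component \<G> x" unfolding mem_component using k' by blast
      ultimately show ?thesis unfolding U'(2) using that(1) k' by simp
    qed
    moreover have "g \<in> V \<inter> S x" using Z(2) gk(1) unfolding VW(3) by simp
    ultimately show "\<exists>V W. openin (F x) V \<and> g \<in> V \<and> openin (F x) W \<and> k \<in> W \<and>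
       (\<forall>g'\<in>V. \<forall>k'\<in>W. g' \<cdot> iv k' \<in> U)" using V W0(1) k by blast
  qed
  then show "U \<subseteq> ?A \<and> ?R" using U'(2) by blast
next
  assume UR: "U \<subseteq> ?A \<and> ?R"
  have "(arbitrary union_of fiberwise_rectangle \<G> F) {(g, h) \<in> composable \<G>. g \<cdot> h \<in> U}"
    unfolding arbitrary_union_of_alt
  proof (rule ballI, clarify)
    fix g h assume gh: "(g, h) \<in> composable \<G>" "g \<cdot> h \<in> U"
    then have gh': "g \<in> arr \<G>" "h \<in> arr \<G>" "\<sigma> g = \<tau> h" by simp_all
    define z where "z = \<tau> h"
    have z: "z \<in> obj \<G>" unfolding z_def using gh' by simp
    have "\<sigma> h \<in> component \<G> x" using UR gh(2) gh' by auto
    then have "z \<in> component \<G> x" using component_closed(1)[OF _ gh'(2)] unfolding z_def by blast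
    then obtain a where a: "a \<in> arr \<G>" "\<sigma> a = x" "\<tau> a = z" unfolding mem_component by blast
    have ga: "g \<cdot> a \<in> S x" "iv h \<cdot> a \<in> S x" using gh' a z_def by simp_all
    have "g \<cdot> a \<cdot> iv (iv h \<cdot> a) = g \<cdot> h" using gh' a z_def by (simp add: assoc[symmetric])
    then have "g \<cdot> a \<cdot> iv (iv h \<cdot> a) \<in> U" using gh(2) by simp
    then obtain V W where VW: "openin (F x) V" "g \<cdot> a \<in> V" "openin (F x) W" "iv h \<cdot> a \<in> W"
      "\<forall>g'\<in>V. \<forall>k'\<in>W. g' \<cdot> iv k' \<in> U" using UR ga by blast
    \<comment> \<open>The rectangle is supported over the single middle object \<open>z\<close>; on
      all other fibers its sides are empty and hence open.\<close>
    define V' where "V' = {g' \<in> S z. g' \<cdot> a \<in> V}"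
    define W0 where "W0 = {k' \<in> S z. k' \<cdot> a \<in> W}"
    define W' where "W' = iv -` W0 \<inter> tgt_fiber \<G> z"
    have V': "openin (F z) V'" unfolding V'_def using right_translate_preimage[OF a(1), of V] VW(1) unfolding a by blast
    have W0: "openin (F z) W0" unfolding W0_def using right_translate_preimage[OF a(1), of W] VW(3) unfolding a by blast
    have "src_fiberwise_open \<G> F V'"
      unfolding src_fiberwise_open_def
    proof (intro conjI ballI)
      fix w assume "w \<in> obj \<G>"
      show "openin (F w) (V' \<inter> S w)"
      proof (cases "w = z")
        case True
        moreover have "V' \<inter> S z = V'" unfolding V'_def by blast
        ultimately show ?thesis using V' by simp
      next
        case False
        then have "V' \<inter> S w = {}" unfolding V'_def by auto
        then show ?thesis by simp
      qed
    qed (auto simp: V'_def)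
    moreover have "tgt_fiberwise_open \<G> F W'"
      unfolding tgt_fiberwise_open_def
    proof (intro conjI ballI)
      fix w assume "w \<in> obj \<G>"
      show "openin (tgt_fiber_topology \<G> F w) (W' \<inter> tgt_fiber \<G> w)"
      proof (cases "w = z")
        case True
        moreover have "W' \<inter> tgt_fiber \<G> z = iv -` W0 \<inter> tgt_fiber \<G> z" unfolding W'_def by blast
        ultimately show ?thesis unfolding tgt_fiber_topology_def openin_pullback_topology using W0 by blast
      next
        case False
        then have "W' \<inter> tgt_fiber \<G> w = {}" unfolding W'_def tgt_fiber_def by auto
        then show ?thesis by simp
      qed
    qed (auto simp: W'_def tgt_fiber_def)
    ultimately have "fiberwise_rectangle \<G> F ((V' \<times> W') \<inter> composable \<G>)"
      unfolding fiberwise_rectangle_def by blast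
    moreover have "(g, h) \<in> (V' \<times> W') \<inter> composable \<G>"
      using gh gh' VW(2,4) unfolding V'_def W'_def W0_def tgt_fiber_def z_def by simp
    moreover have "(V' \<times> W') \<inter> composable \<G> \<subseteq> {(g, h) \<in> composable \<G>. g \<cdot> h \<in> U}"
    proof clarify
      fix g1 h1 assume 1: "(g1, h1) \<in> composable \<G>" "g1 \<in> V'" "h1 \<in> W'"
      have g1: "g1 \<in> arr \<G>" "\<sigma> g1 = z" "g1 \<cdot> a \<in> V" using 1(2) unfolding V'_def by auto
      have h1: "h1 \<in> arr \<G>" "\<tau> h1 = z" "iv h1 \<cdot> a \<in> W" using 1(3) unfolding W'_def W0_def tgt_fiber_def by auto
      have "g1 \<cdot> a \<cdot> iv (iv h1 \<cdot> a) = g1 \<cdot> h1" using g1 h1 a by (simp add: assoc[symmetric])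
      then show "g1 \<cdot> h1 \<in> U" using VW(5) g1(3) h1(3) by metis
    qed
    ultimately show "\<exists>Ua. fiberwise_rectangle \<G> F Ua \<and> (g, h) \<in> Ua \<and> Ua \<subseteq> {(g, h) \<in> composable \<G>. g \<cdot> h \<in> U}"
      by blast
  qed
  then have "openin (arr_topology \<G> F) U" unfolding openin_arr_topology using UR by blast
  moreover have "U = U \<inter> ?A" using UR by blast
  ultimately show ?L
    unfolding component_arr_topology_def restrict_groupoid_def openin_subtopology by auto
qed

subsection \<open>The open topological groupoid of a component\<close>

abbreviation "TC x \<equiv> component_topology \<G> F x"
abbreviation "TG x \<equiv> component_arr_topology \<G> F (component \<G> x)"
abbreviation "arr_over C \<equiv> {g \<in> arr \<G>. \<sigma> g \<in> C}"

text \<open>Images of boxes under division. For open sides they form a base of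
  \<open>TG x\<close>.\<close>

definition quotients :: "'g set \<Rightarrow> 'g set \<Rightarrow> 'g set" where
  "quotients V W = {g \<cdot> iv k | g k. g \<in> V \<and> k \<in> W}"

lemma quotientsI: "g \<in> V \<Longrightarrow> k \<in> W \<Longrightarrow> g \<cdot> iv k \<in> quotients V W"
  unfolding quotients_def by blast

lemma quotient_arrow:
  assumes "g \<in> S x" "k \<in> S x"
  shows "g \<cdot> iv k \<in> arr_over (component \<G> x)" "\<sigma> (g \<cdot> iv k) = \<tau> k" "\<tau> (g \<cdot> iv k) = \<tau> g"
    "iv (g \<cdot> iv k) = k \<cdot> iv g" "g \<cdot> iv k \<cdot> k = g"
proof -
  have "\<tau> k \<in> component \<G> x" using assms(2) unfolding component_def by blast
  then show "g \<cdot> iv k \<in> arr_over (component \<G> x)" using assms by simp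
qed (use assms in simp_all)

lemma arrow_as_quotient:
  assumes "u \<in> arr \<G>" "k \<in> S x" "\<tau> k = \<sigma> u"
  shows "u \<cdot> k \<in> S x" "u \<cdot> k \<cdot> iv k = u"
  using assms by simp_all

lemma arr_over_quotient:
  assumes "u \<in> arr_over (component \<G> x)"
  obtains g k where "g \<in> S x" "k \<in> S x" "u = g \<cdot> iv k"
proof -
  obtain k where "k \<in> S x" "\<tau> k = \<sigma> u" using assms unfolding component_def by auto
  then show thesis using arrow_as_quotient[of u k x] assms by (intro that[of "u \<cdot> k" k]) simp_all
qed

lemma openin_TG:
  assumes "x \<in> obj \<G>" and "openin (TG x) U" and "g \<in> S x" "k \<in> S x" "g \<cdot> iv k \<in> U"
  obtains V W where "openin (F x) V" "g \<in> V" "openin (F x) W" "k \<in> W"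
    "\<And>g' k'. g' \<in> V \<Longrightarrow> k' \<in> W \<Longrightarrow> g' \<cdot> iv k' \<in> U"
proof -
  have "\<exists>V W. openin (F x) V \<and> g \<in> V \<and> openin (F x) W \<and> k \<in> W \<and> (\<forall>g'\<in>V. \<forall>k'\<in>W. g' \<cdot> iv k' \<in> U)"
    using assms openin_component_arr_topology[OF assms(1), of U] by blast
  then show thesis using that by blast
qed

lemma openin_TGI:
  assumes "x \<in> obj \<G>" and "U \<subseteq> arr_over (component \<G> x)"
    and "\<And>g k. g \<in> S x \<Longrightarrow> k \<in> S x \<Longrightarrow> g \<cdot> iv k \<in> U \<Longrightarrow> \<exists>V W. openin (F x) V \<and> g \<in> V \<and>
      openin (F x) W \<and> k \<in> W \<and> (\<forall>g'\<in>V. \<forall>k'\<in>W. g' \<cdot> iv k' \<in> U)"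
  shows "openin (TG x) U"
  unfolding openin_component_arr_topology[OF assms(1)] using assms(2,3) by blast

lemma topspace_TG: assumes x: "x \<in> obj \<G>" shows "topspace (TG x) = arr_over (component \<G> x)"
proof -
  have "openin (TG x) (arr_over (component \<G> x))"
  proof (rule openin_TGI[OF x order_refl])
    fix g k assume gk: "g \<in> S x" "k \<in> S x"
    have "\<forall>g'\<in>S x. \<forall>k'\<in>S x. g' \<cdot> iv k' \<in> arr_over (component \<G> x)" using quotient_arrow(1) by blast
    then show "\<exists>V W. openin (F x) V \<and> g \<in> V \<and> openin (F x) W \<and> k \<in> W \<and>
        (\<forall>g'\<in>V. \<forall>k'\<in>W. g' \<cdot> iv k' \<in> arr_over (component \<G> x))"
      using openin_fiber[OF x] gk by blast
  qed
  moreover have "U \<subseteq> arr_over (component \<G> x)" if "openin (TG x) U" for U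
    using that openin_component_arr_topology[OF x] by blast
  ultimately show ?thesis by (meson openin_subset openin_topspace subset_antisym)
qed

text \<open>Two ways of writing an arrow as \<open>g \<cdot> iv k\<close> differ by a common right
  factor from the vertex group. The saturation of a box is thus the union of its diagonal
  translates, which are again open boxes.\<close>

lemma openin_quotients:
  assumes x: "x \<in> obj \<G>" and V: "openin (F x) V" and W: "openin (F x) W"
  shows "openin (TG x) (quotients V W)"
proof (rule openin_TGI[OF x])
  have sub: "V \<subseteq> S x" "W \<subseteq> S x" using V W fiber_open_subset[OF x] by auto
  show "quotients V W \<subseteq> arr_over (component \<G> x)"
    unfolding quotients_def using sub quotient_arrow(1) by blast
  fix g k assume gk: "g \<in> S x" "k \<in> S x" "g \<cdot> iv k \<in> quotients V W"
  then obtain g1 k1 where 1: "g1 \<in> V" "k1 \<in> W" "g \<cdot> iv k = g1 \<cdot> iv k1" unfolding quotients_def by blast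
  have 2: "g1 \<in> arr \<G>" "\<sigma> g1 = x" "k1 \<in> arr \<G>" "\<sigma> k1 = x" using 1 sub by auto
  have gk': "g \<in> arr \<G>" "\<sigma> g = x" "k \<in> arr \<G>" "\<sigma> k = x" using gk by auto
  have "\<tau> (g \<cdot> iv k) = \<tau> (g1 \<cdot> iv k1)" "\<sigma> (g \<cdot> iv k) = \<sigma> (g1 \<cdot> iv k1)" using 1(3) by simp_all
  then have t: "\<tau> g = \<tau> g1" "\<tau> k = \<tau> k1" using gk' 2 by simp_all
  define a where "a = iv k1 \<cdot> k"
  have a: "a \<in> arr \<G>" "\<sigma> a = x" "\<tau> a = x" unfolding a_def using gk' 2 t by simp_all
  have ka: "k1 \<cdot> a = k" unfolding a_def using gk' 2 t by simp
  have "g1 \<cdot> a = g1 \<cdot> iv k1 \<cdot> k" unfolding a_def using gk' 2 t by (simp add: assoc)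
  also have "\<dots> = g" unfolding 1(3)[symmetric] using gk' by simp
  finally have ga: "g1 \<cdot> a = g" .
  let ?V = "(\<lambda>h. h \<cdot> a) ` V" and ?W = "(\<lambda>h. h \<cdot> a) ` W"
  have "openin (F x) ?V" "openin (F x) ?W" using right_translate_open[OF a(1)] V W a by auto
  moreover have "g \<in> ?V" "k \<in> ?W" using 1 ga ka by force+
  moreover have "\<forall>g'\<in>?V. \<forall>k'\<in>?W. g' \<cdot> iv k' \<in> quotients V W"
  proof clarify
    fix v w assume vw: "v \<in> V" "w \<in> W"
    then have "v \<in> arr \<G>" "\<sigma> v = x" "w \<in> arr \<G>" "\<sigma> w = x" using sub by auto
    then have "v \<cdot> a \<cdot> iv (w \<cdot> a) = v \<cdot> iv w" using a by (simp add: assoc[symmetric])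
    then show "v \<cdot> a \<cdot> iv (w \<cdot> a) \<in> quotients V W" using quotientsI[OF vw] by simp
  qed
  ultimately show "\<exists>V' W'. openin (F x) V' \<and> g \<in> V' \<and> openin (F x) W' \<and> k \<in> W' \<and>
      (\<forall>g'\<in>V'. \<forall>k'\<in>W'. g' \<cdot> iv k' \<in> quotients V W)" by blast
qed

lemma quotients_base:
  assumes x: "x \<in> obj \<G>" and \<B>: "\<And>W p. openin (F x) W \<Longrightarrow> p \<in> W \<Longrightarrow> \<exists>b\<in>\<B>. p \<in> b \<and> b \<subseteq> W"
    and U: "openin (TG x) U" "u \<in> U"
  shows "\<exists>b\<in>\<B>. \<exists>b'\<in>\<B>. u \<in> quotients b b' \<and> quotients b b' \<subseteq> U"
proof -
  have "u \<in> arr_over (component \<G> x)" using U topspace_TG[OF x] openin_subset by blast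
  then obtain g k where gk: "g \<in> S x" "k \<in> S x" "u = g \<cdot> iv k" by (rule arr_over_quotient)
  obtain V W where VW: "openin (F x) V" "g \<in> V" "openin (F x) W" "k \<in> W"
    "\<And>g' k'. g' \<in> V \<Longrightarrow> k' \<in> W \<Longrightarrow> g' \<cdot> iv k' \<in> U"
    using openin_TG[OF x U(1) gk(1,2)] U(2) gk(3) by metis
  obtain b where b: "b \<in> \<B>" "g \<in> b" "b \<subseteq> V" using \<B>[OF VW(1,2)] by blast
  obtain b' where b': "b' \<in> \<B>" "k \<in> b'" "b' \<subseteq> W" using \<B>[OF VW(3,4)] by blast
  have "quotients b b' \<subseteq> U" unfolding quotients_def using VW(5) b(3) b'(3) by blast
  moreover have "u \<in> quotients b b'" unfolding gk(3) using b(2) b'(2) by (rule quotientsI)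
  ultimately show ?thesis using b(1) b'(1) by blast
qed

lemma second_countable_TG: assumes x: "x \<in> obj \<G>" shows "second_countable (TG x)"
proof -
  obtain \<B> where \<B>: "countable \<B>" "\<And>b. b \<in> \<B> \<Longrightarrow> openin (F x) b"
    "\<And>W p. openin (F x) W \<Longrightarrow> p \<in> W \<Longrightarrow> \<exists>b\<in>\<B>. p \<in> b \<and> b \<subseteq> W"
    using fiber_base[OF x] by metis
  let ?\<Q> = "(\<lambda>(b, b'). quotients b b') ` (\<B> \<times> \<B>)"
  have "countable ?\<Q>" using \<B>(1) by simp
  moreover have "\<forall>V\<in>?\<Q>. openin (TG x) V" using openin_quotients[OF x \<B>(2) \<B>(2)] by auto
  moreover have "\<exists>V\<in>?\<Q>. u \<in> V \<and> V \<subseteq> U" if U: "openin (TG x) U" "u \<in> U" for U u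
    using quotients_base[OF x \<B>(3) U] by auto
  ultimately show ?thesis unfolding second_countable_def by (intro exI[of _ ?\<Q>] conjI allI impI; (elim conjE)?)
qed

text \<open>One direction specialises the denominator to the identity at \<open>x\<close>. The other
  rests on joint continuity of the right action: an arrow \<open>g \<cdot> iv k\<close> with source
  \<open>x\<close> has \<open>iv k\<close> in the vertex group, and \<open>iv k\<close> is close to
  the identity when \<open>k\<close> is.\<close>

lemma subtopology_TG_base:
  assumes x: "x \<in> obj \<G>" shows "subtopology (TG x) (S x) = F x"
  unfolding topology_eq
proof (intro allI iffI)
  fix V assume "openin (subtopology (TG x) (S x)) V"
  then obtain U where U: "openin (TG x) U" "V = U \<inter> S x" unfolding openin_subtopology by blast
  show "openin (F x) V"
  proof (rule fiber_openI)
    fix g assume g: "g \<in> V"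
    then have gS: "g \<in> S x" "idt \<G> x \<in> S x" "g \<cdot> iv (idt \<G> x) \<in> U" using U(2) x by auto
    obtain V' W' where VW: "openin (F x) V'" "g \<in> V'" "idt \<G> x \<in> W'"
      "\<And>g' k'. g' \<in> V' \<Longrightarrow> k' \<in> W' \<Longrightarrow> g' \<cdot> iv k' \<in> U"
      using openin_TG[OF x U(1) gS] by metis
    have "V' \<subseteq> V"
    proof
      fix h assume h: "h \<in> V'"
      then have "h \<in> S x" using fiber_open_subset[OF x VW(1)] by blast
      then show "h \<in> V" unfolding U(2) using VW(4)[OF h VW(3)] x by simp
    qed
    then show "\<exists>W. openin (F x) W \<and> g \<in> W \<and> W \<subseteq> V" using VW(1,2) by blast
  qed
next
  fix V assume V: "openin (F x) V"
  have VS: "V \<subseteq> S x" using fiber_open_subset[OF x V] .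
  have "\<exists>U. openin (TG x) U \<and> v \<in> U \<and> U \<inter> S x \<subseteq> V" if v: "v \<in> V" for v
  proof -
    have vS: "v \<in> S x" "idt \<G> x \<in> S x" "\<tau> (idt \<G> x) = x" "v \<cdot> idt \<G> x \<in> V" using v VS x by auto
    obtain V1 N where VN: "openin (F x) V1" "v \<in> V1" "openin (F x) N" "idt \<G> x \<in> N"
      "\<And>g a. g \<in> V1 \<Longrightarrow> a \<in> N \<Longrightarrow> \<tau> a = x \<Longrightarrow> g \<cdot> a \<in> V"
      using right_action_joint_continuity[OF x vS(1-3) V vS(4)] by metis
    have iN: "iv (idt \<G> x) \<in> N" using VN(4) x by simp
    obtain N' where N': "openin (F x) N'" "idt \<G> x \<in> N'" "\<And>k. k \<in> N' \<Longrightarrow> \<tau> k = x \<Longrightarrow> iv k \<in> N"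
      using iv_nhd[OF vS(2,3) VN(3) iN] by metis
    have "v = v \<cdot> iv (idt \<G> x)" using vS x by simp
    then have "v \<in> quotients V1 N'" using quotientsI[OF VN(2) N'(2)] by simp
    moreover have "quotients V1 N' \<inter> S x \<subseteq> V"
    proof
      fix u assume u: "u \<in> quotients V1 N' \<inter> S x"
      then obtain g k where gk: "g \<in> V1" "k \<in> N'" "u = g \<cdot> iv k" unfolding quotients_def by blast
      have gkS: "g \<in> S x" "k \<in> S x" using gk fiber_open_subset[OF x] VN(1) N'(1) by blast+
      have "\<tau> k = x" using u gk(3) gkS by simp
      moreover from this have "\<tau> (iv k) = x" using gkS by simp
      ultimately show "u \<in> V" unfolding gk(3) using VN(5)[OF gk(1) N'(3)[OF gk(2)]] by simp
    qed
    ultimately show ?thesis using openin_quotients[OF x VN(1) N'(1)] by blast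
  qed
  then obtain U where U: "\<forall>v\<in>V. openin (TG x) (U v) \<and> v \<in> U v \<and> U v \<inter> S x \<subseteq> V" by metis
  have "openin (TG x) (\<Union>v\<in>V. U v)" using U by blast
  moreover have "V = (\<Union>v\<in>V. U v) \<inter> S x" using U VS by blast
  ultimately show "openin (subtopology (TG x) (S x)) V" unfolding openin_subtopology by blast
qed

lemma subtopology_TG:
  assumes x: "x \<in> obj \<G>" and y: "y \<in> component \<G> x" shows "subtopology (TG x) (S y) = F y"
proof -
  have "y \<in> obj \<G>" using y component_subset by blast
  then show ?thesis using subtopology_TG_base[of y] component_eq[OF y] by simp
qed

lemma groupoid_restrict: "groupoid (restrict_groupoid \<G> (component \<G> x))"
proof -
  have sub: "y \<in> obj \<G>" if "y \<in> component \<G> x" for y using that component_subset by blast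
  have t: "\<tau> g \<in> component \<G> x" if "g \<in> arr \<G>" "\<sigma> g \<in> component \<G> x" for g
    using component_closed(1)[OF that(2,1)] by simp
  show ?thesis
    unfolding groupoid_def restrict_groupoid_def composable_def
    using sub t by (simp add: assoc mul_ivs_left mul_ivs_right)
qed

lemma mul_continuous_TG:
  assumes x: "x \<in> obj \<G>"
  shows "continuous_map (subtopology (prod_topology (TG x) (TG x))
    (composable (restrict_groupoid \<G> (component \<G> x)))) (TG x) (\<lambda>(g, h). g \<cdot> h)"
proof -
  let ?C = "component \<G> x" and ?K = "composable (restrict_groupoid \<G> (component \<G> x))"
  let ?P = "subtopology (prod_topology (TG x) (TG x)) ?K"
  have K: "?K = {(g, h). g \<in> arr_over ?C \<and> h \<in> arr_over ?C \<and> \<sigma> g = \<tau> h}"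
    unfolding composable_def restrict_groupoid_def by simp
  have top: "topspace ?P = ?K" using topspace_TG[OF x] unfolding K by auto
  show ?thesis
    unfolding continuous_map_def
  proof (intro conjI allI impI)
    show "(\<lambda>(g, h). g \<cdot> h) \<in> topspace ?P \<rightarrow> topspace (TG x)"
      unfolding top topspace_TG[OF x] K by auto
    fix U assume U: "openin (TG x) U"
    show "openin ?P {p \<in> topspace ?P. (\<lambda>(g, h). g \<cdot> h) p \<in> U}"
    proof (subst openin_subopen, intro ballI)
      fix p assume "p \<in> {p \<in> topspace ?P. (\<lambda>(g, h). g \<cdot> h) p \<in> U}"
      then obtain u v where p: "p = (u, v)" and uv: "u \<in> arr_over ?C" "v \<in> arr_over ?C" "\<sigma> u = \<tau> v" "u \<cdot> v \<in> U"
        unfolding top K by auto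
      obtain g k where gk: "g \<in> S x" "k \<in> S x" "u = g \<cdot> iv k" using uv(1) by (rule arr_over_quotient)
      obtain h l where hl: "h \<in> S x" "l \<in> S x" "v = h \<cdot> iv l" using uv(2) by (rule arr_over_quotient)
      have kh: "\<tau> k = \<tau> h" using uv(3) gk hl by simp
      have eq: "g \<cdot> (iv k \<cdot> h) \<cdot> iv l = u \<cdot> v" unfolding gk(3) hl(3) using gk hl kh by (simp add: assoc)
      have gkh: "g \<cdot> (iv k \<cdot> h) \<in> S x" "g \<cdot> (iv k \<cdot> h) \<cdot> iv l \<in> U" using gk hl kh eq uv(4) by simp_all
      obtain V W where VW: "openin (F x) V" "g \<cdot> (iv k \<cdot> h) \<in> V" "openin (F x) W" "l \<in> W"
        "\<And>g' k'. g' \<in> V \<Longrightarrow> k' \<in> W \<Longrightarrow> g' \<cdot> iv k' \<in> U"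
        using openin_TG[OF x U gkh(1) hl(2) gkh(2)] by metis
      obtain V1 V2 V3 where V123: "openin (F x) V1" "g \<in> V1" "openin (F x) V2" "k \<in> V2" "openin (F x) V3" "h \<in> V3"
        "\<And>g' k' h'. g' \<in> V1 \<Longrightarrow> k' \<in> V2 \<Longrightarrow> h' \<in> V3 \<Longrightarrow> \<tau> k' = \<tau> h' \<Longrightarrow> g' \<cdot> (iv k' \<cdot> h') \<in> V"
        using triple_product_nhd[OF x gk(1,2) hl(1) kh VW(1,2)] by metis
      let ?T = "(quotients V1 V2 \<times> quotients V3 W) \<inter> ?K"
      have "openin ?P ?T"
        using openin_quotients[OF x V123(1,3)] openin_quotients[OF x V123(5) VW(3)]
        by (intro openin_subtopology_Int) (simp add: openin_prod_Times_iff)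
      moreover have "p \<in> ?T"
        unfolding p K gk(3) hl(3) using uv quotientsI V123 VW(4) unfolding gk(3) hl(3) by blast
      moreover have "?T \<subseteq> {p \<in> topspace ?P. (\<lambda>(g, h). g \<cdot> h) p \<in> U}"
      proof
        fix q assume q: "q \<in> ?T"
        then obtain g' k' h' l' where q': "g' \<in> V1" "k' \<in> V2" "h' \<in> V3" "l' \<in> W" "q = (g' \<cdot> iv k', h' \<cdot> iv l')"
          unfolding quotients_def by blast
        have S': "g' \<in> S x" "k' \<in> S x" "h' \<in> S x" "l' \<in> S x"
          using q' fiber_open_subset[OF x] V123(1,3,5) VW(3) by blast+
        have "\<sigma> (g' \<cdot> iv k') = \<tau> (h' \<cdot> iv l')" using q unfolding q'(5) K by simp
        then have t: "\<tau> k' = \<tau> h'" using S' by simp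
        have "g' \<cdot> (iv k' \<cdot> h') \<cdot> iv l' \<in> U" by (rule VW(5)[OF V123(7)[OF q'(1-3) t] q'(4)])
        moreover have "g' \<cdot> (iv k' \<cdot> h') \<cdot> iv l' = g' \<cdot> iv k' \<cdot> (h' \<cdot> iv l')" using S' t by (simp add: assoc)
        ultimately show "q \<in> {p \<in> topspace ?P. (\<lambda>(g, h). g \<cdot> h) p \<in> U}"
          using q unfolding top q'(5) by simp
      qed
      ultimately show "\<exists>T. openin ?P T \<and> p \<in> T \<and> T \<subseteq> {p \<in> topspace ?P. (\<lambda>(g, h). g \<cdot> h) p \<in> U}"
        by (intro exI[of _ ?T] conjI)
    qed
  qed
qed

text \<open>Each operation is read on pairs \<open>(g, k)\<close> representing
  \<open>g \<cdot> iv k\<close>: the source is \<open>\<tau> k\<close>, the target is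
  \<open>\<tau> g\<close>, inversion swaps the pair, and identities come from the diagonal.\<close>

lemma open_topological_groupoid_component:
  assumes x: "x \<in> obj \<G>"
  shows "open_topological_groupoid (restrict_groupoid \<G> (component \<G> x)) (TC x) (TG x)"
proof -
  let ?C = "component \<G> x"
  have C: "?C \<subseteq> obj \<G>" by (rule component_subset)
  interpret R: groupoid "restrict_groupoid \<G> ?C" by (rule groupoid_restrict)
  have sel: "obj (restrict_groupoid \<G> ?C) = ?C" "arr (restrict_groupoid \<G> ?C) = arr_over ?C"
    "src (restrict_groupoid \<G> ?C) = \<sigma>" "tgt (restrict_groupoid \<G> ?C) = \<tau>"
    "idt (restrict_groupoid \<G> ?C) = idt \<G>" "ivs (restrict_groupoid \<G> ?C) = iv"
    "mul (restrict_groupoid \<G> ?C) = mul \<G>"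
    unfolding restrict_groupoid_def by simp_all
  have topTC: "topspace (TC x) = ?C" using x by simp
  have topTG: "topspace (TG x) = arr_over ?C" by (rule topspace_TG[OF x])
  show ?thesis
  proof (unfold_locales, unfold sel)
    show "topspace (TC x) = ?C" "topspace (TG x) = arr_over ?C" by fact+
    show "continuous_map (TG x) (TC x) \<sigma>"
      unfolding continuous_map_def topTC topTG
    proof (intro conjI allI impI)
      fix U assume "openin (TC x) U"
      then have U: "openin (F x) {g \<in> S x. \<tau> g \<in> U}" using openin_component_topology[OF x] by blast
      show "openin (TG x) {u \<in> arr_over ?C. \<sigma> u \<in> U}"
      proof (rule openin_TGI[OF x])
        fix g k assume gk: "g \<in> S x" "k \<in> S x" "g \<cdot> iv k \<in> {u \<in> arr_over ?C. \<sigma> u \<in> U}"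
        have "k \<in> {g \<in> S x. \<tau> g \<in> U}" using gk quotient_arrow(2)[OF gk(1,2)] by simp
        moreover have "g' \<cdot> iv k' \<in> {u \<in> arr_over ?C. \<sigma> u \<in> U}" if "g' \<in> S x" "k' \<in> S x" "\<tau> k' \<in> U" for g' k'
          using quotient_arrow(1,2)[OF that(1,2)] that(3) by simp
        then have "\<forall>g'\<in>S x. \<forall>k'\<in>{g \<in> S x. \<tau> g \<in> U}. g' \<cdot> iv k' \<in> {u \<in> arr_over ?C. \<sigma> u \<in> U}" by blast
        ultimately show "\<exists>V W. openin (F x) V \<and> g \<in> V \<and> openin (F x) W \<and> k \<in> W \<and>
            (\<forall>g'\<in>V. \<forall>k'\<in>W. g' \<cdot> iv k' \<in> {u \<in> arr_over ?C. \<sigma> u \<in> U})"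
          using gk(1) U openin_fiber[OF x] by blast
      qed blast
    qed auto
    show "continuous_map (TG x) (TC x) \<tau>"
      unfolding continuous_map_def topTC topTG
    proof (intro conjI allI impI)
      show "\<tau> \<in> arr_over ?C \<rightarrow> ?C" using R.tgt_in unfolding sel by blast
      fix U assume "openin (TC x) U"
      then have U: "openin (F x) {g \<in> S x. \<tau> g \<in> U}" using openin_component_topology[OF x] by blast
      show "openin (TG x) {u \<in> arr_over ?C. \<tau> u \<in> U}"
      proof (rule openin_TGI[OF x])
        fix g k assume gk: "g \<in> S x" "k \<in> S x" "g \<cdot> iv k \<in> {u \<in> arr_over ?C. \<tau> u \<in> U}"
        have "g \<in> {g \<in> S x. \<tau> g \<in> U}" using gk quotient_arrow(3)[OF gk(1,2)] by simp
        moreover have "g' \<cdot> iv k' \<in> {u \<in> arr_over ?C. \<tau> u \<in> U}" if "g' \<in> S x" "k' \<in> S x" "\<tau> g' \<in> U" for g' k'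
          using quotient_arrow(1,3)[OF that(1,2)] that(1,3) by simp
        then have "\<forall>g'\<in>{g \<in> S x. \<tau> g \<in> U}. \<forall>k'\<in>S x. g' \<cdot> iv k' \<in> {u \<in> arr_over ?C. \<tau> u \<in> U}" by blast
        ultimately show "\<exists>V W. openin (F x) V \<and> g \<in> V \<and> openin (F x) W \<and> k \<in> W \<and>
            (\<forall>g'\<in>V. \<forall>k'\<in>W. g' \<cdot> iv k' \<in> {u \<in> arr_over ?C. \<tau> u \<in> U})"
          using gk(2) U openin_fiber[OF x] by blast
      qed blast
    qed
    show "continuous_map (subtopology (prod_topology (TG x) (TG x)) (composable (restrict_groupoid \<G> ?C)))
        (TG x) (\<lambda>(g, h). g \<cdot> h)" by (rule mul_continuous_TG[OF x])
    show "continuous_map (TC x) (TG x) (idt \<G>)"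
      unfolding continuous_map_def topTC topTG
    proof (intro conjI allI impI)
      show "idt \<G> \<in> ?C \<rightarrow> arr_over ?C" using C by auto
      fix U assume U: "openin (TG x) U"
      show "openin (TC x) {y \<in> ?C. idt \<G> y \<in> U}"
        unfolding openin_component_topology[OF x]
      proof (intro conjI fiber_openI)
        fix g assume g: "g \<in> {g \<in> S x. \<tau> g \<in> {y \<in> ?C. idt \<G> y \<in> U}}"
        then have gS: "g \<in> S x" "g \<cdot> iv g \<in> U" by (simp_all add: mul_ivs_right)
        obtain V W where VW: "openin (F x) V" "g \<in> V" "openin (F x) W" "g \<in> W"
          "\<And>g' k'. g' \<in> V \<Longrightarrow> k' \<in> W \<Longrightarrow> g' \<cdot> iv k' \<in> U"
          using openin_TG[OF x U gS(1,1,2)] by metis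
        have "V \<inter> W \<subseteq> {g \<in> S x. \<tau> g \<in> {y \<in> ?C. idt \<G> y \<in> U}}"
        proof
          fix h assume h: "h \<in> V \<inter> W"
          then have hS: "h \<in> S x" using fiber_open_subset[OF x VW(1)] by blast
          moreover have "h \<cdot> iv h \<in> U" using VW(5) h by blast
          moreover have "\<tau> h \<in> ?C" unfolding component_def using hS by blast
          ultimately show "h \<in> {g \<in> S x. \<tau> g \<in> {y \<in> ?C. idt \<G> y \<in> U}}" by (simp add: mul_ivs_right)
        qed
        then show "\<exists>V. openin (F x) V \<and> g \<in> V \<and> V \<subseteq> {g \<in> S x. \<tau> g \<in> {y \<in> ?C. idt \<G> y \<in> U}}"
          using VW(1-4) by (intro exI[of _ "V \<inter> W"]) (simp add: openin_Int)
      qed blast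
    qed
    show "continuous_map (TG x) (TG x) iv"
      unfolding continuous_map_def topTG
    proof (intro conjI allI impI)
      show "iv \<in> arr_over ?C \<rightarrow> arr_over ?C" using R.ivs_in unfolding sel by blast
      fix U assume U: "openin (TG x) U"
      show "openin (TG x) {u \<in> arr_over ?C. iv u \<in> U}"
      proof (rule openin_TGI[OF x])
        fix g k assume gk: "g \<in> S x" "k \<in> S x" "g \<cdot> iv k \<in> {u \<in> arr_over ?C. iv u \<in> U}"
        then have kg: "k \<cdot> iv g \<in> U" using quotient_arrow(4)[OF gk(1,2)] by simp
        obtain V W where VW: "openin (F x) V" "k \<in> V" "openin (F x) W" "g \<in> W"
          "\<And>g' k'. g' \<in> V \<Longrightarrow> k' \<in> W \<Longrightarrow> g' \<cdot> iv k' \<in> U"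
          using openin_TG[OF x U gk(2,1) kg] by metis
        have "g' \<cdot> iv k' \<in> {u \<in> arr_over ?C. iv u \<in> U}" if gk': "g' \<in> W" "k' \<in> V" for g' k'
        proof -
          have "g' \<in> S x" "k' \<in> S x" using gk' fiber_open_subset[OF x] VW(1,3) by blast+
          then show ?thesis using VW(5)[OF gk'(2,1)] quotient_arrow(1,4)[of g' x k'] by simp
        qed
        then show "\<exists>V W. openin (F x) V \<and> g \<in> V \<and> openin (F x) W \<and> k \<in> W \<and>
            (\<forall>g'\<in>V. \<forall>k'\<in>W. g' \<cdot> iv k' \<in> {u \<in> arr_over ?C. iv u \<in> U})" using VW(1-4) by blast
      qed blast
    qed
    show "open_map (TG x) (TC x) \<sigma>"
      unfolding open_map_def
    proof (intro allI impI)
      fix U assume U: "openin (TG x) U"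
      have UC: "U \<subseteq> arr_over ?C" using openin_subset[OF U] topTG by simp
      show "openin (TC x) (\<sigma> ` U)"
        unfolding openin_component_topology[OF x]
      proof (intro conjI fiber_openI)
        show "\<sigma> ` U \<subseteq> ?C" using UC by blast
        fix h assume "h \<in> {g \<in> S x. \<tau> g \<in> \<sigma> ` U}"
        then obtain u where u: "u \<in> U" "\<tau> h = \<sigma> u" and h: "h \<in> S x" by auto
        have uh: "u \<cdot> h \<in> S x" "u \<cdot> h \<cdot> iv h = u" using arrow_as_quotient[OF _ h u(2)] u(1) UC by auto
        then have "u \<cdot> h \<cdot> iv h \<in> U" using u(1) by simp
        \<comment> \<open>With the numerator \<open>u \<cdot> h\<close> kept fixed, every
          \<open>k \<in> W\<close> as denominator gives an arrow of \<open>U\<close> with source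
          \<open>\<tau> k\<close>.\<close>
        then obtain V W where VW: "openin (F x) V" "u \<cdot> h \<in> V" "openin (F x) W" "h \<in> W"
          "\<And>g' k'. g' \<in> V \<Longrightarrow> k' \<in> W \<Longrightarrow> g' \<cdot> iv k' \<in> U"
          using openin_TG[OF x U uh(1) h] by metis
        have "W \<subseteq> {g \<in> S x. \<tau> g \<in> \<sigma> ` U}"
        proof
          fix k assume k: "k \<in> W"
          have kS: "k \<in> S x" using k fiber_open_subset[OF x VW(3)] by blast
          have "\<sigma> (u \<cdot> h \<cdot> iv k) = \<tau> k" by (rule quotient_arrow(2)[OF uh(1) kS])
          then show "k \<in> {g \<in> S x. \<tau> g \<in> \<sigma> ` U}" using kS VW(5)[OF VW(2) k] by (metis (mono_tags, lifting) imageI mem_Collect_eq)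
        qed
        then show "\<exists>V. openin (F x) V \<and> h \<in> V \<and> V \<subseteq> {g \<in> S x. \<tau> g \<in> \<sigma> ` U}" using VW(3,4) by blast
      qed
    qed
  qed
qed

text \<open>Because \<open>\<tau>\<close> is open and continuous on the fiber, the complement of the
  closure of a nowhere dense set pulls back to an open dense set. A countable cover by nowhere dense
  sets would contradict the Baire property of the fiber.\<close>

lemma component_nonmeager:
  assumes x: "x \<in> obj \<G>" shows "\<not> meager_in (TC x) (component \<G> x)"
proof
  assume "meager_in (TC x) (component \<G> x)"
  then obtain N :: "nat \<Rightarrow> 'x set" where N: "\<And>n. nowhere_dense_in (TC x) (N n)" "component \<G> x = (\<Union>n. N n)"
    unfolding meager_in_def by blast
  define D where "D n = {g \<in> S x. \<tau> g \<in> component \<G> x - TC x closure_of (N n)}" for n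
  have op: "openin (TC x) (component \<G> x - TC x closure_of (N n))" for n
    using openin_diff[OF openin_topspace closedin_closure_of[of "TC x" "N n"]] x by simp
  have D: "\<forall>U\<in>range D. open_dense_on (F x) (topspace (F x)) U"
  proof
    fix U assume "U \<in> range D"
    then obtain n where n: "U = D n" by blast
    show "open_dense_on (F x) (topspace (F x)) U"
      unfolding open_dense_on_def n
    proof (intro conjI allI impI; (elim conjE)?)
      show "openin (F x) (D n)" unfolding D_def using op[of n] openin_component_topology[OF x] by blast
      fix W assume W: "openin (F x) W" "W \<inter> topspace (F x) \<noteq> {}"
      have WS: "W \<subseteq> S x" using fiber_open_subset[OF x W(1)] .
      have "openin (TC x) (\<tau> ` W)" by (rule openin_tgt_image[OF x W(1)])
      moreover have "\<tau> ` W \<noteq> {}" using W(2) by blast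
      moreover have "TC x interior_of (TC x closure_of (N n)) = {}"
        using N(1)[of n] unfolding nowhere_dense_in_def by blast
      ultimately have "\<not> \<tau> ` W \<subseteq> TC x closure_of (N n)" by (metis interior_of_maximal subset_empty)
      then obtain g where g: "g \<in> W" "\<tau> g \<notin> TC x closure_of (N n)" by blast
      moreover have "\<tau> g \<in> component \<G> x" unfolding component_def using g(1) WS by blast
      ultimately have "g \<in> D n" unfolding D_def using WS by blast
      then show "W \<inter> D n \<inter> topspace (F x) \<noteq> {}" using g(1) WS topspace_fiber[OF x] by blast
    qed
  qed
  have ne: "S x \<inter> topspace (F x) \<noteq> {}"
    using x topspace_fiber[OF x] src_idt idt_in by (metis Int_absorb empty_iff mem_src_fiber)
  have cnt: "countable (range D)" by simp
  obtain p where p: "p \<in> S x \<inter> topspace (F x)" "\<forall>U\<in>range D. p \<in> U"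
    using quasi_polish_baire[OF quasi_polish_fiber[OF x] pi02_in_topspace cnt D openin_fiber[OF x] ne] by (elim bexE)
  have "\<tau> p \<in> component \<G> x" unfolding component_def using p(1) by blast
  then obtain n where n: "\<tau> p \<in> N n" using N(2) by blast
  have "N n \<subseteq> TC x closure_of (N n)"
    using N(1)[of n] unfolding nowhere_dense_in_def by (intro closure_of_subset) blast
  moreover have "p \<in> D n" using p(2) by blast
  ultimately show False unfolding D_def using n by blast
qed

subsection \<open>Borel sets\<close>

lemma component_subset_space: "component \<G> x \<subseteq> space BX"
  unfolding space_obj by (rule component_subset)

text \<open>Lusin separation for \<open>\<tau>\<close> on the fiber. A separator is controlled only
  on the image, so this yields a trace and leaves open whether the component is Borel.\<close>

lemma component_open_trace_borel:
  assumes x: "x \<in> obj \<G>" and U: "openin (TC x) U"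
  obtains B where "B \<in> sets BX" and "B \<inter> component \<G> x = U"
proof -
  let ?C = "component \<G> x"
  obtain \<A> where \<A>: "countable \<A>" "\<A> \<subseteq> sets BX"
    "\<And>p q. p \<in> space BX \<Longrightarrow> q \<in> space BX \<Longrightarrow> p \<noteq> q \<Longrightarrow> \<exists>A\<in>\<A>. (p \<in> A) \<noteq> (q \<in> A)"
    using standard_borel_separating[OF standard_borel_obj] by metis
  have UC: "U \<subseteq> ?C" and U': "openin (F x) {g \<in> S x. \<tau> g \<in> U}"
    using U openin_component_topology[OF x] by auto
  obtain B where B: "B \<in> sets BX" "B \<inter> \<tau> ` S x = U \<inter> \<tau> ` S x"
  proof (rule standard_borel_saturated_image[OF standard_borel_arr sets.sigma_algebra_axioms
        src_fiber_borel[OF x] _ \<A>(1,2) _ _ fiber_open_borel[OF x U']])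
    show "\<tau> ` S x \<subseteq> space BX" using space_obj by auto
    show "{g \<in> S x. \<tau> g \<in> A} \<in> sets BG" if "A \<in> \<A>" for A
      using tgt_preimage_borel[OF x] \<A>(2) that by blast
    show "\<exists>A\<in>\<A>. (\<tau> p \<in> A) \<noteq> (\<tau> q \<in> A)" if "p \<in> S x" "q \<in> S x" "\<tau> p \<noteq> \<tau> q" for p q
      by (rule \<A>(3)) (use that space_obj in auto)
  qed
  have "B \<inter> ?C = U" using B(2) UC unfolding component_def by blast
  then show thesis using B(1) that by blast
qed

text \<open>The converse use of Lusin separation: the separator is sought in the sigma-algebra
  generated by the topology, and the T0 property makes a countable base separate points.\<close>

lemma borel_trace_component:
  assumes x: "x \<in> obj \<G>" and B: "B \<in> sets BX"
  shows "B \<inter> component \<G> x \<in> sigma_sets (component \<G> x) {U. openin (TC x) U}"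
proof -
  let ?C = "component \<G> x" and ?\<S> = "sigma_sets (component \<G> x) {U. openin (TC x) U}"
  obtain \<O> where \<O>: "countable \<O>" "\<And>V. V \<in> \<O> \<Longrightarrow> openin (TC x) V"
    "\<And>U y. openin (TC x) U \<Longrightarrow> y \<in> U \<Longrightarrow> \<exists>V\<in>\<O>. y \<in> V \<and> V \<subseteq> U"
    using second_countable_component[OF x] unfolding second_countable_def by auto
  have top: "topspace (TC x) = ?C" using x by simp
  have tC: "\<tau> ` S x = ?C" unfolding component_def ..
  obtain D where D: "D \<in> ?\<S>" "D \<inter> \<tau> ` S x = B \<inter> \<tau> ` S x"
  proof (rule standard_borel_saturated_image[OF standard_borel_arr sigma_algebra_sigma_opens[of "TC x", unfolded top]
        src_fiber_borel[OF x] _ \<O>(1) _ _ _ tgt_preimage_borel[OF x B]])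
    show "\<tau> ` S x \<subseteq> ?C" using tC by simp
    show "\<O> \<subseteq> ?\<S>" using \<O>(2) by (auto intro: sigma_sets.Basic)
    show "{g \<in> S x. \<tau> g \<in> A} \<in> sets BG" if "A \<in> \<O>" for A
      by (rule fiber_open_borel[OF x]) (use \<O>(2)[OF that] openin_component_topology[OF x] in blast)
    show "\<exists>A\<in>\<O>. (\<tau> p \<in> A) \<noteq> (\<tau> q \<in> A)" if pq: "p \<in> S x" "q \<in> S x" "\<tau> p \<noteq> \<tau> q" for p q
    proof -
      have "\<tau> p \<in> ?C" "\<tau> q \<in> ?C" using pq(1,2) tC by blast+
      then obtain W where W: "openin (TC x) W" "(\<tau> p \<in> W) \<noteq> (\<tau> q \<in> W)"
        using component_t0_space[OF x _ _ pq(3)] by blast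
      then show ?thesis using \<O>(3)[OF W(1), of "\<tau> p"] \<O>(3)[OF W(1), of "\<tau> q"] by blast
    qed
  qed
  have "D \<subseteq> ?C" using sigma_sets_into_sp[OF _ D(1)] openin_subset[of "TC x"] top by blast
  then have "D = B \<inter> ?C" using D(2) unfolding tC by blast
  then show ?thesis using D(1) by simp
qed

lemma sigma_component_topology:
  assumes x: "x \<in> obj \<G>"
  shows "{U. openin (TC x) U} \<subseteq> sets (restrict_space BX (component \<G> x))"
    and "sigma_sets (component \<G> x) {U. openin (TC x) U} = sets (restrict_space BX (component \<G> x))"
proof -
  let ?C = "component \<G> x"
  have sp: "space (restrict_space BX ?C) = ?C"
    using component_subset_space by (auto simp: space_restrict_space)
  show 1: "{U. openin (TC x) U} \<subseteq> sets (restrict_space BX ?C)"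
  proof clarify
    fix U assume "openin (TC x) U"
    then obtain B where "B \<in> sets BX" "B \<inter> ?C = U" by (rule component_open_trace_borel[OF x])
    then show "U \<in> sets (restrict_space BX ?C)" unfolding sets_restrict_space by blast
  qed
  show "sigma_sets ?C {U. openin (TC x) U} = sets (restrict_space BX ?C)"
  proof
    show "sigma_sets ?C {U. openin (TC x) U} \<subseteq> sets (restrict_space BX ?C)"
      using sets.sigma_sets_subset[OF 1] unfolding sp .
    show "sets (restrict_space BX ?C) \<subseteq> sigma_sets ?C {U. openin (TC x) U}"
      unfolding sets_restrict_space using borel_trace_component[OF x] by (auto simp: Int_commute)
  qed
qed

section \<open>Components and their open sets of arrows are Borel\<close>

text \<open>The operations that build \<open>D\<close> are repeated on ambient sets, with
  complements taken in \<open>\<Omega>\<close>.\<close>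

lemma sigma_sets_trace_lift:
  assumes "D \<in> sigma_sets C \<O>" and "C \<subseteq> \<Omega>"
    and "\<And>U. U \<in> \<O> \<Longrightarrow> \<exists>E\<in>sigma_sets \<Omega> \<W>. E \<inter> C = U"
  shows "\<exists>E\<in>sigma_sets \<Omega> \<W>. E \<inter> C = D"
  using assms(1)
proof induction
  case (Basic a)
  then show ?case using assms(3) by blast
next
  case Empty
  show ?case by (intro bexI[of _ "{}"]) (auto intro: sigma_sets.Empty)
next
  case (Compl a)
  then obtain E where "E \<in> sigma_sets \<Omega> \<W>" "E \<inter> C = a" by (elim bexE)
  then show ?case using assms(2) by (intro bexI[of _ "\<Omega> - E"]) (auto intro: sigma_sets.Compl)
next
  case (Union a)
  then obtain E where E: "\<forall>i. E i \<in> sigma_sets \<Omega> \<W> \<and> E i \<inter> C = a i" by metis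
  have "(\<Union>i. E i) \<in> sigma_sets \<Omega> \<W>" using E by (intro sigma_sets.Union) blast
  moreover have "(\<Union>i. E i) \<inter> C = (\<Union>i. a i)" using E by blast
  ultimately show ?case by blast
qed

text \<open>The sets that do not tell \<open>y\<close> from \<open>z\<close> are closed under
  complement in \<open>\<Omega>\<close> and countable union.\<close>

lemma sigma_sets_same_atom:
  assumes "E \<in> sigma_sets \<Omega> \<W>" and "y \<in> \<Omega>" "z \<in> \<Omega>" and "\<And>W. W \<in> \<W> \<Longrightarrow> y \<in> W \<longleftrightarrow> z \<in> W"
  shows "y \<in> E \<longleftrightarrow> z \<in> E"
  using assms(1) by induction (use assms(2-) in auto)

text \<open>A component is Borel because membership in it is equivalent to countably many Borel conditions:
  they express that the sets \<open>W b\<close> containing \<open>y\<close> are the images of the members \<open>b\<close> of a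
  neighbourhood base of some \<open>p\<close> in the fiber, and that \<open>y\<close> is not separated from \<open>\<tau> p\<close>.\<close>

theorem component_borel:
  assumes x: "x \<in> obj \<G>" shows "component \<G> x \<in> sets BX"
proof -
  let ?C = "component \<G> x"
  from quasi_polish_fiber[OF x] obtain \<B> R where sys: "countable \<B>" "countable R"
    "\<And>b. b \<in> \<B> \<Longrightarrow> openin (F x) b"
    "\<And>W p. openin (F x) W \<Longrightarrow> p \<in> W \<Longrightarrow> \<exists>b\<in>\<B>. p \<in> b \<and> b \<subseteq> W"
    "\<And>b \<C>. (b, \<C>) \<in> R \<Longrightarrow> \<C> \<subseteq> \<B> \<and> b \<subseteq> \<Union>\<C>"
    "\<And>c :: nat \<Rightarrow> 'g set. (\<And>k. c k \<in> \<B>) \<Longrightarrow> (\<And>k. c (Suc k) \<subseteq> c k) \<Longrightarrow>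
        (\<And>b \<C> k. (b, \<C>) \<in> R \<Longrightarrow> c k \<subseteq> b \<Longrightarrow> \<exists>l. \<exists>b'\<in>\<C>. c l \<subseteq> b') \<Longrightarrow>
        \<exists>p\<in>topspace (F x). (\<forall>k. p \<in> c k) \<and> (\<forall>W. openin (F x) W \<and> p \<in> W \<longrightarrow> (\<exists>k. c k \<subseteq> W))"
    by (rule quasi_polish_cover_system) blast
  have bS: "b \<subseteq> S x" if "b \<in> \<B>" for b using fiber_open_subset[OF x sys(3)[OF that]] .
  have "\<exists>W. W \<in> sets BX \<and> W \<inter> ?C = \<tau> ` b" if "b \<in> \<B>" for b
    using component_open_trace_borel[OF x openin_tgt_image[OF x sys(3)[OF that]]] by metis
  then obtain W where W: "\<And>b. b \<in> \<B> \<Longrightarrow> W b \<in> sets BX \<and> W b \<inter> ?C = \<tau> ` b" by metis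
  obtain \<A> where \<A>: "countable \<A>" "\<A> \<subseteq> sets BX"
    "\<And>p q. p \<in> space BX \<Longrightarrow> q \<in> space BX \<Longrightarrow> p \<noteq> q \<Longrightarrow> \<exists>A\<in>\<A>. (p \<in> A) \<noteq> (q \<in> A)"
    using standard_borel_separating[OF standard_borel_obj] by metis
  have lift: "\<exists>E\<in>sigma_sets (space BX) (W ` \<B>). E \<inter> ?C = U" if U: "U \<in> {U. openin (TC x) U}" for U
  proof
    let ?E = "\<Union>(W ` {b \<in> \<B>. \<tau> ` b \<subseteq> U})"
    have "countable (W ` {b \<in> \<B>. \<tau> ` b \<subseteq> U})"
      using sys(1) by (intro countable_image) (rule countable_subset[rotated], assumption, blast)
    moreover have "E \<in> sigma_sets (space BX) (W ` \<B>)" if "E \<in> W ` {b \<in> \<B>. \<tau> ` b \<subseteq> U}" for E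
      using that by (auto intro: sigma_sets.Basic)
    ultimately show "?E \<in> sigma_sets (space BX) (W ` \<B>)" by (rule sigma_sets_UNION)
    have U': "U \<subseteq> ?C" "openin (F x) {g \<in> S x. \<tau> g \<in> U}" using U openin_component_topology[OF x] by auto
    have "U \<subseteq> ?E"
    proof
      fix y assume y: "y \<in> U"
      then obtain g where g: "g \<in> S x" "y = \<tau> g" using U'(1) unfolding component_def by blast
      then obtain b where "b \<in> \<B>" "g \<in> b" "b \<subseteq> {g \<in> S x. \<tau> g \<in> U}" using sys(4)[OF U'(2), of g] y by blast
      then show "y \<in> ?E" using W g(2) by blast
    qed
    moreover have "?E \<inter> ?C \<subseteq> U" using W by blast
    ultimately show "?E \<inter> ?C = U" using U'(1) by blast
  qed
  have "\<exists>E\<in>sigma_sets (space BX) (W ` \<B>). E \<inter> ?C = A \<inter> ?C" if "A \<in> \<A>" for A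
    using sigma_sets_trace_lift[OF borel_trace_component[OF x] component_subset_space lift] \<A>(2) that by blast
  \<comment> \<open>\<open>E A\<close> agrees with \<open>A\<close> on the component but is built
    from the sets \<open>W b\<close> alone, so it cannot tell apart two objects lying in the same
    sets \<open>W b\<close>.\<close>
  then obtain E where E: "\<And>A. A \<in> \<A> \<Longrightarrow> E A \<in> sigma_sets (space BX) (W ` \<B>) \<and> E A \<inter> ?C = A \<inter> ?C" by metis
  have E_borel: "E A \<in> sets BX" if "A \<in> \<A>" for A
    using sets.sigma_sets_subset[of "W ` \<B>" BX] W E[OF that] by blast
  \<comment> \<open>\<open>c1\<close> starts the construction of \<open>p\<close>, \<open>c2\<close>
    lets covering axioms be answered, and \<open>c3\<close> lets the image be driven into every
    \<open>W b1\<close> containing \<open>y\<close>. Conversely \<open>c4\<close> ensures that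
    \<open>y\<close> lies in \<open>W b\<close> whenever \<open>\<tau> p\<close> does. Finally
    \<open>c5\<close> passes from the sets \<open>W b\<close> to sets that separate points.\<close>
  define c1 where "c1 y \<longleftrightarrow> (\<exists>b\<in>\<B>. y \<in> W b)" for y
  define c2 where "c2 y \<longleftrightarrow> (\<forall>r\<in>R. \<forall>b\<in>{b \<in> \<B>. b \<subseteq> fst r}. y \<in> W b \<longrightarrow>
      (\<exists>b'\<in>{b' \<in> \<B>. b' \<subseteq> b \<and> (\<exists>c\<in>snd r. b' \<subseteq> c)}. y \<in> W b'))" for y
  define c3 where "c3 y \<longleftrightarrow> (\<forall>b\<in>\<B>. \<forall>b1\<in>\<B>. y \<in> W b \<and> y \<in> W b1 \<longrightarrow>
      (\<exists>b'\<in>{b' \<in> \<B>. b' \<subseteq> b \<and> \<tau> ` b' \<subseteq> \<tau> ` b1}. y \<in> W b'))" for y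
  define c4 where "c4 y \<longleftrightarrow> (\<forall>b\<in>\<B>. \<forall>b1\<in>{b1 \<in> \<B>. \<tau> ` b \<subseteq> \<tau> ` b1}. y \<in> W b \<longrightarrow> y \<in> W b1)" for y
  define c5 where "c5 y \<longleftrightarrow> (\<forall>A\<in>\<A>. y \<in> A \<longleftrightarrow> y \<in> E A)" for y
  have "?C = {y \<in> space BX. c1 y \<and> c2 y \<and> c3 y \<and> c4 y \<and> c5 y}"
  proof (intro equalityI subsetI)
    fix y assume y: "y \<in> ?C"
    then obtain g where g: "g \<in> S x" "y = \<tau> g" unfolding component_def by blast
    have yW: "y \<in> W b \<longleftrightarrow> y \<in> \<tau> ` b" if "b \<in> \<B>" for b using W[OF that] y by blast
    have base: "\<exists>b'\<in>\<B>. b' \<subseteq> b \<and> b' \<subseteq> V \<and> y \<in> W b'"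
      if bV: "b \<in> \<B>" "openin (F x) V" "h \<in> b" "h \<in> V" "\<tau> h = y" for b V h
    proof -
      have "openin (F x) (b \<inter> V)" using sys(3)[OF bV(1)] bV(2) by (rule openin_Int)
      then obtain b' where "b' \<in> \<B>" "h \<in> b'" "b' \<subseteq> b \<inter> V" using sys(4)[of "b \<inter> V" h] bV(3,4) by blast
      then show ?thesis using yW[of b'] bV(5) by blast
    qed
    have "c1 y"
    proof -
      obtain b where "b \<in> \<B>" "g \<in> b" using sys(4)[OF openin_fiber[OF x] g(1)] by blast
      then show ?thesis unfolding c1_def using yW[of b] g(2) by blast
    qed
    moreover have "c2 y" unfolding c2_def
    proof (intro ballI impI)
      fix r b assume r: "r \<in> R" and b: "b \<in> {b \<in> \<B>. b \<subseteq> fst r}" "y \<in> W b"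
      then obtain h where h: "h \<in> b" "\<tau> h = y" using yW[of b] by blast
      have r': "snd r \<subseteq> \<B> \<and> fst r \<subseteq> \<Union>(snd r)" using sys(5)[of "fst r" "snd r"] r by simp
      then obtain c where c: "c \<in> snd r" "h \<in> c" using h(1) b(1) by blast
      have "openin (F x) c" using sys(3) c(1) r' by blast
      then show "\<exists>b'\<in>{b' \<in> \<B>. b' \<subseteq> b \<and> (\<exists>c\<in>snd r. b' \<subseteq> c)}. y \<in> W b'"
        using base[of b c h] b(1) h c by blast
    qed
    moreover have "c3 y" unfolding c3_def
    proof (intro ballI impI)
      fix b b1 assume b: "b \<in> \<B>" "b1 \<in> \<B>" "y \<in> W b \<and> y \<in> W b1"
      then obtain h where h: "h \<in> b" "\<tau> h = y" using yW[of b] by blast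
      have "openin (F x) {g \<in> S x. \<tau> g \<in> \<tau> ` b1}"
        using openin_tgt_image[OF x sys(3)[OF b(2)]] openin_component_topology[OF x] by blast
      moreover have "h \<in> {g \<in> S x. \<tau> g \<in> \<tau> ` b1}" using h bS[OF b(1)] yW[OF b(2)] b(3) by blast
      ultimately obtain b' where "b' \<in> \<B>" "b' \<subseteq> b" "b' \<subseteq> {g \<in> S x. \<tau> g \<in> \<tau> ` b1}" "y \<in> W b'"
        using base[OF b(1) _ h(1) _ h(2)] by blast
      then show "\<exists>b'\<in>{b' \<in> \<B>. b' \<subseteq> b \<and> \<tau> ` b' \<subseteq> \<tau> ` b1}. y \<in> W b'" by blast
    qed
    moreover have "c4 y" unfolding c4_def using yW by blast
    moreover have "c5 y" unfolding c5_def using E y by blast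
    ultimately show "y \<in> {y \<in> space BX. c1 y \<and> c2 y \<and> c3 y \<and> c4 y \<and> c5 y}"
      using y component_subset_space by blast
  next
    fix y assume "y \<in> {y \<in> space BX. c1 y \<and> c2 y \<and> c3 y \<and> c4 y \<and> c5 y}"
    then have y: "y \<in> space BX" "c1 y" "c2 y" "c3 y" "c4 y" "c5 y" by auto
    obtain b0 where b0: "b0 \<in> \<B>" "y \<in> W b0" using y(2) unfolding c1_def by blast
    define t1 where "t1 r b \<longleftrightarrow> (b \<subseteq> fst r \<longrightarrow> (\<exists>c\<in>snd r. b \<subseteq> c))" for r :: "'g set \<times> 'g set set" and b
    define t2 where "t2 b1 b \<longleftrightarrow> \<tau> ` b \<subseteq> \<tau> ` b1" for b1 b
    let ?\<T> = "t1 ` R \<union> t2 ` {b1 \<in> \<B>. y \<in> W b1}"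
    obtain c :: "nat \<Rightarrow> 'g set" where c: "c 0 = b0" "\<And>k. c k \<in> \<B> \<and> y \<in> W (c k)" "\<And>k. c (Suc k) \<subseteq> c k"
      and fair: "\<And>t m. t \<in> ?\<T> \<Longrightarrow> \<exists>k\<ge>m. t (c k)"
    proof (rule fair_chain[of ?\<T> "\<lambda>b. b \<in> \<B> \<and> y \<in> W b" b0 "(\<subseteq>)" "\<lambda>t. t"])
      show "countable ?\<T>" using sys(1,2) by simp
      show "?\<T> \<noteq> {}" using b0 by blast
      show "b0 \<in> \<B> \<and> y \<in> W b0" using b0 by blast
    next
      fix t b assume t: "t \<in> ?\<T>" and b: "b \<in> \<B> \<and> y \<in> W b"
      from t show "\<exists>b'. (b' \<in> \<B> \<and> y \<in> W b') \<and> b' \<subseteq> b \<and> t b'"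
      proof
        assume "t \<in> t1 ` R"
        then obtain r where r: "r \<in> R" "t = t1 r" by blast
        show ?thesis
        proof (cases "b \<subseteq> fst r")
          case True
          then have "\<exists>b'\<in>{b' \<in> \<B>. b' \<subseteq> b \<and> (\<exists>c\<in>snd r. b' \<subseteq> c)}. y \<in> W b'"
            using y(3) r(1) b unfolding c2_def by simp
          then show ?thesis unfolding r(2) t1_def by blast
        next
          case False
          then show ?thesis unfolding r(2) t1_def using b by (intro exI[of _ b]) simp
        qed
      next
        assume "t \<in> t2 ` {b1 \<in> \<B>. y \<in> W b1}"
        then obtain b1 where b1: "b1 \<in> \<B>" "y \<in> W b1" "t = t2 b1" by blast
        then have "\<exists>b'\<in>{b' \<in> \<B>. b' \<subseteq> b \<and> \<tau> ` b' \<subseteq> \<tau> ` b1}. y \<in> W b'"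
          using y(4) b unfolding c3_def by simp
        then show ?thesis unfolding b1(3) t2_def by blast
      qed
    qed (rule that)
    have mono: "c l \<subseteq> c k" if "k \<le> l" for k l
      using lift_Suc_antimono_le[of c, OF c(3) that] .
    have "\<exists>p\<in>topspace (F x). (\<forall>k. p \<in> c k) \<and> (\<forall>W. openin (F x) W \<and> p \<in> W \<longrightarrow> (\<exists>k. c k \<subseteq> W))"
    proof (rule sys(6))
      fix b \<C> k assume b: "(b, \<C>) \<in> R" "c k \<subseteq> b"
      then have "t1 (b, \<C>) \<in> ?\<T>" by blast
      from fair[OF this, of k] obtain l where l: "l \<ge> k" "t1 (b, \<C>) (c l)" by blast
      then show "\<exists>l. \<exists>b'\<in>\<C>. c l \<subseteq> b'" using mono[OF l(1)] b(2) unfolding t1_def by auto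
    qed (use c in auto)
    then obtain p where p: "p \<in> S x" "\<forall>k. p \<in> c k" "\<forall>W. openin (F x) W \<and> p \<in> W \<longrightarrow> (\<exists>k. c k \<subseteq> W)"
      unfolding topspace_fiber[OF x] by (elim bexE conjE)
    have pC: "\<tau> p \<in> ?C" unfolding component_def using p(1) by blast
    have same: "y \<in> W b \<longleftrightarrow> \<tau> p \<in> W b" if b: "b \<in> \<B>" for b
    proof
      assume "y \<in> W b"
      then have "t2 b \<in> ?\<T>" using b by blast
      from fair[OF this, of 0] obtain k where "t2 b (c k)" by blast
      then show "\<tau> p \<in> W b" using p(2) W[OF b] unfolding t2_def by blast
    next
      assume "\<tau> p \<in> W b"
      then have tp: "\<tau> p \<in> \<tau> ` b" using W[OF b] pC by blast
      have "openin (F x) {g \<in> S x. \<tau> g \<in> \<tau> ` b}"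
        using openin_tgt_image[OF x sys(3)[OF b]] openin_component_topology[OF x] by blast
      then obtain k where "c k \<subseteq> {g \<in> S x. \<tau> g \<in> \<tau> ` b}" using p(1,3) tp by blast
      then have "\<tau> ` c k \<subseteq> \<tau> ` b" by blast
      then show "y \<in> W b" using y(5) c(2)[of k] b unfolding c4_def by blast
    qed
    have "y = \<tau> p"
    proof (rule ccontr)
      have ps: "\<tau> p \<in> space BX" using pC component_subset_space by blast
      assume "y \<noteq> \<tau> p"
      then obtain A where A: "A \<in> \<A>" "(y \<in> A) \<noteq> (\<tau> p \<in> A)" using \<A>(3)[OF y(1) ps] by blast
      have "y \<in> A \<longleftrightarrow> y \<in> E A" using y(6) A(1) unfolding c5_def by blast
      also have "\<dots> \<longleftrightarrow> \<tau> p \<in> E A"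
        using sigma_sets_same_atom[OF conjunct1[OF E[OF A(1)]] y(1) ps] same by blast
      also have "\<dots> \<longleftrightarrow> \<tau> p \<in> A" using E[OF A(1)] pC by blast
      finally show False using A(2) by blast
    qed
    then show "y \<in> ?C" using pC by simp
  qed
  also have "\<dots> \<in> sets BX"
  proof -
    have W': "{y \<in> space BX. y \<in> W b} \<in> sets BX" if "b \<in> \<B>" for b
      using W[OF that] sets.sets_into_space[of "W b" BX] by (simp add: Collect_conj_eq Int_absorb1)
    have A': "{y \<in> space BX. y \<in> A} \<in> sets BX" if "A \<in> sets BX" for A
      using that sets.sets_into_space[OF that] by (simp add: Collect_conj_eq Int_absorb1)
    have cnt: "countable {b \<in> \<B>. Q b}" for Q using sys(1) by (rule countable_subset[rotated]) blast
    note collect = sets.sets_Collect_countable_All' sets.sets_Collect_countable_Ex'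
      sets.sets_Collect_conj sets.sets_Collect_imp
    have "{y \<in> space BX. c1 y} \<in> sets BX" unfolding c1_def by (intro collect sys(1) W')
    moreover have "{y \<in> space BX. c2 y} \<in> sets BX" unfolding c2_def by (intro collect sys(2) cnt W') auto
    moreover have "{y \<in> space BX. c3 y} \<in> sets BX" unfolding c3_def by (intro collect sys(1) cnt W') auto
    moreover have "{y \<in> space BX. c4 y} \<in> sets BX" unfolding c4_def by (intro collect sys(1) cnt W') auto
    moreover have "{y \<in> space BX. c5 y} \<in> sets BX"
      unfolding c5_def iff_conv_conj_imp by (intro collect \<A>(1) A' E_borel) (use \<A>(2) in auto)
    ultimately show ?thesis by (intro sets.sets_Collect_conj)
  qed
  finally show ?thesis .
qed

lemma arr_over_component_borel:
  assumes x: "x \<in> obj \<G>" shows "arr_over (component \<G> x) \<in> sets BG"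
proof -
  have "\<sigma> -` component \<G> x \<inter> space BG \<in> sets BG"
    using borel_src component_borel[OF x] by (rule measurable_sets)
  moreover have "\<sigma> -` component \<G> x \<inter> space BG = arr_over (component \<G> x)" unfolding space_arr by auto
  ultimately show ?thesis by simp
qed

lemma quotient_preimage_borel:
  assumes x: "x \<in> obj \<G>" and A: "A \<in> sets BG"
  shows "{p \<in> S x \<times> S x. fst p \<cdot> iv (snd p) \<in> A} \<in> sets (BG \<Otimes>\<^sub>M BG)"
proof -
  let ?N = "restrict_space (BG \<Otimes>\<^sub>M BG) (S x \<times> S x)" and ?f = "\<lambda>p. (fst p, iv (snd p))"
  have SS: "S x \<times> S x \<in> sets (BG \<Otimes>\<^sub>M BG)" using src_fiber_borel[OF x] by (intro pair_measureI)
  have sp: "space ?N = S x \<times> S x"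
    by (auto simp: space_restrict_space space_pair_measure space_arr)
  have "?f \<in> measurable (BG \<Otimes>\<^sub>M BG) (BG \<Otimes>\<^sub>M BG)"
    using borel_ivs by (intro measurable_Pair measurable_fst measurable_compose[OF measurable_snd])
  then have "?f \<in> measurable ?N (BG \<Otimes>\<^sub>M BG)" by (rule measurable_restrict_space1)
  moreover have "?f \<in> space ?N \<rightarrow> composable \<G>" unfolding sp by auto
  ultimately have "?f \<in> measurable ?N (restrict_space (BG \<Otimes>\<^sub>M BG) (composable \<G>))"
    by (intro measurable_restrict_space2)
  from measurable_compose[OF this borel_mul]
  have f: "(\<lambda>p. fst p \<cdot> iv (snd p)) \<in> measurable ?N BG" by simp
  have "(\<lambda>p. fst p \<cdot> iv (snd p)) -` A \<inter> space ?N \<in> sets ?N" using f A by (rule measurable_sets)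
  moreover have "(\<lambda>p. fst p \<cdot> iv (snd p)) -` A \<inter> space ?N = {p \<in> S x \<times> S x. fst p \<cdot> iv (snd p) \<in> A}"
    unfolding sp by blast
  ultimately have *: "{p \<in> S x \<times> S x. fst p \<cdot> iv (snd p) \<in> A} \<in> sets ?N" by simp
  have "S x \<times> S x \<inter> space (BG \<Otimes>\<^sub>M BG) \<in> sets (BG \<Otimes>\<^sub>M BG)" using SS sets.Int_space_eq2[OF SS] by argo
  from iffD1[OF sets_restrict_space_iff[OF this] *] show ?thesis by (rule conjunct2)
qed

text \<open>The preimage of \<open>U\<close> under division is a countable union of boxes, and Lusin
  separation on the product makes \<open>U\<close> the trace of a Borel set on the image. The image
  consists of all arrows over the component, a Borel set by \<open>component_borel\<close>.\<close>

lemma arr_open_borel: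
  assumes x: "x \<in> obj \<G>" and U: "openin (TG x) U" shows "U \<in> sets BG"
proof -
  let ?C = "component \<G> x"
  obtain \<B> where \<B>: "countable \<B>" "\<And>b. b \<in> \<B> \<Longrightarrow> openin (F x) b"
    "\<And>W p. openin (F x) W \<Longrightarrow> p \<in> W \<Longrightarrow> \<exists>b\<in>\<B>. p \<in> b \<and> b \<subseteq> W"
    using fiber_base[OF x] by metis
  obtain \<A> where \<A>: "countable \<A>" "\<A> \<subseteq> sets BG"
    "\<And>p q. p \<in> space BG \<Longrightarrow> q \<in> space BG \<Longrightarrow> p \<noteq> q \<Longrightarrow> \<exists>A\<in>\<A>. (p \<in> A) \<noteq> (q \<in> A)"
    using standard_borel_separating[OF standard_borel_arr] by metis
  let ?q = "\<lambda>p. fst p \<cdot> iv (snd p)"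
  define P where "P = {p \<in> S x \<times> S x. ?q p \<in> U}"
  have UC: "U \<subseteq> arr_over ?C" using openin_subset[OF U] topspace_TG[OF x] by simp
  have P_eq: "P = (\<Union>(b, b')\<in>{(b, b'). b \<in> \<B> \<and> b' \<in> \<B> \<and> quotients b b' \<subseteq> U}. b \<times> b')"
  proof
    show "P \<subseteq> (\<Union>(b, b')\<in>{(b, b'). b \<in> \<B> \<and> b' \<in> \<B> \<and> quotients b b' \<subseteq> U}. b \<times> b')"
    proof
      fix p assume "p \<in> P"
      then obtain g k where gk: "p = (g, k)" "g \<in> S x" "k \<in> S x" "g \<cdot> iv k \<in> U" unfolding P_def by auto
      obtain V W where VW: "openin (F x) V" "g \<in> V" "openin (F x) W" "k \<in> W"
        "\<And>g' k'. g' \<in> V \<Longrightarrow> k' \<in> W \<Longrightarrow> g' \<cdot> iv k' \<in> U"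
        using openin_TG[OF x U gk(2-4)] by metis
      obtain b where b: "b \<in> \<B>" "g \<in> b" "b \<subseteq> V" using \<B>(3)[OF VW(1,2)] by blast
      obtain b' where b': "b' \<in> \<B>" "k \<in> b'" "b' \<subseteq> W" using \<B>(3)[OF VW(3,4)] by blast
      have "quotients b b' \<subseteq> U" unfolding quotients_def using VW(5) b(3) b'(3) by blast
      then show "p \<in> (\<Union>(b, b')\<in>{(b, b'). b \<in> \<B> \<and> b' \<in> \<B> \<and> quotients b b' \<subseteq> U}. b \<times> b')"
        unfolding gk(1) using b b' by blast
    qed
    show "(\<Union>(b, b')\<in>{(b, b'). b \<in> \<B> \<and> b' \<in> \<B> \<and> quotients b b' \<subseteq> U}. b \<times> b') \<subseteq> P"
    proof clarify
      fix b b' g k assume bb: "b \<in> \<B>" "b' \<in> \<B>" "quotients b b' \<subseteq> U" "g \<in> b" "k \<in> b'"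
      then have "g \<in> S x" "k \<in> S x" using fiber_open_subset[OF x \<B>(2)] by blast+
      then show "(g, k) \<in> P" unfolding P_def using bb(3) quotientsI[OF bb(4,5)] by auto
    qed
  qed
  have "{(b, b'). b \<in> \<B> \<and> b' \<in> \<B> \<and> quotients b b' \<subseteq> U} \<subseteq> \<B> \<times> \<B>" by blast
  then have "countable {(b, b'). b \<in> \<B> \<and> b' \<in> \<B> \<and> quotients b b' \<subseteq> U}"
    by (rule countable_subset) (simp add: \<B>(1))
  moreover have "b \<times> b' \<in> sets (BG \<Otimes>\<^sub>M BG)" if "b \<in> \<B>" "b' \<in> \<B>" for b b'
    by (intro pair_measureI fiber_open_borel[OF x] \<B>(2) that)
  ultimately have P: "P \<in> sets (BG \<Otimes>\<^sub>M BG)" unfolding P_eq by (intro sets.countable_UN'') auto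
  have SS: "S x \<times> S x \<in> sets (BG \<Otimes>\<^sub>M BG)" using src_fiber_borel[OF x] by (intro pair_measureI)
  have img: "?q ` (S x \<times> S x) = arr_over ?C"
  proof
    show "?q ` (S x \<times> S x) \<subseteq> arr_over ?C"
    proof (rule image_subsetI)
      fix p assume "p \<in> S x \<times> S x"
      then have "fst p \<in> S x" "snd p \<in> S x" by (simp_all add: mem_Times_iff)
      then show "?q p \<in> arr_over ?C" by (rule quotient_arrow(1))
    qed
    show "arr_over ?C \<subseteq> ?q ` (S x \<times> S x)"
    proof
      fix u assume "u \<in> arr_over ?C"
      then obtain g k where "g \<in> S x" "k \<in> S x" "u = g \<cdot> iv k" by (rule arr_over_quotient)
      then show "u \<in> ?q ` (S x \<times> S x)" by (intro image_eqI[of _ _ "(g, k)"]) simp_all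
    qed
  qed
  have sub: "?q ` (S x \<times> S x) \<subseteq> space BG" unfolding img space_arr by blast
  obtain B where B: "B \<in> sets BG" "B \<inter> ?q ` (S x \<times> S x) = U \<inter> ?q ` (S x \<times> S x)"
  proof (rule standard_borel_saturated_image[OF standard_borel_pair[OF standard_borel_arr standard_borel_arr]
        sets.sigma_algebra_axioms SS sub \<A>(1,2) _ _ P[unfolded P_def]])
    show "{p \<in> S x \<times> S x. ?q p \<in> A} \<in> sets (BG \<Otimes>\<^sub>M BG)" if "A \<in> \<A>" for A
      using quotient_preimage_borel[OF x] \<A>(2) that by blast
    show "\<exists>A\<in>\<A>. (?q p \<in> A) \<noteq> (?q r \<in> A)" if "p \<in> S x \<times> S x" "r \<in> S x \<times> S x" "?q p \<noteq> ?q r" for p r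
    proof -
      have "?q p \<in> space BG" "?q r \<in> space BG" using that(1,2) sub by blast+
      then show ?thesis using \<A>(3) that(3) by metis
    qed
  qed
  have "U = B \<inter> arr_over ?C" using B(2) UC unfolding img by blast
  then show ?thesis using B(1) arr_over_component_borel[OF x] by simp
qed

lemma compatible_component_topologies_existence:
  assumes x: "x \<in> obj \<G>"
  shows "compatible_component_topologies \<G> BX BG F (component \<G> x) (TC x) (TG x)"
  unfolding compatible_component_topologies_def
proof (intro conjI ballI)
  show "{U. openin (TG x) U} \<subseteq> sets BG" using arr_open_borel[OF x] by blast
  show "subtopology (TG x) (S y) = F y" if "y \<in> component \<G> x" for y by (rule subtopology_TG[OF x that])
qed (fact second_countable_component[OF x] second_countable_TG[OF x] sigma_component_topology[OF x]
  open_topological_groupoid_component[OF x] component_nonmeager[OF x])+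

subsection \<open>Uniqueness\<close>

lemma compatible_component_topologies_unique:
  assumes x: "x \<in> obj \<G>" and compat: "compatible_component_topologies \<G> BX BG F (component \<G> x) Q H"
  shows "Q = TC x \<and> H = TG x"
proof -
  let ?C = "component \<G> x"
  have C: "?C \<subseteq> obj \<G>" by (rule component_subset)
  interpret OT: open_topological_groupoid "restrict_groupoid \<G> ?C" Q H
    using compat unfolding compatible_component_topologies_def by blast
  have H2: "second_countable H" and sub: "\<And>z. z \<in> ?C \<Longrightarrow> subtopology H (S z) = F z"
    and gen: "sigma_sets ?C {U. openin Q U} = sets (restrict_space BX ?C)" and nm: "\<not> meager_in Q ?C"
    using compat unfolding compatible_component_topologies_def by blast+
  have sel: "obj (restrict_groupoid \<G> ?C) = ?C" "arr (restrict_groupoid \<G> ?C) = arr_over ?C"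
    "src (restrict_groupoid \<G> ?C) = \<sigma>" "tgt (restrict_groupoid \<G> ?C) = \<tau>"
    "ivs (restrict_groupoid \<G> ?C) = iv" "mul (restrict_groupoid \<G> ?C) = mul \<G>"
    unfolding restrict_groupoid_def by simp_all
  note topQ = OT.topspace_obj[unfolded sel] and topH = OT.topspace_arr[unfolded sel]
  have pre_src: "openin H {u \<in> arr_over ?C. \<sigma> u \<in> W}" if "openin Q W" for W
    using openin_continuous_map_preimage[OF OT.continuous_src[unfolded sel] that] unfolding topH .
  have pre_tgt: "openin H {u \<in> arr_over ?C. \<tau> u \<in> W}" if "openin Q W" for W
    using openin_continuous_map_preimage[OF OT.continuous_tgt[unfolded sel] that] unfolding topH .
  have pre_iv: "openin H {u \<in> arr_over ?C. iv u \<in> W}" if "openin H W" for W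
    using openin_continuous_map_preimage[OF OT.continuous_ivs[unfolded sel] that] unfolding topH .
  have open_src: "openin Q (\<sigma> ` U)" if "openin H U" for U
    using OT.open_src[unfolded sel] that unfolding open_map_def by blast
  have H_sub: "U \<subseteq> arr_over ?C" if "openin H U" for U using openin_subset[OF that] unfolding topH .
  have tC: "\<tau> u \<in> ?C" if "u \<in> arr_over ?C" for u using that component_closed(1)[of "\<sigma> u" x u] by simp
  have S_sub: "S z \<subseteq> arr_over ?C" if "z \<in> ?C" for z using that by auto
  have toF: "openin (F z) (U \<inter> S z)" if "openin H U" "z \<in> ?C" for U z
    using that(1) unfolding sub[OF that(2), symmetric] openin_subtopology by blast
  have fromF: "\<exists>U. openin H U \<and> V = U \<inter> S z" if "openin (F z) V" "z \<in> ?C" for V z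
    using that(1) unfolding sub[OF that(2), symmetric] openin_subtopology .
  have mul_nhd_H: "\<exists>M N. openin H M \<and> openin H N \<and> u \<in> M \<and> v \<in> N \<and>
      (\<forall>u'\<in>M. \<forall>v'\<in>N. \<sigma> u' = \<tau> v' \<longrightarrow> u' \<cdot> v' \<in> U)"
    if U: "openin H U" and uv: "u \<in> arr_over ?C" "v \<in> arr_over ?C" "\<sigma> u = \<tau> v" "u \<cdot> v \<in> U" for U u v
  proof -
    let ?K = "composable (restrict_groupoid \<G> ?C)"
    let ?P = "subtopology (prod_topology H H) ?K"
    have K: "?K = {(g, h). g \<in> arr_over ?C \<and> h \<in> arr_over ?C \<and> \<sigma> g = \<tau> h}"
      unfolding composable_def sel ..
    have "openin ?P {p \<in> topspace ?P. (\<lambda>(g, h). g \<cdot> h) p \<in> U}"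
      using OT.continuous_mul[unfolded sel] U by (rule openin_continuous_map_preimage)
    then obtain O' where O': "openin (prod_topology H H) O'" "{p \<in> topspace ?P. (\<lambda>(g, h). g \<cdot> h) p \<in> U} = O' \<inter> ?K"
      unfolding openin_subtopology by blast
    have tp: "topspace ?P = ?K" unfolding K using topH by auto
    have "(u, v) \<in> O' \<inter> ?K" unfolding O'(2)[symmetric] tp using uv unfolding K by simp
    then obtain M N where MN: "openin H M" "openin H N" "u \<in> M" "v \<in> N" "M \<times> N \<subseteq> O'"
      using O'(1) unfolding openin_prod_topology_alt by (metis IntD1)
    have "u' \<cdot> v' \<in> U" if uv': "u' \<in> M" "v' \<in> N" "\<sigma> u' = \<tau> v'" for u' v'
    proof -
      have "(u', v') \<in> O' \<inter> ?K" using uv' MN(5) H_sub[OF MN(1)] H_sub[OF MN(2)] unfolding K by blast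
      then show ?thesis unfolding O'(2)[symmetric] by simp
    qed
    then show ?thesis using MN(1-4) by blast
  qed
  have Q_coarse: "openin (TC x) W" if W: "openin Q W" for W
    unfolding openin_component_topology[OF x]
  proof
    show "W \<subseteq> ?C" using openin_subset[OF W] unfolding topQ .
    have "openin (F x) ({u \<in> arr_over ?C. \<tau> u \<in> W} \<inter> S x)"
      by (rule toF[OF pre_tgt[OF W] component_refl[OF x]])
    moreover have "{u \<in> arr_over ?C. \<tau> u \<in> W} \<inter> S x = {g \<in> S x. \<tau> g \<in> W}"
      using component_refl[OF x] by auto
    ultimately show "openin (F x) {g \<in> S x. \<tau> g \<in> W}" by simp
  qed
  have fiber_pre: "openin (F c) {g \<in> S c. \<tau> g \<in> W}" if "openin (TC x) W" "c \<in> ?C" for W c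
  proof -
    have "c \<in> obj \<G>" using that(2) C by blast
    then show ?thesis
      using openin_component_topology[of c W] that(1) component_topology_eq[OF x that(2)] by simp
  qed
  text \<open>A Kuratowski--Ulam argument along \<open>\<sigma>\<close> yields one good object \<open>c0\<close>, and right translations
    carry its fiber to all others.\<close>
  have dense: "open_dense_on (F c) (S c) {g \<in> S c. \<tau> g \<in> D}"
    if D: "open_dense_on Q ?C D" and c: "c \<in> ?C" for D c
  proof -
    have Dop: "openin Q D" using D unfolding open_dense_on_def by blast
    obtain \<N> where \<N>: "countable \<N>" "\<And>V. V \<in> \<N> \<Longrightarrow> openin H V"
      "\<And>U u. openin H U \<Longrightarrow> u \<in> U \<Longrightarrow> \<exists>V\<in>\<N>. u \<in> V \<and> V \<subseteq> U"
      using H2 unfolding second_countable_def by auto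
    \<comment> \<open>The objects at which some arrow of \<open>N\<close> leads into
      \<open>D\<close>, completed to a dense set by the objects away from all sources of
      \<open>N\<close>. At an object in every \<open>E N\<close>, each basic \<open>N\<close>
      meeting its fiber contains an arrow into \<open>D\<close>.\<close>
    define E where "E N = \<sigma> ` (N \<inter> {u \<in> arr_over ?C. \<tau> u \<in> D}) \<union> \<Union>{W. openin Q W \<and> W \<inter> \<sigma> ` N = {}}" for N
    have E: "\<forall>U\<in>E ` \<N>. open_dense_on Q (topspace Q) U"
    proof
      fix U assume "U \<in> E ` \<N>"
      then obtain N where N: "N \<in> \<N>" "U = E N" by blast
      have Nop: "openin H N" by (rule \<N>(2)[OF N(1)])
      show "open_dense_on Q (topspace Q) U"
        unfolding open_dense_on_def N(2)
      proof (intro conjI allI impI; (elim conjE)?)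
        have "openin Q (\<sigma> ` (N \<inter> {u \<in> arr_over ?C. \<tau> u \<in> D}))"
          by (intro open_src openin_Int Nop pre_tgt Dop)
        moreover have "openin Q (\<Union>{W. openin Q W \<and> W \<inter> \<sigma> ` N = {}})" by (rule openin_Union) blast
        ultimately show "openin Q (E N)" unfolding E_def by (rule openin_Un)
        fix W assume W: "openin Q W" "W \<inter> topspace Q \<noteq> {}"
        show "W \<inter> E N \<inter> topspace Q \<noteq> {}"
        proof (cases "W \<inter> \<sigma> ` N = {}")
          case True
          then have "W \<subseteq> E N" unfolding E_def using W(1) by blast
          then show ?thesis using W(2) by blast
        next
          case False
          \<comment> \<open>Inverting the arrows of \<open>N\<close> that start in \<open>W\<close>
            turns their targets into sources. Openness of \<open>\<sigma>\<close> then makes these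
            targets an open set, which \<open>D\<close> must meet.\<close>
          let ?M = "N \<inter> {u \<in> arr_over ?C. \<sigma> u \<in> W}"
          let ?M' = "{u \<in> arr_over ?C. iv u \<in> ?M}"
          have M': "openin H ?M'" by (intro pre_iv openin_Int Nop pre_src W(1))
          obtain u where u: "u \<in> N" "\<sigma> u \<in> W" using False by blast
          have uA: "u \<in> arr \<G>" "\<sigma> u \<in> ?C" using H_sub[OF Nop] u(1) by auto
          have "iv u \<in> ?M'" using u uA tC[of u] by simp
          then have "\<sigma> (iv u) \<in> \<sigma> ` ?M'" by blast
          moreover have "\<sigma> ` ?M' \<subseteq> ?C" by blast
          ultimately have "\<sigma> ` ?M' \<inter> ?C \<noteq> {}" by blast
          then have "\<sigma> ` ?M' \<inter> D \<inter> ?C \<noteq> {}" using D open_src[OF M'] unfolding open_dense_on_def by blast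
          then obtain v where v: "v \<in> ?M'" "\<sigma> v \<in> D" by blast
          have v': "v \<in> arr \<G>" "iv v \<in> N" "iv v \<in> arr_over ?C" "\<sigma> (iv v) \<in> W" using v(1) by auto
          have "iv v \<in> N \<inter> {u \<in> arr_over ?C. \<tau> u \<in> D}" using v' v(2) by simp
          then have "\<sigma> (iv v) \<in> E N" unfolding E_def by blast
          moreover have "\<sigma> (iv v) \<in> topspace Q" unfolding topQ using v'(3) by blast
          ultimately show ?thesis using v'(4) by blast
        qed
      qed
    qed
    have cnt: "countable (E ` \<N>)" using \<N>(1) by simp
    obtain c0 where c0: "c0 \<in> topspace Q" "\<forall>U\<in>E ` \<N>. c0 \<in> U"
      using nonmeager_dense_Inter[OF nm[folded topQ] cnt E] by (elim bexE)
    have c0C: "c0 \<in> ?C" using c0(1) unfolding topQ .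
    have good: "\<exists>h\<in>W. \<tau> h \<in> D" if W: "openin (F c0) W" "g \<in> W" for W g
    proof -
      obtain U where U: "openin H U" "W = U \<inter> S c0" using fromF[OF W(1) c0C] by blast
      obtain N where N: "N \<in> \<N>" "g \<in> N" "N \<subseteq> U" using \<N>(3)[OF U(1), of g] W(2) U(2) by blast
      have "c0 \<in> \<sigma> ` N" using N(2) W(2) U(2) by force
      moreover have "c0 \<in> E N" using c0(2) N(1) by blast
      ultimately have "c0 \<in> \<sigma> ` (N \<inter> {u \<in> arr_over ?C. \<tau> u \<in> D})" unfolding E_def by blast
      then obtain h where h: "h \<in> N" "h \<in> arr_over ?C" "\<tau> h \<in> D" "c0 = \<sigma> h" by blast
      then have "h \<in> W" unfolding U(2) using N(3) by auto
      then show ?thesis using h(3) by blast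
    qed
    obtain a where a: "a \<in> arr \<G>" "\<sigma> a = c" "\<tau> a = c0" by (rule component_arrow[OF c c0C])
    have co: "c \<in> obj \<G>" using c C by blast
    show ?thesis
      unfolding open_dense_on_def
    proof (intro conjI allI impI; (elim conjE)?)
      show "openin (F c) {g \<in> S c. \<tau> g \<in> D}" by (rule fiber_pre[OF Q_coarse[OF Dop] c])
      fix W assume W: "openin (F c) W" "W \<inter> S c \<noteq> {}"
      obtain g where g: "g \<in> W" "g \<in> S c" using W(2) by blast
      have "openin (F c0) {h \<in> S c0. h \<cdot> a \<in> W}" using right_translate_preimage[OF a(1), of W] W(1) unfolding a by blast
      moreover have "g \<cdot> iv a \<in> {h \<in> S c0. h \<cdot> a \<in> W}" using g a by simp
      ultimately obtain h where h: "h \<in> {h \<in> S c0. h \<cdot> a \<in> W}" "\<tau> h \<in> D" using good by blast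
      then have "h \<cdot> a \<in> W \<inter> {g \<in> S c. \<tau> g \<in> D} \<inter> S c" using a by simp
      then show "W \<inter> {g \<in> S c. \<tau> g \<in> D} \<inter> S c \<noteq> {}" by blast
    qed
  qed
  \<comment> \<open>An arrow of \<open>N\<close> from \<open>c\<close> into \<open>X\<close> can be
    replaced by a generic one, since \<open>N\<close> and the preimage of \<open>X\<close> are open
    in the fiber of \<open>c\<close>. Its target avoids the exceptional points and so lies in
    \<open>Y\<close>.\<close>
  have transfer: "\<sigma> ` (N \<inter> {u \<in> arr_over ?C. \<tau> u \<in> X}) \<subseteq> \<sigma> ` (N \<inter> {u \<in> arr_over ?C. \<tau> u \<in> Y})"
    if N: "openin H N" and X: "openin (TC x) X" and \<D>: "countable \<D>" "\<forall>D\<in>\<D>. open_dense_on Q ?C D"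
      and XY: "\<forall>p\<in>?C. (\<forall>D\<in>\<D>. p \<in> D) \<longrightarrow> p \<in> X \<longrightarrow> p \<in> Y" for N X Y \<D>
  proof
    fix c assume "c \<in> \<sigma> ` (N \<inter> {u \<in> arr_over ?C. \<tau> u \<in> X})"
    then obtain u where u: "u \<in> N" "u \<in> arr_over ?C" "\<tau> u \<in> X" "c = \<sigma> u" by blast
    have c: "c \<in> ?C" "c \<in> obj \<G>" using u(2,4) C by auto
    let ?W = "N \<inter> S c \<inter> {g \<in> S c. \<tau> g \<in> X}"
    let ?\<E> = "(\<lambda>D. {g \<in> S c. \<tau> g \<in> D}) ` \<D>"
    have W: "openin (F c) ?W" by (intro openin_Int toF[OF N c(1)] fiber_pre[OF X c(1)])
    have "u \<in> ?W \<inter> S c" using u by simp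
    then have ne: "?W \<inter> S c \<noteq> {}" by blast
    have cnt: "countable ?\<E>" using \<D>(1) by simp
    have dns: "\<forall>D\<in>?\<E>. open_dense_on (F c) (S c) D" using dense[OF _ c(1)] \<D>(2) by blast
    obtain p where p: "p \<in> ?W \<inter> S c" "\<forall>D\<in>?\<E>. p \<in> D"
      using quasi_polish_baire[OF quasi_polish_fiber[OF c(2)]
          pi02_in_topspace[of "F c", unfolded topspace_fiber[OF c(2)]] cnt dns W ne] by (elim bexE)
    have pA: "p \<in> arr_over ?C" "\<sigma> p = c" "p \<in> N" "\<tau> p \<in> X" using p(1) c(1) by auto
    have "\<forall>D\<in>\<D>. \<tau> p \<in> D" using p(2) by simp
    then have "\<tau> p \<in> Y" using XY tC[OF pA(1)] pA(4) by blast
    then show "c \<in> \<sigma> ` (N \<inter> {u \<in> arr_over ?C. \<tau> u \<in> Y})" using pA by blast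
  qed
  have saturation: "openin Q (\<sigma> ` (N \<inter> {u \<in> arr_over ?C. \<tau> u \<in> W}))"
    if N: "openin H N" and W: "openin (TC x) W" for N W
  proof -
    \<comment> \<open>The Baire property is taken with respect to the unknown topology
      \<open>Q\<close>. It applies because \<open>W\<close> is Borel in the component and
      \<open>Q\<close> generates these Borel sets.\<close>
    have "W \<in> sigma_sets (topspace Q) {U. openin Q U}"
      unfolding topQ gen using sigma_component_topology(1)[OF x] W by blast
    from baire_property[OF this, of ?C] obtain A \<D> where A: "openin Q A" "countable \<D>"
      "\<forall>D\<in>\<D>. open_dense_on Q ?C D" "\<forall>p\<in>?C. (\<forall>D\<in>\<D>. p \<in> D) \<longrightarrow> (p \<in> W \<longleftrightarrow> p \<in> A)"
      unfolding topQ by (elim exE conjE meta_impE) simp_all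
    have "\<sigma> ` (N \<inter> {u \<in> arr_over ?C. \<tau> u \<in> W}) = \<sigma> ` (N \<inter> {u \<in> arr_over ?C. \<tau> u \<in> A})"
      by (intro equalityI transfer[OF N W A(2,3)] transfer[OF N Q_coarse[OF A(1)] A(2,3)]) (use A(4) in blast)+
    moreover have "openin Q (\<sigma> ` (N \<inter> {u \<in> arr_over ?C. \<tau> u \<in> A}))"
      by (intro open_src openin_Int N pre_tgt A(1))
    ultimately show ?thesis by simp
  qed
  have Q_fine: "openin Q W" if W: "openin (TC x) W" for W
  proof (subst openin_subopen, intro ballI)
    fix y assume y: "y \<in> W"
    have yC: "y \<in> ?C" using y W openin_component_topology[OF x] by blast
    have yo: "y \<in> obj \<G>" using yC C by blast
    obtain N where N: "openin H N" "{g \<in> S y. \<tau> g \<in> W} = N \<inter> S y" using fromF[OF fiber_pre[OF W yC] yC] by blast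
    have iN: "idt \<G> y \<in> N \<inter> S y" unfolding N(2)[symmetric] using yo y by simp
    have iA: "idt \<G> y \<in> arr_over ?C" "\<sigma> (idt \<G> y) = \<tau> (idt \<G> y)" "idt \<G> y \<cdot> idt \<G> y \<in> N"
      using yo yC iN by simp_all
    obtain N1 N2 where N12: "openin H N1" "openin H N2" "idt \<G> y \<in> N1" "idt \<G> y \<in> N2"
      "\<forall>u'\<in>N1. \<forall>v'\<in>N2. \<sigma> u' = \<tau> v' \<longrightarrow> u' \<cdot> v' \<in> N"
      using mul_nhd_H[OF N(1) iA(1,1,2,3)] by (elim exE conjE)
    \<comment> \<open>For \<open>c \<in> ?Z\<close> there are \<open>u\<close> out of
      \<open>c\<close> and \<open>k \<in> N2\<close> out of \<open>y\<close> with the same target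
      and \<open>iv u \<in> N1\<close>. Then \<open>iv u \<cdot> k\<close> is an arrow of
      \<open>N\<close> from \<open>y\<close> to \<open>c\<close>, which forces
      \<open>c \<in> W\<close>.\<close>
    let ?W' = "\<tau> ` (N2 \<inter> S y)" and ?N = "{u \<in> arr_over ?C. iv u \<in> N1}"
    let ?Z = "\<sigma> ` (?N \<inter> {u \<in> arr_over ?C. \<tau> u \<in> ?W'})"
    have "openin (TC y) ?W'" by (rule openin_tgt_image[OF yo toF[OF N12(2) yC]])
    then have W': "openin (TC x) ?W'" unfolding component_topology_eq[OF x yC] .
    have "openin Q ?Z" by (rule saturation[OF pre_iv[OF N12(1)] W'])
    moreover have "y \<in> ?Z"
    proof (rule image_eqI)
      show "y = \<sigma> (idt \<G> y)" using yo by simp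
      have "idt \<G> y \<in> N2 \<inter> S y" using N12(4) yo by simp
      then have "\<tau> (idt \<G> y) \<in> ?W'" by blast
      then show "idt \<G> y \<in> ?N \<inter> {u \<in> arr_over ?C. \<tau> u \<in> ?W'}" using N12(3) iA(1) yo by simp
    qed
    moreover have "?Z \<subseteq> W"
    proof
      fix c assume "c \<in> ?Z"
      then obtain u k where u: "u \<in> arr \<G>" "iv u \<in> N1" "c = \<sigma> u" and k: "k \<in> N2" "k \<in> S y" "\<tau> u = \<tau> k" by auto
      have "iv u \<cdot> k \<in> N" using N12(5) u k by simp
      then have "iv u \<cdot> k \<in> N \<inter> S y" using u k by simp
      then have "\<tau> (iv u \<cdot> k) \<in> W" unfolding N(2)[symmetric] by blast
      then show "c \<in> W" using u k by simp
    qed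
    ultimately show "\<exists>Z. openin Q Z \<and> y \<in> Z \<and> Z \<subseteq> W" by (intro exI[of _ ?Z] conjI)
  qed
  have Q_eq: "Q = TC x" unfolding topology_eq using Q_coarse Q_fine by blast
  have H_coarse: "openin (TG x) U" if U: "openin H U" for U
  proof (rule openin_TGI[OF x H_sub[OF U]])
    fix g k assume gk: "g \<in> S x" "k \<in> S x" "g \<cdot> iv k \<in> U"
    have A: "g \<in> arr_over ?C" "iv k \<in> arr_over ?C" "\<sigma> g = \<tau> (iv k)"
      using gk component_refl[OF x] tC[of k] by simp_all
    obtain M N where MN: "openin H M" "openin H N" "g \<in> M" "iv k \<in> N"
      "\<forall>u'\<in>M. \<forall>v'\<in>N. \<sigma> u' = \<tau> v' \<longrightarrow> u' \<cdot> v' \<in> U"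
      using mul_nhd_H[OF U A gk(3)] by (elim exE conjE)
    let ?V = "M \<inter> S x" and ?W = "{u \<in> arr_over ?C. iv u \<in> N} \<inter> S x"
    have "openin (F x) ?V" "openin (F x) ?W"
      using toF[OF MN(1) component_refl[OF x]] toF[OF pre_iv[OF MN(2)] component_refl[OF x]] by auto
    moreover have "g \<in> ?V" "k \<in> ?W" using MN(3,4) gk component_refl[OF x] by auto
    moreover have "\<forall>g'\<in>?V. \<forall>k'\<in>?W. g' \<cdot> iv k' \<in> U" using MN(5) by simp
    ultimately show "\<exists>V W. openin (F x) V \<and> g \<in> V \<and> openin (F x) W \<and> k \<in> W \<and> (\<forall>g'\<in>V. \<forall>k'\<in>W. g' \<cdot> iv k' \<in> U)"
      by (intro exI[of _ ?V] exI[of _ ?W] conjI)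
  qed
  have H_fine: "openin H U" if U: "openin (TG x) U" for U
  proof (subst openin_subopen, intro ballI)
    fix u assume u: "u \<in> U"
    have uA: "u \<in> arr_over ?C" using u openin_subset[OF U] topspace_TG[OF x] by blast
    then obtain k where k: "k \<in> S x" "\<tau> k = \<sigma> u" unfolding component_def by auto
    have uk: "u \<cdot> k \<in> S x" "u \<cdot> k \<cdot> iv k = u" using arrow_as_quotient[OF _ k] uA by auto
    have uk': "u \<cdot> k \<cdot> iv k \<in> U" using uk(2) u by simp
    obtain V W where VW: "openin (F x) V" "u \<cdot> k \<in> V" "openin (F x) W" "k \<in> W"
      "\<And>g' k'. g' \<in> V \<Longrightarrow> k' \<in> W \<Longrightarrow> g' \<cdot> iv k' \<in> U"
      using openin_TG[OF x U uk(1) k(1) uk'] by metis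
    obtain M where M: "openin H M" "V = M \<inter> S x" using fromF[OF VW(1) component_refl[OF x]] by blast
    have kA: "k \<in> arr_over ?C" "\<sigma> u = \<tau> k" "u \<cdot> k \<in> M" using k component_refl[OF x] VW(2) M(2) by auto
    obtain M1 M2 where M12: "openin H M1" "openin H M2" "u \<in> M1" "k \<in> M2"
      "\<forall>u'\<in>M1. \<forall>v'\<in>M2. \<sigma> u' = \<tau> v' \<longrightarrow> u' \<cdot> v' \<in> M"
      using mul_nhd_H[OF M(1) uA kA] by (elim exE conjE)
    \<comment> \<open>An arrow \<open>v \<in> M1\<close> whose source is the target of some
      \<open>l \<in> ?W2\<close> equals \<open>v \<cdot> l \<cdot> iv l\<close> with
      \<open>v \<cdot> l \<in> V\<close> and \<open>l \<in> W\<close>, hence lies in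
      \<open>U\<close>. The equality \<open>Q_eq\<close> makes this condition on sources
      \<open>H\<close>-open.\<close>
    let ?W2 = "W \<inter> (M2 \<inter> S x)"
    have "openin (F x) ?W2" using VW(3) toF[OF M12(2) component_refl[OF x]] by (rule openin_Int)
    then have "openin Q (\<tau> ` ?W2)" unfolding Q_eq by (rule openin_tgt_image[OF x])
    then have "openin H (M1 \<inter> {u \<in> arr_over ?C. \<sigma> u \<in> \<tau> ` ?W2})" by (intro openin_Int M12(1) pre_src)
    moreover have "k \<in> ?W2" using VW(4) M12(4) k(1) by blast
    then have "u \<in> M1 \<inter> {u \<in> arr_over ?C. \<sigma> u \<in> \<tau> ` ?W2}" using M12(3) uA kA(2) by blast
    moreover have "M1 \<inter> {u \<in> arr_over ?C. \<sigma> u \<in> \<tau> ` ?W2} \<subseteq> U"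
    proof
      fix v assume v: "v \<in> M1 \<inter> {u \<in> arr_over ?C. \<sigma> u \<in> \<tau> ` ?W2}"
      then obtain l where l: "l \<in> W" "l \<in> M2" "l \<in> S x" "\<tau> l = \<sigma> v" by auto
      have vA: "v \<in> arr \<G>" "v \<in> M1" using v by auto
      have vl: "v \<cdot> l \<in> S x" "v \<cdot> l \<cdot> iv l = v" using arrow_as_quotient[OF vA(1) l(3,4)] .
      have "v \<cdot> l \<in> M" using M12(5) vA(2) l(2,4) by simp
      then have "v \<cdot> l \<in> V" unfolding M(2) using vl(1) by blast
      from VW(5)[OF this l(1)] show "v \<in> U" unfolding vl(2) .
    qed
    ultimately show "\<exists>Z. openin H Z \<and> u \<in> Z \<and> Z \<subseteq> U"
      by (intro exI[of _ "M1 \<inter> {u \<in> arr_over ?C. \<sigma> u \<in> \<tau> ` ?W2}"] conjI)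
  qed
  have "H = TG x" unfolding topology_eq using H_coarse H_fine by blast
  then show ?thesis using Q_eq by blast
qed

end

theorem mainTheorem7:
  fixes \<G> :: "('x, 'g) groupoid" and BX :: "'x measure" and BG :: "'g measure"
    and F :: "'x \<Rightarrow> 'g topology" and x :: 'x and C :: "'x set"
  assumes "borel_overt_componentwise_quasi_polish_groupoid \<G> BX BG F"
    and "x \<in> obj \<G>" and "C = component \<G> x"
  shows "compatible_component_topologies \<G> BX BG F C
           (component_topology \<G> F x) (component_arr_topology \<G> F C) \<and>
         (\<forall>TC TG. compatible_component_topologies \<G> BX BG F C TC TG \<longrightarrow>
            TC = component_topology \<G> F x \<and> TG = component_arr_topology \<G> F C)"
proof -
  interpret borel_overt_componentwise_quasi_polish_groupoid \<G> BX BG F by (rule assms(1))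
  show ?thesis
    unfolding assms(3)
    using compatible_component_topologies_existence[OF assms(2)]
      compatible_component_topologies_unique[OF assms(2)] by blast
qed

end
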